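(* Let $u_h(t)\in\mathcal V_h^r$ be the approximate solution given by the DoD-stabilized semi-discrete scheme: for all $t$ and all $w_h\in\mathcal V_h^r$, $$\int_\Omega\langle \partial_t u_h(t),w_h\rangle+a_h(u_h(t),w_h)+J_h^a(u_h(t),w_h)+s_h(u_h(t),w_h)+J_h^s(u_h(t),w_h)=0,$$ where $a_h,s_h,J_h^a,J_h^s$ are as defined in the context, and where for every small cell $E\in\mathcal I$ the set of propagation forms used in $J_h^a$ is energy preserving and reflecting. Then for any $T>0$ $$\tfrac12\|u_h(T)\|_{L^2(\Omega)}^2\le \tfrac12\|u_h(0)\|_{L^2(\Omega)}^2,$$ with equality if $S_n=0$, i.e. if there is no dissipation.
   Context: **Equation.** $c>0$ is constant, states are $u=(p,v)^T\in\mathbb R^3$ with $p\in\mathbb R$, $v=(v_1,v_2)\in\mathbb R^2$, and $\langle\cdot,\cdot\rangle$ is the Euclidean product on $\mathbb R^3$. $f_k(u)=A_ku$ with $A_1=\begin{pmatrix}0&c&0\\c&0&0\\0&0&0\end{pmatrix}$, $A_2=\begin{pmatrix}0&0&c\\0&0&0\\c&0&0\end{pmatrix}$; for a unit vector $n$, $A_n=n_1A_1+n_2A_2$ and $f_n(u)=A_nu$. Write $f(u)\cdot\nabla w=\sum_{k=1}^2\langle f_k(u),\partial_kw\rangle$. **Mesh.** $\Omega\subset\mathbb R^2$ is a domain contained in a rectangle $\widehat\Omega$ with a Cartesian background mesh $\widehat{\mathcal M}_h$. The cut-cell mesh is $\mathcal M_h=\{E=\widehat E\cap\Omega:\widehat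 E\in\widehat{\mathcal M}_h\}$ (non-empty cells; regular enough that the divergence theorem holds on each). Interior faces: $\Gamma_h^{\rm i}=\{\gamma=\bar E_1\cap\bar E_2:|\gamma|>0\}$ for distinct cells $E_1,E_2$. Boundary faces: $\Gamma_h^{\rm b}=\{\gamma=\bar E\cap\partial\Omega : |\gamma|>0\}$ (so a cell has at most one boundary face). $\Gamma_h^{\rm i}(E),\Gamma_h^{\rm b}(E)$ are the interior/boundary faces contained in $\partial E$, $\Gamma_h(E)$ is their union (which makes up $\partial E$), $\mathbb I(E)=\{1,\dots,K\}$ with $K=|\Gamma_h(E)|$ numbers the faces $\gamma_i$ of $E$; $E_i$ is the neighbor of $E$ across $\gamma_i$ if $\gamma_i$ is interior, and just an index symbol ("ghost cell") if $\gamma_i$ is a boundary face. Each interior face $\gamma$ has a fixed left cell $E_\gamma^L$ and right cell $E_\gamma^R$ and unit normal $n$ pointing from left to right; on boundary faces $n$ is the outward normal of $\Omega$. $w_\gamma^L,w_\gamma^R$ are the traces from the two sides and $\llbracket w\rrbracket=w_\gamma^L-w_\gamma^R$. $\mathcal V_h^r=\{v_h\in L^2(\Omega)^3: v_h|_E\in P^r(E)^3\ \forall E\in\mathcal M_h\}$, $P^r$ = polynomials of degree $r$. **Mirroring.** $\mathfrak M_n(p,v)=(p,\,v-2(v\cdot n)n)$ on $\mathbb R^3$. For a straight boundary face $\gamma$ with constant normal $n$, and a polynomial vector field $u=(p,v)$, $\mathfrak M_{n}(u)(x)=(p(x),\,v(x)-2(v(x^\perp)\cdot n)n)$, where $x^\perp$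 is the orthogonal projection of $x$ onto the line containing $\gamma$. **Base forms.** $$a_h(u,w)=-\sum_{E\in\mathcal M_h}\int_E f(u)\cdot\nabla w+\sum_{\gamma\in\Gamma_h^{\rm i}}\int_\gamma\langle\tfrac12[f_n(u^L_\gamma)+f_n(u^R_\gamma)],\llbracket w\rrbracket\rangle+\sum_{\gamma\in\Gamma_h^{\rm b}}\int_\gamma\langle\tfrac12[f_n(u)+f_n(\mathfrak M_n(u))],w\rangle,$$ $$s_h(u,w)=\sum_{\gamma\in\Gamma_h^{\rm i}}\int_\gamma\langle S_n(u^L_\gamma,u^R_\gamma),\llbracket w\rrbracket\rangle+\sum_{\gamma\in\Gamma_h^{\rm b}}\int_\gamma\langle S_n(u,\mathfrak M_n(u)),w\rangle.$$ Here, for each unit vector $n$, $S_n:\mathbb R^3\times\mathbb R^3\to\mathbb R^3$ is a dissipative operator, assumed linear in the sense that $S_n(a,b)=S_n^M(a-b)$ with $S_n^M\in\mathbb R^{3\times 3}$ positive semi-definite (a common choice is Lax–Friedrichs, $S_n^M=\tfrac c2 I$). **Small cells.** With $\alpha_E=|E|/|\widehat E|$ and a threshold $\alpha\in(0,1)$, $\mathcal I=\{E\in\mathcal M_h:\alpha_E<\alpha\}$. Assumptions: (i) no $E\in\mathcal I$ has a neighbor $E_i\in\mathcal I$; (ii) a boundary face of $E\in\mathcal I$ has constant normal (is contained in a line); (iii) there is $\rho>0$ with $h_E^2\le\rho|E|$ for all $E\in\mathcal I$, $h_E$ the diameter. For a time step $\Delta t>0$, the stabilization parameter is $\eta_E=1-\frac{1}{2r+1}\frac{|E|}{\Delta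 t\,c\,\max_{i\in\mathbb I(E)}|\gamma_i|}$. **Extension operators.** For $w_h\in\mathcal V_h^r$, $\mathcal L_E(w_h)$ is the polynomial vector field on the whole domain extending $w_h|_E$. For a boundary face $\gamma$, $\mathcal L_E^\gamma(w_h)=\mathfrak M_{n_\gamma}(\mathcal L_E(w_h))$. For $E\in\mathcal I$ and $i\ne j\in\mathbb I(E)$: $\mathcal L^{ij}_{E}=\mathcal L_E$; for $k\in\{i,j\}$ with $\gamma_k$ interior $\mathcal L^{ij}_{E_k}=\mathcal L_{E_k}$; if $\gamma_i$ is a boundary face, $\mathcal L^{ij}_{E_i}=\mathcal L^{\gamma_i}_{E_j}$; if $\gamma_j$ is a boundary face, $\mathcal L^{ij}_{E_j}=\mathcal L^{\gamma_j}_{E_i}$. **Propagation forms.** For $E\in\mathcal I$ and a face $\gamma$ of $E$ let $b_\gamma(u^\mu,u^\nu,w)=\int_\gamma\langle\tfrac12[f_n(u^\mu)+f_n(u^\nu)],w\rangle$ with $n$ the outward normal of $E$. A set of propagation forms on $E$ consists of maps $p_{ij}^E$ ($i\neq j\in\mathbb I(E)$), $p_V^E$, $p_V^{E,*}$ from $(P^r(E)^3)^3$ to $\mathbb R$, symmetric in the first two arguments, linear in the third, such that for all arguments $p_{ij}^E(u^\mu,u^\nu,w)+p_{ji}^E(u^\mu,u^\nu,w)=p_V^E(u^\mu,u^\nu,w)+p_V^{E,*}(u^\mu,u^\nu,w)$ for $i\ne j$, and $\sum_{i\neq j}p_{ij}^E(u^\mu,u^\nu,w)=b_{\gamma_j}(u^\mu,u^\nu,w)$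 for every $j$. It is *energy preserving* if for all $i\neq j$ and all $w,u^\mu,u^\nu\in P^r(E)^3$: (1) $\frac{2}{K(K-1)}\int_E f(w)\cdot\nabla w=\tfrac12p_{ij}^E(w,w,w)+\tfrac12p_{ji}^E(w,w,w)$; (2) $p_{ij}^E(u^\mu,u^\nu,u^\mu-u^\nu)=\tfrac12p_{ij}^E(u^\mu,u^\mu,u^\mu)-\tfrac12p_{ij}^E(u^\nu,u^\nu,u^\nu)$. It is *reflecting* if, whenever $\gamma_i$ is a boundary face of $E$, with $\mathfrak M=\mathfrak M_{n_{\gamma_i}}$, for all $j\neq i$ and all $u^\mu,u^\nu,w\in P^r(E)^3$: $p_{ji}^E(u^\mu,\mathfrak M(u^\nu),w)=-p_{ji}^E(\mathfrak M(u^\mu),u^\nu,\mathfrak M(w))$. **Stabilization.** $J_h^a=\sum_{E\in\mathcal I}(J_h^{0,E}+J_h^{1,E})$, $J_h^s=\sum_{E\in\mathcal I}J_h^{s,E}$ with (sums over pairs $i<j$ in $\mathbb I(E)$) $$J_h^{0,E}(u,w)=\eta_E\sum_{i<j}J_{h,ij}^{0,E}(u,w)-\eta_E\sum_{\gamma\in\Gamma_h^{\rm i}(E)}\int_\gamma\langle\tfrac12[f_n(u_\gamma^L)+f_n(u_\gamma^R)],\llbracket w\rrbracket\rangle-\eta_E\sum_{\gamma\in\Gamma_h^{\rm b}(E)}\int_\gamma\langle\tfrac12[f_n(u)+f_n(\mathfrak M_n(u))],w\rangle,$$ $$J_h^{1,E}(u,w)=\eta_E\sum_{i<j}J_{h,ij}^{1,E}(u,w),$$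 $$J_h^{s,E}(u,w)=\eta_E\sum_{i<j}J_{ij}^{s,E}(u,w)-\eta_E\sum_{\gamma\in\Gamma_h^{\rm i}(E)}\int_\gamma\langle S_n(u_\gamma^L,u_\gamma^R),\llbracket w\rrbracket\rangle-\eta_E\sum_{\gamma\in\Gamma_h^{\rm b}(E)}\int_\gamma\langle S_n(u,\mathfrak M_n(u)),w\rangle.$$ If $\gamma_i,\gamma_j$ are interior: $J_{h,ij}^{0,E}(u,w)=p_{ij}^E(\mathcal L_{E_i}u,\mathcal L_{E_j}u,\mathcal L_Ew-\mathcal L_{E_j}w)+p_{ji}^E(\mathcal L_{E_i}u,\mathcal L_{E_j}u,\mathcal L_Ew-\mathcal L_{E_i}w)$. If one of the two faces is a boundary face, call it $\gamma_i$ (exchanging the roles of $i,j$ if needed): $J_{h,ij}^{0,E}(u,w)=p_{ij}^E(\mathcal L_{E_j}^{\gamma_i}u,\mathcal L_{E_j}u,\mathcal L_Ew-\mathcal L_{E_j}w)+p_{ji}^E(\mathcal L_{E_j}^{\gamma_i}u,\mathcal L_{E_j}u,\mathcal L_Ew)$. With $\omega_E=-1$ and $\omega_{E_i}=\omega_{E_j}=\tfrac12$, $$J_{h,ij}^{1,E}(u,w)=\sum_{\mathcal E\in\{E,E_i,E_j\}}\omega_{\mathcal E}\Big[p_V^E(\mathcal L_{E_i}^{ij}u,\mathcal L_{E_j}^{ij}u,\mathcal L_{\mathcal E}^{ij}w)-\tfrac{2}{K(K-1)}\int_Ef(\mathcal L_{\mathcal E}^{ij}u)\cdot\nabla\mathcal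 L_{\mathcal E}^{ij}w+p_V^{E,*}(\mathcal L_{E_i}^{ij}w,\mathcal L_{E_j}^{ij}w,\mathcal L_{\mathcal E}^{ij}u)\Big].$$ $$J_{ij}^{s,E}(u,w)=\tfrac16\sum_{\gamma\in\Gamma_h(E)}\int_\gamma\Big(\langle S_n(\mathcal L_{E_i}^{ij}u,\mathcal L_{E_j}^{ij}u),\mathcal L_{E_i}^{ij}w-\mathcal L_{E_j}^{ij}w\rangle+\langle S_n(\mathcal L_{E_j}^{ij}u,\mathcal L_{E_i}^{ij}u),\mathcal L_{E_j}^{ij}w-\mathcal L_{E_i}^{ij}w\rangle\Big).$$
   Formalization: The inequality is proved assuming η_E ≥ 0 for all small cells (false for very small Δt), and S_n is also assumed dissipative at reflecting walls, ⟨S_n(a, M_n a), a⟩ ≥ 0, which positive semi-definiteness of S_n^M does not imply; the equality for S_n = 0 needs neither restriction. *)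

theory Defs
  imports "HOL-Analysis.Analysis"
begin

section \<open>One-dimensional Hausdorff measure\<close>

(* The length of faces, which may be curved, and all face integrals are taken with respect to this
   measure; hausdorff_measure_space shows that length_measure is not the degenerate zero measure
   that measure_of returns for a set function which is not countably additive. *)

definition hausdorff_pre :: "real \<Rightarrow> 'a::metric_space set \<Rightarrow> ennreal" where
  "hausdorff_pre \<delta> A = (INF U\<in>{U :: nat \<Rightarrow> 'a set. A \<subseteq> (\<Union>i. U i) \<and> (\<forall>i. bounded (U i) \<and> diameter (U i) \<le> \<delta>)}.
     \<Sum>i. ennreal (diameter (U i)))"

definition hausdorff_outer :: "'a::metric_space set \<Rightarrow> ennreal" where
  "hausdorff_outer A = (SUP \<delta>\<in>{0<..}. hausdorff_pre \<delta> A)"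

lemma hausdorff_pre_le: "A \<subseteq> (\<Union>i. U i) \<Longrightarrow> (\<And>i. bounded (U i)) \<Longrightarrow> (\<And>i. diameter (U i) \<le> \<delta>) \<Longrightarrow>
   hausdorff_pre \<delta> A \<le> (\<Sum>i. ennreal (diameter (U i)))"
  unfolding hausdorff_pre_def by (intro INF_lower) auto

lemma hausdorff_pre_mono: "A \<subseteq> B \<Longrightarrow> hausdorff_pre \<delta> A \<le> hausdorff_pre \<delta> B"
  unfolding hausdorff_pre_def by (intro INF_superset_mono) auto

lemma hausdorff_pre_antimono: "\<delta> \<le> \<epsilon> \<Longrightarrow> hausdorff_pre \<epsilon> A \<le> hausdorff_pre \<delta> A"
  unfolding hausdorff_pre_def by (intro INF_superset_mono) (auto intro: order_trans)

lemma hausdorff_outer_mono: "A \<subseteq> B \<Longrightarrow> hausdorff_outer A \<le> hausdorff_outer B"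
  unfolding hausdorff_outer_def by (intro SUP_mono) (auto intro: hausdorff_pre_mono)

lemma hausdorff_outer_empty: "hausdorff_outer {} = 0"
proof -
  have "hausdorff_pre \<delta> ({}::'a set) = 0" if "\<delta> > 0" for \<delta>
    using hausdorff_pre_le[of "{}" "\<lambda>_. {}" \<delta>] that by simp
  then show ?thesis unfolding hausdorff_outer_def by simp
qed

lemma hausdorff_outer_seq: "hausdorff_outer A = (SUP n. hausdorff_pre (1 / real (Suc n)) A)"
  unfolding hausdorff_outer_def
proof (rule antisym)
  show "(SUP \<delta>\<in>{0<..}. hausdorff_pre \<delta> A) \<le> (SUP n. hausdorff_pre (1 / real (Suc n)) A)"
  proof (rule SUP_mono)
    fix \<delta> :: real assume "\<delta> \<in> {0<..}"
    then obtain n where "1 / real (Suc n) < \<delta>"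
      using nat_approx_posE[of \<delta>] by auto
    then show "\<exists>n\<in>UNIV. hausdorff_pre \<delta> A \<le> hausdorff_pre (1 / real (Suc n)) A"
      by (intro bexI[of _ n] hausdorff_pre_antimono) auto
  qed
  show "(SUP n. hausdorff_pre (1 / real (Suc n)) A) \<le> (SUP \<delta>\<in>{0<..}. hausdorff_pre \<delta> A)"
    by (intro SUP_mono) (auto intro!: bexI[of _ "1 / real (Suc n)" for n] simp del: of_nat_Suc)
qed

lemma hausdorff_pre_countable_subadd:
  "hausdorff_pre \<delta> (\<Union>i. A i) \<le> (\<Sum>i. hausdorff_pre \<delta> (A i))"
proof (rule ennreal_le_epsilon)
    fix e :: real assume e: "0 < e" and "(\<Sum>i. hausdorff_pre \<delta> (A i)) < top"
    then have *: "hausdorff_pre \<delta> (A n) < hausdorff_pre \<delta> (A n) + e * (1/2)^Suc n" for n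
      by (auto simp add: less_top dest!: ennreal_suminf_lessD)
    have "\<exists>U :: nat \<Rightarrow> 'a set. A n \<subseteq> (\<Union>i. U i) \<and> (\<forall>i. bounded (U i) \<and> diameter (U i) \<le> \<delta>) \<and>
        (\<Sum>i. ennreal (diameter (U i))) \<le> hausdorff_pre \<delta> (A n) + ennreal (e * (1/2)^Suc n)" for n
    proof -
      obtain U :: "nat \<Rightarrow> 'a set" where "A n \<subseteq> (\<Union>i. U i)" "\<forall>i. bounded (U i) \<and> diameter (U i) \<le> \<delta>"
        "(\<Sum>i. ennreal (diameter (U i))) < hausdorff_pre \<delta> (A n) + ennreal (e * (1/2)^Suc n)"
        using *[of n] unfolding hausdorff_pre_def[of \<delta> "A n"] INF_less_iff by blast
      then show ?thesis by (intro exI[of _ U]) auto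
    qed
    then obtain U :: "nat \<Rightarrow> nat \<Rightarrow> 'a set" where U: "\<And>n. A n \<subseteq> (\<Union>i. U n i)" "\<And>n i. bounded (U n i)"
      "\<And>n i. diameter (U n i) \<le> \<delta>"
      "\<And>n. (\<Sum>i. ennreal (diameter (U n i))) \<le> hausdorff_pre \<delta> (A n) + ennreal (e * (1/2)^Suc n)"
      by metis
    define V where "V k = (case prod_decode k of (n, i) \<Rightarrow> U n i)" for k
    have "(\<Union>i. A i) \<subseteq> (\<Union>k. V k)"
    proof
      fix x assume "x \<in> (\<Union>i. A i)"
      then obtain n i where "x \<in> U n i" using U(1) by blast
      then have "x \<in> V (prod_encode (n, i))" by (simp add: V_def)
      then show "x \<in> (\<Union>k. V k)" by blast
    qed
    then have "hausdorff_pre \<delta> (\<Union>i. A i) \<le> (\<Sum>k. ennreal (diameter (V k)))"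
      by (rule hausdorff_pre_le) (auto simp: V_def U split: prod.split)
    also have "\<dots> = (\<Sum>k. (\<lambda>(n,i). ennreal (diameter (U n i))) (prod_decode k))"
      by (intro arg_cong[of _ _ suminf] ext) (simp add: V_def split: prod.split)
    also have "\<dots> = (\<Sum>n. \<Sum>i. ennreal (diameter (U n i)))"
      by (rule suminf_ennreal_2dimen) simp
    also have "\<dots> \<le> (\<Sum>n. hausdorff_pre \<delta> (A n) + ennreal (e * (1/2)^Suc n))"
      by (intro suminf_le U(4)) auto
    also have "\<dots> = (\<Sum>n. hausdorff_pre \<delta> (A n)) + (\<Sum>n. ennreal (e * (1/2)^Suc n))"
      by (intro suminf_add[symmetric]) auto
    also have "(\<Sum>n. ennreal (e * (1/2)^Suc n)) = ennreal e"
      using sums_mult[OF power_half_series, of e] e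
      by (intro suminf_ennreal_eq) auto
    finally show "hausdorff_pre \<delta> (\<Union>i. A i) \<le> (\<Sum>n. hausdorff_pre \<delta> (A n)) + ennreal e" .
qed

lemma hausdorff_outer_countable_subadd: "hausdorff_outer (\<Union>i. A i) \<le> (\<Sum>i. hausdorff_outer (A i))"
  unfolding hausdorff_outer_def[of "\<Union>i. A i"]
proof (rule SUP_least)
  fix \<delta> :: real assume "\<delta> \<in> {0<..}"
  then show "hausdorff_pre \<delta> (\<Union>i. A i) \<le> (\<Sum>i. hausdorff_outer (A i))"
    by (intro order_trans[OF hausdorff_pre_countable_subadd] suminf_le)
       (auto simp: hausdorff_outer_def intro!: SUP_upper)
qed

lemma hausdorff_outer_subadd: "hausdorff_outer (A \<union> B) \<le> hausdorff_outer A + hausdorff_outer B"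
proof -
  have "hausdorff_outer (\<Union>i. binaryset A B i) \<le> (\<Sum>i. hausdorff_outer (binaryset A B i))"
    by (rule hausdorff_outer_countable_subadd)
  also have "\<dots> = hausdorff_outer A + hausdorff_outer B"
    by (rule suminf_binaryset_eq) (rule hausdorff_outer_empty)
  finally show ?thesis by (simp add: UN_binaryset_eq)
qed

lemma hausdorff_outer_metric:
  assumes d: "d > 0" "\<And>x y. x \<in> A \<Longrightarrow> y \<in> B \<Longrightarrow> dist x y \<ge> d"
  shows "hausdorff_outer A + hausdorff_outer B \<le> hausdorff_outer (A \<union> B)"
proof -
  have pre: "hausdorff_pre \<delta> A + hausdorff_pre \<delta> B \<le> hausdorff_pre \<delta> (A \<union> B)" if "\<delta> < d" "0 < \<delta>" for \<delta>
    unfolding hausdorff_pre_def[of \<delta> "A \<union> B"]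
  proof (rule INF_greatest, clarsimp)
    fix U :: "nat \<Rightarrow> 'a set" assume U: "A \<subseteq> (\<Union>i. U i)" "B \<subseteq> (\<Union>i. U i)" "\<forall>i. bounded (U i) \<and> diameter (U i) \<le> \<delta>"
    define V W where "V i = (if U i \<inter> A \<noteq> {} then U i else {})" and "W i = (if U i \<inter> B \<noteq> {} then U i else {})" for i
    have disj: "U i \<inter> A = {} \<or> U i \<inter> B = {}" for i
    proof (rule ccontr)
      assume "\<not> ?thesis"
      then obtain x y where "x \<in> U i" "x \<in> A" "y \<in> U i" "y \<in> B" by blast
      then show False using d(2)[of x y] diameter_bounded_bound[of "U i" x y] U(3)[rule_format, of i] that by auto
    qed
    have "hausdorff_pre \<delta> A \<le> (\<Sum>i. ennreal (diameter (V i)))"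
    proof (rule hausdorff_pre_le)
      show "A \<subseteq> \<Union> (range V)"
      proof
        fix x assume "x \<in> A"
        then obtain i where "x \<in> U i" using U(1) by blast
        with \<open>x \<in> A\<close> have "x \<in> V i" by (auto simp: V_def)
        then show "x \<in> \<Union> (range V)" by blast
      qed
    qed (use U(3) that in \<open>auto simp: V_def\<close>)
    moreover have "hausdorff_pre \<delta> B \<le> (\<Sum>i. ennreal (diameter (W i)))"
    proof (rule hausdorff_pre_le)
      show "B \<subseteq> \<Union> (range W)"
      proof
        fix x assume "x \<in> B"
        then obtain i where "x \<in> U i" using U(2) by blast
        with \<open>x \<in> B\<close> have "x \<in> W i" by (auto simp: W_def)
        then show "x \<in> \<Union> (range W)" by blast
      qed
    qed (use U(3) that in \<open>auto simp: W_def\<close>)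
    ultimately have "hausdorff_pre \<delta> A + hausdorff_pre \<delta> B \<le> (\<Sum>i. ennreal (diameter (V i))) + (\<Sum>i. ennreal (diameter (W i)))"
      by (rule add_mono)
    also have "\<dots> = (\<Sum>i. ennreal (diameter (V i)) + ennreal (diameter (W i)))"
      by (intro suminf_add) auto
    also have "\<dots> \<le> (\<Sum>i. ennreal (diameter (U i)))"
      by (intro suminf_le) (use disj in \<open>auto simp: V_def W_def\<close>)
    finally show "hausdorff_pre \<delta> A + hausdorff_pre \<delta> B \<le> (\<Sum>i. ennreal (diameter (U i)))" .
  qed
  have inc: "incseq (\<lambda>n. hausdorff_pre (1 / real (Suc n)) X)" for X :: "'a set"
    by (intro incseq_SucI hausdorff_pre_antimono) (simp add: field_simps)
  have "hausdorff_outer A + hausdorff_outer B =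
     (SUP n. hausdorff_pre (1 / real (Suc n)) A + hausdorff_pre (1 / real (Suc n)) B)"
    unfolding hausdorff_outer_seq by (rule ennreal_SUP_add[symmetric]) (rule inc)+
  also have "\<dots> \<le> hausdorff_outer (A \<union> B)"
  proof (rule SUP_least)
    fix n
    obtain m where m: "1 / real (Suc m) < d" using nat_approx_posE[OF d(1)] by auto
    let ?k = "max m n"
    have k: "1 / real (Suc ?k) \<le> 1 / real (Suc m)" "1 / real (Suc ?k) \<le> 1 / real (Suc n)"
      by (auto intro!: divide_left_mono)
    have "hausdorff_pre (1 / real (Suc n)) A + hausdorff_pre (1 / real (Suc n)) B \<le>
       hausdorff_pre (1 / real (Suc ?k)) A + hausdorff_pre (1 / real (Suc ?k)) B"
      by (intro add_mono hausdorff_pre_antimono k)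
    also have "\<dots> \<le> hausdorff_pre (1 / real (Suc ?k)) (A \<union> B)"
      using k m by (intro pre) auto
    also have "\<dots> \<le> hausdorff_outer (A \<union> B)"
      unfolding hausdorff_outer_seq by (rule SUP_upper) simp
    finally show "hausdorff_pre (1 / real (Suc n)) A + hausdorff_pre (1 / real (Suc n)) B \<le> hausdorff_outer (A \<union> B)" .
  qed
  finally show ?thesis .
qed

lemma ennreal_suminf_tail:
  fixes f :: "nat \<Rightarrow> ennreal"
  assumes "(\<Sum>i. f i) \<noteq> \<infinity>"
  shows "(\<lambda>n. \<Sum>i. f (i + n)) \<longlonglongrightarrow> 0"
proof -
  have "f i \<noteq> top" for i
    using assms by (auto dest!: ennreal_suminf_lessD[of f top i, rotated] simp: less_top)
  then have f: "f i = ennreal (enn2real (f i))" for i by (simp add: less_top)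
  have sm: "summable (\<lambda>i. enn2real (f i))"
    using assms f by (intro summable_suminf_not_top) auto
  have "(\<Sum>i. f (i + n)) = ennreal (\<Sum>i. enn2real (f (i + n)))" for n
    using f summable_ignore_initial_segment[OF sm, of n] by (subst suminf_ennreal2[symmetric]) auto
  then show ?thesis
    using tendsto_ennrealI[OF suminf_exist_split2[OF sm]] by simp
qed

lemma hausdorff_outer_metric_sum:
  fixes R :: "nat \<Rightarrow> 'a::metric_space set"
  assumes "\<And>i j. i < j \<Longrightarrow> \<exists>d>0. \<forall>x\<in>R i. \<forall>y\<in>R j. dist x y \<ge> d"
  shows "(\<Sum>i<n. hausdorff_outer (R i)) \<le> hausdorff_outer (\<Union>i<n. R i)"
proof (induction n)
  case (Suc n)
  obtain d where d: "\<And>i. i < n \<Longrightarrow> d i > 0" "\<And>i x y. i < n \<Longrightarrow> x \<in> R i \<Longrightarrow> y \<in> R n \<Longrightarrow> dist x y \<ge> d i"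
    using assms[of _ n] by metis
  define D where "D = Min (insert 1 (d ` {..<n}))"
  have D: "D > 0" "\<And>i. i < n \<Longrightarrow> D \<le> d i" using d(1) by (auto simp: D_def)
  have "(\<Sum>i<Suc n. hausdorff_outer (R i)) \<le> hausdorff_outer (\<Union>i<n. R i) + hausdorff_outer (R n)"
    using Suc by (simp add: add_right_mono)
  also have "\<dots> \<le> hausdorff_outer ((\<Union>i<n. R i) \<union> R n)"
    by (intro hausdorff_outer_metric[OF D(1)]) (use D(2) d(2) order_trans in blast)
  also have "(\<Union>i<n. R i) \<union> R n = (\<Union>i<Suc n. R i)" by (auto simp: less_Suc_eq)
  finally show ?case .
qed simp

lemma hausdorff_outer_closed:
  assumes C: "closed C"
  shows "hausdorff_outer (a \<inter> C) + hausdorff_outer (a - C) \<le> hausdorff_outer a"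
proof (cases "C = {} \<or> hausdorff_outer a = \<infinity>")
  case True then show ?thesis by (auto simp: hausdorff_outer_empty)
next
  case False
  define A where "A n = {x \<in> a. infdist x C \<ge> 1 / real (Suc n)}" for n
  define R where "R n = A (Suc n) - A n" for n
  have fin: "hausdorff_outer a < \<infinity>" and ne: "C \<noteq> {}" using False by (auto simp: less_top)
  have sep: "\<exists>d>0. \<forall>x\<in>R i. \<forall>y\<in>R j. dist x y \<ge> d" if "Suc i < j" for i j
  proof (intro exI[of _ "1 / real (Suc (Suc i)) - 1 / real (Suc j)"] conjI ballI)
    show "0 < 1 / real (Suc (Suc i)) - 1 / real (Suc j)"
      using that frac_less2[of 1 1 "real (Suc (Suc i))" "real (Suc j)"] by simp
    fix x y assume "x \<in> R i" "y \<in> R j"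
    then have "infdist x C \<ge> 1 / real (Suc (Suc i))" "infdist y C < 1 / real (Suc j)"
      by (auto simp: R_def A_def)
    then show "1 / real (Suc (Suc i)) - 1 / real (Suc j) \<le> dist x y"
      using infdist_triangle[of x C y] by linarith
  qed
  have Ra: "R i \<subseteq> a" for i by (auto simp: R_def A_def)
  have "(\<Sum>i. hausdorff_outer (R (2 * i))) \<le> hausdorff_outer a"
    by (intro suminf_le_const summableI order_trans[OF hausdorff_outer_metric_sum] hausdorff_outer_mono UN_least Ra sep) auto
  then have ev: "(\<Sum>i. hausdorff_outer (R (2 * i))) \<noteq> \<infinity>" using fin by (auto simp: top_unique)
  have "(\<Sum>i. hausdorff_outer (R (2 * i + 1))) \<le> hausdorff_outer a"
    by (intro suminf_le_const summableI order_trans[OF hausdorff_outer_metric_sum] hausdorff_outer_mono UN_least Ra sep) auto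
  then have od: "(\<Sum>i. hausdorff_outer (R (2 * i + 1))) \<noteq> \<infinity>" using fin by (auto simp: top_unique)
  have bound: "hausdorff_outer (a \<inter> C) + hausdorff_outer (a - C) \<le>
     hausdorff_outer a + ((\<Sum>i. hausdorff_outer (R (2 * (i + n)))) + (\<Sum>i. hausdorff_outer (R (2 * (i + n) + 1))))" for n
  proof -
    let ?T = "\<Union>i. R (2 * (i + n))" and ?T' = "\<Union>i. R (2 * (i + n) + 1)"
    have "a - C \<subseteq> A (2 * n) \<union> (?T \<union> ?T')"
    proof
      fix x assume x: "x \<in> a - C"
      have "infdist x C > 0" using x C ne in_closed_iff_infdist_zero[OF C ne, of x] infdist_nonneg[of x C] by auto
      then obtain k where k: "1 / real (Suc k) < infdist x C" using nat_approx_posE by metis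
      define m where "m = (LEAST k. x \<in> A k)"
      have ex: "x \<in> A k" using k x by (auto simp: A_def)
      have m: "x \<in> A m" unfolding m_def by (rule LeastI) (rule ex)
      show "x \<in> A (2 * n) \<union> (?T \<union> ?T')"
      proof (cases "m \<le> 2 * n")
        case True
        have "1 / real (Suc (2 * n)) \<le> 1 / real (Suc m)" using True by (intro divide_left_mono) auto
        then show ?thesis using m by (auto simp: A_def)
      next
        case False
        then obtain l where l: "m = Suc l" "2 * n \<le> l" by (cases m) auto
        have "x \<notin> A l" using not_less_Least[of l "\<lambda>k. x \<in> A k"] l by (auto simp: m_def)
        then have xl: "x \<in> R l" using m l by (simp add: R_def)
        show ?thesis
        proof (cases "even l")
          case True
          then have "l = 2 * ((l div 2 - n) + n)" using l by auto
          then show ?thesis using xl by (metis UN_I UNIV_I Un_iff)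
        next
          case False
          then have "l = 2 * ((l div 2 - n) + n) + 1" using l by (auto elim!: oddE)
          then show ?thesis using xl by (metis UN_I UNIV_I Un_iff)
        qed
      qed
    qed
    then have "hausdorff_outer (a - C) \<le> hausdorff_outer (A (2 * n) \<union> (?T \<union> ?T'))" by (rule hausdorff_outer_mono)
    also have "\<dots> \<le> hausdorff_outer (A (2 * n)) + (hausdorff_outer ?T + hausdorff_outer ?T')"
      by (intro order_trans[OF hausdorff_outer_subadd] add_left_mono hausdorff_outer_subadd)
    also have "\<dots> \<le> hausdorff_outer (A (2 * n)) + ((\<Sum>i. hausdorff_outer (R (2 * (i + n)))) + (\<Sum>i. hausdorff_outer (R (2 * (i + n) + 1))))"
      by (intro add_left_mono add_mono hausdorff_outer_countable_subadd)
    finally have 1: "hausdorff_outer (a - C) \<le> \<dots>" .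
    have "hausdorff_outer (a \<inter> C) + hausdorff_outer (A (2 * n)) \<le> hausdorff_outer ((a \<inter> C) \<union> A (2 * n))"
    proof (rule hausdorff_outer_metric)
      show "0 < 1 / real (Suc (2 * n))" by simp
      fix x y assume "x \<in> a \<inter> C" "y \<in> A (2 * n)"
      then show "1 / real (Suc (2 * n)) \<le> dist x y"
        using infdist_le[of x C y] by (auto simp: A_def dist_commute)
    qed
    also have "\<dots> \<le> hausdorff_outer a" by (intro hausdorff_outer_mono) (auto simp: A_def)
    finally show ?thesis using 1 by (smt (verit) add.assoc add_left_mono add_right_mono order_trans)
  qed
  have "(\<lambda>n. (\<Sum>i. hausdorff_outer (R (2 * (i + n)))) + (\<Sum>i. hausdorff_outer (R (2 * (i + n) + 1)))) \<longlonglongrightarrow> 0 + 0"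
    using ev od using ennreal_suminf_tail[of "\<lambda>i. hausdorff_outer (R (2 * i))"] ennreal_suminf_tail[of "\<lambda>i. hausdorff_outer (R (2 * i + 1))"]
    by (intro tendsto_add) auto
  then have "(\<lambda>n. hausdorff_outer a + ((\<Sum>i. hausdorff_outer (R (2 * (i + n)))) + (\<Sum>i. hausdorff_outer (R (2 * (i + n) + 1))))) \<longlonglongrightarrow> hausdorff_outer a + 0"
    by (intro tendsto_add tendsto_const) simp
  then show ?thesis
    using bound by (intro LIMSEQ_le_const[where X="\<lambda>n. hausdorff_outer a + ((\<Sum>i. hausdorff_outer (R (2 * (i + n)))) + (\<Sum>i. hausdorff_outer (R (2 * (i + n) + 1))))"]) auto
qed

lemma hausdorff_outer_space: "outer_measure_space (Pow UNIV) hausdorff_outer"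
  unfolding outer_measure_space_def positive_def increasing_def countably_subadditive_def
  by (auto simp: hausdorff_outer_empty hausdorff_outer_mono hausdorff_outer_countable_subadd)

lemma hausdorff_measure_space: "measure_space UNIV (sets borel) hausdorff_outer"
proof -
  interpret P: sigma_algebra UNIV "Pow UNIV :: 'a set set" by (rule sigma_algebra_Pow)
  let ?L = "lambda_system UNIV (Pow UNIV) (hausdorff_outer :: 'a set \<Rightarrow> ennreal)"
  have ms: "measure_space UNIV ?L hausdorff_outer"
    by (rule P.caratheodory_lemma) (rule hausdorff_outer_space)
  then interpret L: sigma_algebra UNIV ?L by (simp add: measure_space_def)
  have "C \<in> ?L" if "closed C" for C :: "'a set"
    unfolding P.lambda_system_eq
  proof (clarsimp, rule antisym)
    fix x :: "'a set"
    show "hausdorff_outer (x \<inter> C) + hausdorff_outer (x - C) \<le> hausdorff_outer x"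
      using that by (rule hausdorff_outer_closed)
    show "hausdorff_outer x \<le> hausdorff_outer (x \<inter> C) + hausdorff_outer (x - C)"
      using hausdorff_outer_subadd[of "x \<inter> C" "x - C"] by (simp add: Int_Diff_Un)
  qed
  then have "sigma_sets UNIV {S :: 'a set. closed S} \<subseteq> ?L"
    by (intro L.sigma_sets_subset) auto
  then have sub: "sets (borel :: 'a measure) \<subseteq> ?L"
    by (simp add: borel_eq_closed)
  have "sigma_algebra UNIV (sets (borel :: 'a measure))" using sets.sigma_algebra_axioms[of "borel :: 'a measure"] by simp
  then show ?thesis
    using ms sub by (auto simp: measure_space_def positive_def countably_additive_def)
qed

definition length_measure :: "'a::metric_space measure" where
  "length_measure = measure_of UNIV (sets borel) hausdorff_outer"

lemma sets_length_measure [simp, measurable_cong]: "sets length_measure = sets borel"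
  unfolding length_measure_def using sets.sigma_sets_eq[of borel] by (simp add: sets_measure_of_conv)
lemma space_length_measure [simp]: "space length_measure = UNIV"
  unfolding length_measure_def by (simp add: space_measure_of_conv)
lemma emeasure_length_measure: "A \<in> sets borel \<Longrightarrow> emeasure length_measure A = hausdorff_outer A"
  unfolding length_measure_def
  using hausdorff_measure_space
  by (intro emeasure_measure_of_sigma) (auto simp: measure_space_def)

section \<open>The plane, the state space and the wave equation\<close>

type_synonym pt = "real^2"
type_synonym st = "real^3"
type_synonym field = "pt \<Rightarrow> st"

definition state :: "real \<Rightarrow> real^2 \<Rightarrow> st" where
  "state p v = vector [p, v$1, v$2]"

definition vel :: "st \<Rightarrow> real^2" where
  "vel u = vector [u$2, u$3]"

definition A_mat :: "real \<Rightarrow> 2 \<Rightarrow> real^3^3" where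
  "A_mat c k = (if k = 1
     then vector [vector [0, c, 0], vector [c, 0, 0], vector [0, 0, 0]]
     else vector [vector [0, 0, c], vector [0, 0, 0], vector [c, 0, 0]])"

definition flux :: "real \<Rightarrow> pt \<Rightarrow> st \<Rightarrow> st" where
  "flux c n u = (\<Sum>k\<in>UNIV. n$k *\<^sub>R A_mat c k) *v u"

definition partial :: "2 \<Rightarrow> (pt \<Rightarrow> 'a::real_normed_vector) \<Rightarrow> pt \<Rightarrow> 'a" where
  "partial k w x = frechet_derivative w (at x) (axis k 1)"

(* the density f(u) . grad w *)
definition flux_grad :: "real \<Rightarrow> field \<Rightarrow> field \<Rightarrow> pt \<Rightarrow> real" where
  "flux_grad c u w x = (\<Sum>k\<in>UNIV. (A_mat c k *v u x) \<bullet> partial k w x)"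

definition mirror :: "pt \<Rightarrow> st \<Rightarrow> st" where
  "mirror n u = state (u$1) (vel u - (2 * (vel u \<bullet> n)) *\<^sub>R n)"

(* For a straight face g the affine hull is the line containing g, and closest_point is the
   orthogonal projection onto it. *)
definition mirror_ext :: "pt set \<Rightarrow> pt \<Rightarrow> field \<Rightarrow> field" where
  "mirror_ext g n u x = state (u x $ 1)
     (vel (u x) - (2 * (vel (u (closest_point (affine hull g) x)) \<bullet> n)) *\<^sub>R n)"

(* Polynomials of total degree at most r.  Since a polynomial is determined by its values on a
   nonempty open set, P^r(E) is represented by functions on the whole plane for every cell E. *)
definition poly1 :: "nat \<Rightarrow> (pt \<Rightarrow> real) set" where
  "poly1 r = {q. \<exists>a :: nat \<Rightarrow> nat \<Rightarrow> real. \<forall>x. q x = (\<Sum>i\<le>r. \<Sum>j\<le>r - i. a i j * (x$1)^i * (x$2)^j)}"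

definition poly3 :: "nat \<Rightarrow> field set" where
  "poly3 r = {q. \<forall>k. (\<lambda>x. q x $ k) \<in> poly1 r}"


section \<open>Cut-cell meshes\<close>

(* Omega: the domain; xgrid, ygrid: the increasing grid coordinates of the Cartesian background
   mesh of the rectangle; leftc g, rightc g: the cells chosen as left and right cell of an interior
   face g; normal g x: the unit normal on the face g (left to right, or outward at a boundary face);
   face E i: the i-th face of the cell E. *)
record cut_mesh =
  Omega :: "pt set"
  xgrid :: "real list"
  ygrid :: "real list"
  leftc :: "pt set \<Rightarrow> pt set"
  rightc :: "pt set \<Rightarrow> pt set"
  normal :: "pt set \<Rightarrow> pt \<Rightarrow> pt"
  face :: "pt set \<Rightarrow> nat \<Rightarrow> pt set"

(* Cells are open sets, so that a nonempty cell has positive area. *)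
definition bg_cells :: "cut_mesh \<Rightarrow> pt set set" where
  "bg_cells M = {box (vector [xgrid M ! i, ygrid M ! j]) (vector [xgrid M ! Suc i, ygrid M ! Suc j]) | i j.
     Suc i < length (xgrid M) \<and> Suc j < length (ygrid M)}"

definition cells :: "cut_mesh \<Rightarrow> pt set set" where
  "cells M = {B \<inter> Omega M | B. B \<in> bg_cells M \<and> B \<inter> Omega M \<noteq> {}}"

definition int_faces :: "cut_mesh \<Rightarrow> pt set set" where
  "int_faces M = {closure E1 \<inter> closure E2 | E1 E2. E1 \<in> cells M \<and> E2 \<in> cells M \<and> E1 \<noteq> E2 \<and>
     0 < emeasure length_measure (closure E1 \<inter> closure E2)}"

definition bd_faces :: "cut_mesh \<Rightarrow> pt set set" where
  "bd_faces M = {closure E \<inter> frontier (Omega M) | E. E \<in> cells M \<and>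
     0 < emeasure length_measure (closure E \<inter> frontier (Omega M))}"

definition int_faces_of :: "cut_mesh \<Rightarrow> pt set \<Rightarrow> pt set set" where
  "int_faces_of M E = {g \<in> int_faces M. g \<subseteq> frontier E}"

definition bd_faces_of :: "cut_mesh \<Rightarrow> pt set \<Rightarrow> pt set set" where
  "bd_faces_of M E = {g \<in> bd_faces M. g \<subseteq> frontier E}"

definition faces_of :: "cut_mesh \<Rightarrow> pt set \<Rightarrow> pt set set" where
  "faces_of M E = int_faces_of M E \<union> bd_faces_of M E"

definition nfaces :: "cut_mesh \<Rightarrow> pt set \<Rightarrow> nat" where
  "nfaces M E = card (faces_of M E)"

definition idx :: "cut_mesh \<Rightarrow> pt set \<Rightarrow> nat set" where
  "idx M E = {1..nfaces M E}"

definition idx_pairs :: "cut_mesh \<Rightarrow> pt set \<Rightarrow> (nat \<times> nat) set" where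
  "idx_pairs M E = {(i, j). i \<in> idx M E \<and> j \<in> idx M E \<and> i < j}"

definition nbr :: "cut_mesh \<Rightarrow> pt set \<Rightarrow> pt set \<Rightarrow> pt set" where
  "nbr M E g = (if leftc M g = E then rightc M g else leftc M g)"

definition bd_cell :: "cut_mesh \<Rightarrow> pt set \<Rightarrow> pt set" where
  "bd_cell M g = (THE E. E \<in> cells M \<and> g = closure E \<inter> frontier (Omega M))"

definition outn :: "cut_mesh \<Rightarrow> pt set \<Rightarrow> pt set \<Rightarrow> pt \<Rightarrow> pt" where
  "outn M E g x = (if g \<in> int_faces M \<and> rightc M g = E then - normal M g x else normal M g x)"

(* Up to cones around the tangent line of arbitrarily small opening, A lies locally on the side
   of x opposite to n, and only there. *)
definition is_outward_normal :: "pt set \<Rightarrow> pt \<Rightarrow> pt \<Rightarrow> bool" where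
  "is_outward_normal A x n \<longleftrightarrow> norm n = 1 \<and>
     (\<forall>e>0. \<forall>\<^sub>F y in nhds x. ((y - x) \<bullet> n < - e * norm (y - x) \<longrightarrow> y \<in> A) \<and>
                            ((y - x) \<bullet> n > e * norm (y - x) \<longrightarrow> y \<notin> A))"

definition C1_field :: "(pt \<Rightarrow> pt) \<Rightarrow> bool" where
  "C1_field F \<longleftrightarrow> (\<forall>x. F differentiable (at x)) \<and> (\<forall>k. continuous_on UNIV (partial k F))"

definition cartesian_domain :: "cut_mesh \<Rightarrow> bool" where
  "cartesian_domain M \<longleftrightarrow>
     2 \<le> length (xgrid M) \<and> 2 \<le> length (ygrid M) \<and>
     sorted_wrt (<) (xgrid M) \<and> sorted_wrt (<) (ygrid M) \<and>
     open (Omega M) \<and> connected (Omega M) \<and> Omega M \<noteq> {} \<and>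
     Omega M \<subseteq> cbox (vector [hd (xgrid M), hd (ygrid M)]) (vector [last (xgrid M), last (ygrid M)])"

definition faces_oriented :: "cut_mesh \<Rightarrow> bool" where
  "faces_oriented M \<longleftrightarrow>
     (\<forall>g \<in> int_faces M. leftc M g \<in> cells M \<and> rightc M g \<in> cells M \<and> leftc M g \<noteq> rightc M g \<and>
        g = closure (leftc M g) \<inter> closure (rightc M g)) \<and>
     (\<forall>g \<in> int_faces M. AE x in length_measure. x \<in> g \<longrightarrow>
        is_outward_normal (leftc M g) x (normal M g x) \<and> is_outward_normal (rightc M g) x (- normal M g x)) \<and>
     (\<forall>g \<in> bd_faces M. AE x in length_measure. x \<in> g \<longrightarrow> is_outward_normal (Omega M) x (normal M g x)) \<and>
     (\<forall>g \<in> int_faces M \<union> bd_faces M. set_borel_measurable borel g (normal M g))"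

definition faces_numbered :: "cut_mesh \<Rightarrow> bool" where
  "faces_numbered M \<longleftrightarrow> (\<forall>E \<in> cells M. bij_betw (face M E) (idx M E) (faces_of M E))"

definition divergence_theorem :: "cut_mesh \<Rightarrow> bool" where
  "divergence_theorem M \<longleftrightarrow> (\<forall>E \<in> cells M.
     emeasure length_measure (frontier E) < \<infinity> \<and>
     (\<forall>F. C1_field F \<longrightarrow>
        (LINT x:E|lebesgue. (\<Sum>k\<in>UNIV. partial k F x $ k)) =
        (\<Sum>g \<in> faces_of M E. LINT x:g|length_measure. F x \<bullet> outn M E g x)))"

definition cut_cell_mesh :: "cut_mesh \<Rightarrow> bool" where
  "cut_cell_mesh M \<longleftrightarrow>
     cartesian_domain M \<and> faces_oriented M \<and> faces_numbered M \<and> divergence_theorem M"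


section \<open>The discontinuous space and the base forms\<close>

definition V_space :: "cut_mesh \<Rightarrow> nat \<Rightarrow> field set" where
  "V_space M r = {w. set_borel_measurable lebesgue (Omega M) w \<and>
     set_integrable lebesgue (Omega M) (\<lambda>x. (norm (w x))\<^sup>2) \<and>
     (\<forall>E \<in> cells M. \<exists>q \<in> poly3 r. \<forall>x\<in>E. w x = q x)}"

definition L2norm :: "pt set \<Rightarrow> field \<Rightarrow> real" where
  "L2norm A w = sqrt (LINT x:A|lebesgue. (norm (w x))\<^sup>2)"

definition trace_from :: "pt set \<Rightarrow> field \<Rightarrow> field" where
  "trace_from E w x = Lim (at x within E) w"

definition trL :: "cut_mesh \<Rightarrow> pt set \<Rightarrow> field \<Rightarrow> field" where
  "trL M g w = trace_from (leftc M g) w"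

definition trR :: "cut_mesh \<Rightarrow> pt set \<Rightarrow> field \<Rightarrow> field" where
  "trR M g w = trace_from (rightc M g) w"

definition trB :: "cut_mesh \<Rightarrow> pt set \<Rightarrow> field \<Rightarrow> field" where
  "trB M g w = trace_from (bd_cell M g) w"

definition jump :: "cut_mesh \<Rightarrow> pt set \<Rightarrow> field \<Rightarrow> field" where
  "jump M g w x = trL M g w x - trR M g w x"

definition central_int :: "cut_mesh \<Rightarrow> real \<Rightarrow> pt set \<Rightarrow> field \<Rightarrow> field \<Rightarrow> real" where
  "central_int M c g u w = (LINT x:g|length_measure.
     ((1/2) *\<^sub>R (flux c (normal M g x) (trL M g u x) + flux c (normal M g x) (trR M g u x))) \<bullet> jump M g w x)"

definition central_bd :: "cut_mesh \<Rightarrow> real \<Rightarrow> pt set \<Rightarrow> field \<Rightarrow> field \<Rightarrow> real" where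
  "central_bd M c g u w = (LINT x:g|length_measure.
     ((1/2) *\<^sub>R (flux c (normal M g x) (trB M g u x) +
        flux c (normal M g x) (mirror (normal M g x) (trB M g u x)))) \<bullet> trB M g w x)"

definition diss_int :: "cut_mesh \<Rightarrow> (pt \<Rightarrow> st \<Rightarrow> st \<Rightarrow> st) \<Rightarrow> pt set \<Rightarrow> field \<Rightarrow> field \<Rightarrow> real" where
  "diss_int M S g u w = (LINT x:g|length_measure.
     S (normal M g x) (trL M g u x) (trR M g u x) \<bullet> jump M g w x)"

definition diss_bd :: "cut_mesh \<Rightarrow> (pt \<Rightarrow> st \<Rightarrow> st \<Rightarrow> st) \<Rightarrow> pt set \<Rightarrow> field \<Rightarrow> field \<Rightarrow> real" where
  "diss_bd M S g u w = (LINT x:g|length_measure.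
     S (normal M g x) (trB M g u x) (mirror (normal M g x) (trB M g u x)) \<bullet> trB M g w x)"

definition a_h :: "cut_mesh \<Rightarrow> real \<Rightarrow> field \<Rightarrow> field \<Rightarrow> real" where
  "a_h M c u w = - (\<Sum>E \<in> cells M. LINT x:E|lebesgue. flux_grad c u w x)
     + (\<Sum>g \<in> int_faces M. central_int M c g u w) + (\<Sum>g \<in> bd_faces M. central_bd M c g u w)"

definition s_h :: "cut_mesh \<Rightarrow> (pt \<Rightarrow> st \<Rightarrow> st \<Rightarrow> st) \<Rightarrow> field \<Rightarrow> field \<Rightarrow> real" where
  "s_h M S u w = (\<Sum>g \<in> int_faces M. diss_int M S g u w) + (\<Sum>g \<in> bd_faces M. diss_bd M S g u w)"

definition dissipative :: "(pt \<Rightarrow> st \<Rightarrow> st \<Rightarrow> st) \<Rightarrow> bool" where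
  "dissipative S \<longleftrightarrow> (\<exists>SM :: pt \<Rightarrow> real^3^3. \<forall>n. norm n = 1 \<longrightarrow>
     (\<forall>a b. S n a b = SM n *v (a - b)) \<and> (\<forall>a. 0 \<le> (SM n *v a) \<bullet> a))"

(* Dissipativity at a reflecting wall.  It holds for instance for Lax-Friedrichs and upwind
   fluxes, but it does not follow from positive semi-definiteness: a matrix that couples p with
   the normal velocity can produce energy through the boundary term of s_h. *)
definition wall_dissipative :: "(pt \<Rightarrow> st \<Rightarrow> st \<Rightarrow> st) \<Rightarrow> bool" where
  "wall_dissipative S \<longleftrightarrow> (\<forall>n a. norm n = 1 \<longrightarrow> 0 \<le> S n a (mirror n a) \<bullet> a)"


section \<open>Small cells and extension operators\<close>

definition small_cells :: "cut_mesh \<Rightarrow> real \<Rightarrow> pt set set" where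
  "small_cells M \<alpha> = {B \<inter> Omega M | B. B \<in> bg_cells M \<and> B \<inter> Omega M \<noteq> {} \<and>
     measure lebesgue (B \<inter> Omega M) / measure lebesgue B < \<alpha>}"

definition straight_face :: "cut_mesh \<Rightarrow> pt set \<Rightarrow> bool" where
  "straight_face M g \<longleftrightarrow> (\<exists>n d. norm n = 1 \<and> (AE x in length_measure. x \<in> g \<longrightarrow> normal M g x = n) \<and>
     g \<subseteq> {x. n \<bullet> x = d})"

definition face_normal :: "cut_mesh \<Rightarrow> pt set \<Rightarrow> pt" where
  "face_normal M g = (THE n. AE x in length_measure. x \<in> g \<longrightarrow> normal M g x = n)"

definition small_cells_admissible :: "cut_mesh \<Rightarrow> real \<Rightarrow> bool" where
  "small_cells_admissible M \<alpha> \<longleftrightarrow>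
     (\<forall>E \<in> small_cells M \<alpha>. \<forall>g \<in> int_faces_of M E. nbr M E g \<notin> small_cells M \<alpha>) \<and>
     (\<forall>E \<in> small_cells M \<alpha>. \<forall>g \<in> bd_faces_of M E. straight_face M g) \<and>
     (\<exists>\<rho>>0. \<forall>E \<in> small_cells M \<alpha>. (diameter E)\<^sup>2 \<le> \<rho> * measure lebesgue E)"

definition eta :: "cut_mesh \<Rightarrow> real \<Rightarrow> nat \<Rightarrow> real \<Rightarrow> pt set \<Rightarrow> real" where
  "eta M c r dt E = 1 - 1 / (2 * real r + 1) *
     (measure lebesgue E / (dt * c * Max ((\<lambda>i. measure length_measure (face M E i)) ` idx M E)))"

definition ext :: "nat \<Rightarrow> pt set \<Rightarrow> field \<Rightarrow> field" where
  "ext r E w = (THE q. q \<in> poly3 r \<and> (\<forall>x\<in>E. q x = w x))"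

definition ext_nbr :: "cut_mesh \<Rightarrow> nat \<Rightarrow> pt set \<Rightarrow> nat \<Rightarrow> field \<Rightarrow> field" where
  "ext_nbr M r E k w = ext r (nbr M E (face M E k)) w"

(* the reflection, across the boundary face numbered k, of the extension from E_l *)
definition ext_refl :: "cut_mesh \<Rightarrow> nat \<Rightarrow> pt set \<Rightarrow> nat \<Rightarrow> nat \<Rightarrow> field \<Rightarrow> field" where
  "ext_refl M r E k l w = mirror_ext (face M E k) (face_normal M (face M E k)) (ext_nbr M r E l w)"

(* For the pair {i, j} = {k, l}: the operator with superscript ij and subscript E_k. *)
definition ext_pair :: "cut_mesh \<Rightarrow> nat \<Rightarrow> pt set \<Rightarrow> nat \<Rightarrow> nat \<Rightarrow> field \<Rightarrow> field" where
  "ext_pair M r E k l w = (if face M E k \<in> bd_faces M then ext_refl M r E k l w else ext_nbr M r E k w)"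


section \<open>Propagation forms\<close>

type_synonym form3 = "field \<Rightarrow> field \<Rightarrow> field \<Rightarrow> real"

definition b_form :: "cut_mesh \<Rightarrow> real \<Rightarrow> pt set \<Rightarrow> pt set \<Rightarrow> form3" where
  "b_form M c E g u v w = (LINT x:g|length_measure.
     ((1/2) *\<^sub>R (flux c (outn M E g x) (u x) + flux c (outn M E g x) (v x))) \<bullet> w x)"

definition symm_linear :: "nat \<Rightarrow> form3 \<Rightarrow> bool" where
  "symm_linear r q \<longleftrightarrow> (\<forall>u \<in> poly3 r. \<forall>v \<in> poly3 r. \<forall>w \<in> poly3 r. q u v w = q v u w) \<and>
     (\<forall>u \<in> poly3 r. \<forall>v \<in> poly3 r. \<forall>w \<in> poly3 r. \<forall>z \<in> poly3 r. \<forall>a b.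
        q u v (\<lambda>x. a *\<^sub>R w x + b *\<^sub>R z x) = a * q u v w + b * q u v z)"

definition propagation_forms ::
  "cut_mesh \<Rightarrow> real \<Rightarrow> nat \<Rightarrow> pt set \<Rightarrow> (nat \<Rightarrow> nat \<Rightarrow> form3) \<Rightarrow> form3 \<Rightarrow> form3 \<Rightarrow> bool" where
  "propagation_forms M c r E p pV pVs \<longleftrightarrow>
     (\<forall>i \<in> idx M E. \<forall>j \<in> idx M E. i \<noteq> j \<longrightarrow> symm_linear r (p i j)) \<and> symm_linear r pV \<and> symm_linear r pVs \<and>
     (\<forall>i \<in> idx M E. \<forall>j \<in> idx M E. i \<noteq> j \<longrightarrow> (\<forall>u \<in> poly3 r. \<forall>v \<in> poly3 r. \<forall>w \<in> poly3 r.
        p i j u v w + p j i u v w = pV u v w + pVs u v w)) \<and>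
     (\<forall>j \<in> idx M E. \<forall>u \<in> poly3 r. \<forall>v \<in> poly3 r. \<forall>w \<in> poly3 r.
        (\<Sum>i \<in> idx M E - {j}. p i j u v w) = b_form M c E (face M E j) u v w)"

definition pair_weight :: "cut_mesh \<Rightarrow> pt set \<Rightarrow> real" where
  "pair_weight M E = 2 / (real (nfaces M E) * (real (nfaces M E) - 1))"

definition energy_preserving ::
  "cut_mesh \<Rightarrow> real \<Rightarrow> nat \<Rightarrow> pt set \<Rightarrow> (nat \<Rightarrow> nat \<Rightarrow> form3) \<Rightarrow> bool" where
  "energy_preserving M c r E p \<longleftrightarrow> (\<forall>i \<in> idx M E. \<forall>j \<in> idx M E. i \<noteq> j \<longrightarrow>
     (\<forall>w \<in> poly3 r. pair_weight M E * (LINT x:E|lebesgue. flux_grad c w w x) =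
        1/2 * p i j w w w + 1/2 * p j i w w w) \<and>
     (\<forall>u \<in> poly3 r. \<forall>v \<in> poly3 r. p i j u v (\<lambda>x. u x - v x) = 1/2 * p i j u u u - 1/2 * p i j v v v))"

definition reflecting ::
  "cut_mesh \<Rightarrow> nat \<Rightarrow> pt set \<Rightarrow> (nat \<Rightarrow> nat \<Rightarrow> form3) \<Rightarrow> bool" where
  "reflecting M r E p \<longleftrightarrow> (\<forall>i \<in> idx M E. \<forall>j \<in> idx M E. i \<noteq> j \<longrightarrow> face M E i \<in> bd_faces_of M E \<longrightarrow>
     (let m = mirror_ext (face M E i) (face_normal M (face M E i)) in
      \<forall>u \<in> poly3 r. \<forall>v \<in> poly3 r. \<forall>w \<in> poly3 r. p j i u (m v) w = - p j i (m u) v (m w)))"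


section \<open>Stabilization\<close>

definition J0_int :: "cut_mesh \<Rightarrow> nat \<Rightarrow> pt set \<Rightarrow> (nat \<Rightarrow> nat \<Rightarrow> form3) \<Rightarrow> nat \<Rightarrow> nat \<Rightarrow> field \<Rightarrow> field \<Rightarrow> real" where
  "J0_int M r E p i j u w =
     p i j (ext_nbr M r E i u) (ext_nbr M r E j u) (\<lambda>x. ext r E w x - ext_nbr M r E j w x) +
     p j i (ext_nbr M r E i u) (ext_nbr M r E j u) (\<lambda>x. ext r E w x - ext_nbr M r E i w x)"

(* the case in which the i-th face is the boundary face *)
definition J0_bd :: "cut_mesh \<Rightarrow> nat \<Rightarrow> pt set \<Rightarrow> (nat \<Rightarrow> nat \<Rightarrow> form3) \<Rightarrow> nat \<Rightarrow> nat \<Rightarrow> field \<Rightarrow> field \<Rightarrow> real" where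
  "J0_bd M r E p i j u w =
     p i j (ext_refl M r E i j u) (ext_nbr M r E j u) (\<lambda>x. ext r E w x - ext_nbr M r E j w x) +
     p j i (ext_refl M r E i j u) (ext_nbr M r E j u) (ext r E w)"

definition J0_ij :: "cut_mesh \<Rightarrow> nat \<Rightarrow> pt set \<Rightarrow> (nat \<Rightarrow> nat \<Rightarrow> form3) \<Rightarrow> nat \<Rightarrow> nat \<Rightarrow> field \<Rightarrow> field \<Rightarrow> real" where
  "J0_ij M r E p i j u w =
     (if face M E i \<in> bd_faces M then J0_bd M r E p i j u w
      else if face M E j \<in> bd_faces M then J0_bd M r E p j i u w
      else J0_int M r E p i j u w)"

definition J0_E ::
  "cut_mesh \<Rightarrow> real \<Rightarrow> nat \<Rightarrow> real \<Rightarrow> pt set \<Rightarrow> (nat \<Rightarrow> nat \<Rightarrow> form3) \<Rightarrow> field \<Rightarrow> field \<Rightarrow> real" where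
  "J0_E M c r dt E p u w =
     eta M c r dt E * (\<Sum>(i, j) \<in> idx_pairs M E. J0_ij M r E p i j u w)
     - eta M c r dt E * (\<Sum>g \<in> int_faces_of M E. central_int M c g u w)
     - eta M c r dt E * (\<Sum>g \<in> bd_faces_of M E. central_bd M c g u w)"

(* The summand for one of the three cells E, E_i, E_j, without its weight omega; Lu and Lw are the
   extensions of u and w from that cell. *)
definition J1_term ::
  "cut_mesh \<Rightarrow> real \<Rightarrow> nat \<Rightarrow> pt set \<Rightarrow> form3 \<Rightarrow> form3 \<Rightarrow> nat \<Rightarrow> nat \<Rightarrow> field \<Rightarrow> field \<Rightarrow> field \<Rightarrow> field \<Rightarrow> real" where
  "J1_term M c r E pV pVs i j u w Lu Lw =
     pV (ext_pair M r E i j u) (ext_pair M r E j i u) Lw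
     - pair_weight M E * (LINT x:E|lebesgue. flux_grad c Lu Lw x)
     + pVs (ext_pair M r E i j w) (ext_pair M r E j i w) Lu"

definition J1_ij ::
  "cut_mesh \<Rightarrow> real \<Rightarrow> nat \<Rightarrow> pt set \<Rightarrow> form3 \<Rightarrow> form3 \<Rightarrow> nat \<Rightarrow> nat \<Rightarrow> field \<Rightarrow> field \<Rightarrow> real" where
  "J1_ij M c r E pV pVs i j u w =
     - 1 * J1_term M c r E pV pVs i j u w (ext r E u) (ext r E w)
     + 1/2 * J1_term M c r E pV pVs i j u w (ext_pair M r E i j u) (ext_pair M r E i j w)
     + 1/2 * J1_term M c r E pV pVs i j u w (ext_pair M r E j i u) (ext_pair M r E j i w)"

definition J1_E ::
  "cut_mesh \<Rightarrow> real \<Rightarrow> nat \<Rightarrow> real \<Rightarrow> pt set \<Rightarrow> form3 \<Rightarrow> form3 \<Rightarrow> field \<Rightarrow> field \<Rightarrow> real" where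
  "J1_E M c r dt E pV pVs u w =
     eta M c r dt E * (\<Sum>(i, j) \<in> idx_pairs M E. J1_ij M c r E pV pVs i j u w)"

definition Js_ij ::
  "cut_mesh \<Rightarrow> nat \<Rightarrow> pt set \<Rightarrow> (pt \<Rightarrow> st \<Rightarrow> st \<Rightarrow> st) \<Rightarrow> nat \<Rightarrow> nat \<Rightarrow> field \<Rightarrow> field \<Rightarrow> real" where
  "Js_ij M r E S i j u w = 1/6 * (\<Sum>g \<in> faces_of M E. LINT x:g|length_measure.
     S (normal M g x) (ext_pair M r E i j u x) (ext_pair M r E j i u x)
         \<bullet> (ext_pair M r E i j w x - ext_pair M r E j i w x) +
     S (normal M g x) (ext_pair M r E j i u x) (ext_pair M r E i j u x)
         \<bullet> (ext_pair M r E j i w x - ext_pair M r E i j w x))"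

definition Js_E ::
  "cut_mesh \<Rightarrow> real \<Rightarrow> nat \<Rightarrow> real \<Rightarrow> pt set \<Rightarrow> (pt \<Rightarrow> st \<Rightarrow> st \<Rightarrow> st) \<Rightarrow> field \<Rightarrow> field \<Rightarrow> real" where
  "Js_E M c r dt E S u w =
     eta M c r dt E * (\<Sum>(i, j) \<in> idx_pairs M E. Js_ij M r E S i j u w)
     - eta M c r dt E * (\<Sum>g \<in> int_faces_of M E. diss_int M S g u w)
     - eta M c r dt E * (\<Sum>g \<in> bd_faces_of M E. diss_bd M S g u w)"

definition Ja_h ::
  "cut_mesh \<Rightarrow> real \<Rightarrow> nat \<Rightarrow> real \<Rightarrow> real \<Rightarrow> (pt set \<Rightarrow> nat \<Rightarrow> nat \<Rightarrow> form3) \<Rightarrow> (pt set \<Rightarrow> form3) \<Rightarrow>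
   (pt set \<Rightarrow> form3) \<Rightarrow> field \<Rightarrow> field \<Rightarrow> real" where
  "Ja_h M c r dt \<alpha> p pV pVs u w =
     (\<Sum>E \<in> small_cells M \<alpha>. J0_E M c r dt E (p E) u w + J1_E M c r dt E (pV E) (pVs E) u w)"

definition Js_h ::
  "cut_mesh \<Rightarrow> real \<Rightarrow> nat \<Rightarrow> real \<Rightarrow> real \<Rightarrow> (pt \<Rightarrow> st \<Rightarrow> st \<Rightarrow> st) \<Rightarrow> field \<Rightarrow> field \<Rightarrow> real" where
  "Js_h M c r dt \<alpha> S u w = (\<Sum>E \<in> small_cells M \<alpha>. Js_E M c r dt E S u w)"

end

(* Testing the scheme with w = u_h reduces the claim to the signs of the forms on the diagonal.

   Central terms: symmetry of the matrices A_k makes f(q) . grad q a divergence, so the volume term of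
   each cell is half of the sum of its face energies b_g(q,q,q).  At an interior face these cancel
   against the central flux, and at a wall the reflected state carries no energy flux; hence
   a_h(u,u) = 0.  For a small cell, each pair of faces contributes to J^0 + J^1 the share
   2/(K(K-1)) of the volume energy minus the outflow energies p_ji(q_i,q_i,q_i)/2 of the two
   neighbours; the reflection property removes the outflow at a wall.  Summed over the pairs, this is
   exactly the central flux that J^0 subtracts, so J^a(u,u) = 0.

   Dissipation: s_h + J^s is non-negative because a face lies on at most one small cell and
   0 <= eta <= 1, so at most the whole dissipation of a face is subtracted.

   For this bookkeeping faces must be attributed to cells: three cells share at most one point, and a
   wall face cannot lie in an interior face since the two outward normal conditions exclude each other. *)

theory Submission
  imports Defs
begin

section \<open>Polynomials in two variables\<close>

text \<open>All energy identities are evaluated on global polynomials: \<open>ext\<close> replaces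
  the field on a cell and traces become values of \<open>ext\<close>, because the divergence theorem
  speaks of C1 fields on the plane and the propagation forms of \<open>poly3\<close>. Interpolation
  at finitely many nodes inside a cell serves twice: it makes \<open>ext\<close> unique, and it
  turns the energy of a cell into a quadratic form in point values, so that pointwise
  differentiability in time is enough. The pair balance rests on the weights -1, 1/2, 1/2 of J^1. On
  the diagonal p_V + p_V^* equals p_ij + p_ji, so the mixed terms containing the polynomial of E
  cancel and half of p_ij - p_ji remains, tested with the jump of the two neighbours. Property (2)
  makes this a difference of diagonal values with factor 1/4; property (1) supplies the other
  quarters. Normals are controlled only almost everywhere on a face and \<open>S\<close> need not be
  measurable in the normal. Hence the central integrals are split only after integrability has been
  shown, while of the dissipative ones only the sign is used.\<close>

lemma lagrange_basis:
  fixes s :: "nat \<Rightarrow> real"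
  assumes inj: "inj_on s {..r}"
  obtains l :: "nat \<Rightarrow> real \<Rightarrow> real" where
    "\<And>i. continuous_on UNIV (l i)"
    "\<And>a x. (\<Sum>m\<le>r. a m * x ^ m) = (\<Sum>i\<le>r. (\<Sum>m\<le>r. a m * s i ^ m) * l i x)"
proof -
  define L where "L i = (\<Prod>j\<in>{..r} - {i}. smult (1 / (s i - s j)) [:- s j, 1:])" for i
  have deg: "degree (L i) \<le> r" if "i \<le> r" for i
  proof -
    have "degree (L i) \<le> (\<Sum>j\<in>{..r} - {i}. degree (smult (1 / (s i - s j)) [:- s j, 1:]))"
      unfolding L_def by (rule degree_prod_sum_le[unfolded o_def]) simp
    also have "\<dots> \<le> (\<Sum>j\<in>{..r} - {i}. 1)"
      by (intro sum_mono) simp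
    finally show ?thesis using that by simp
  qed
  have val: "poly (L i) (s k) = (if k = i then 1 else 0)" if "i \<le> r" "k \<le> r" for i k
  proof (cases "k = i")
    case True
    have "s i \<noteq> s j" if "j \<in> {..r} - {i}" for j
      using that \<open>i \<le> r\<close> inj_onD[OF inj, of i j] by auto
    then show ?thesis using True
      by (auto simp: L_def poly_prod diff_divide_distrib[symmetric] intro!: prod.neutral)
  next
    case False
    then show ?thesis using that by (auto simp: L_def poly_prod intro!: prod_zero bexI[of _ k])
  qed
  have "(\<Sum>m\<le>r. a m * x ^ m) = (\<Sum>i\<le>r. (\<Sum>m\<le>r. a m * s i ^ m) * poly (L i) x)" for a :: "nat \<Rightarrow> real" and x
  proof -
    define P where "P = (\<Sum>m\<le>r. monom (a m) m)"
    define Q where "Q = (\<Sum>i\<le>r. smult (poly P (s i)) (L i))"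
    have P: "poly P z = (\<Sum>m\<le>r. a m * z ^ m)" for z by (simp add: P_def poly_sum poly_monom)
    \<comment> \<open>Both polynomials have degree at most \<open>r\<close> and agree at the
      \<open>r + 1\<close> distinct nodes.\<close>
    have "P = Q"
    proof (rule poly_eqI_degree[where A = "s ` {..r}"])
      fix z assume "z \<in> s ` {..r}"
      then obtain k where k: "k \<le> r" "z = s k" by auto
      have "poly Q (s k) = (\<Sum>i\<le>r. if k = i then poly P (s i) else 0)"
        unfolding Q_def poly_sum by (intro sum.cong) (auto simp: val k)
      also have "\<dots> = poly P (s k)" using k by simp
      finally show "poly P z = poly Q z" using k by simp
    next
      have "degree P \<le> r" unfolding P_def
        by (intro degree_sum_le) (auto intro: order_trans[OF degree_monom_le])
      then show "degree P < card (s ` {..r})" using inj by (simp add: card_image)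
      have "degree Q \<le> r" unfolding Q_def
        by (intro degree_sum_le) (auto intro: order_trans[OF degree_smult_le] deg)
      then show "degree Q < card (s ` {..r})" using inj by (simp add: card_image)
    qed
    then have "poly P x = poly Q x" by simp
    then show ?thesis unfolding Q_def poly_sum by (simp add: P)
  qed
  then show thesis by (rule that[of "\<lambda>i. poly (L i)", rotated]) (rule continuous_on_poly, rule continuous_on_id)
qed

lemma continuous_on_vec_nth_comp:
  "continuous_on UNIV (f :: real \<Rightarrow> real) \<Longrightarrow> continuous_on UNIV (\<lambda>x :: real^'n. f (x $ k))"
  by (rule continuous_on_compose2[of UNIV f]) (auto intro: continuous_intros)

text \<open>Tensor-product Lagrange interpolation at a grid of nodes inside the open set.\<close>

lemma poly1_interpolation:
  assumes "open E" "E \<noteq> {}"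
  obtains I :: "(nat \<times> nat) set" and P :: "nat \<times> nat \<Rightarrow> pt" and \<phi> :: "nat \<times> nat \<Rightarrow> pt \<Rightarrow> real"
  where "finite I" "\<And>k. k \<in> I \<Longrightarrow> P k \<in> E" "\<And>k. continuous_on UNIV (\<phi> k)"
    "\<And>q x. q \<in> poly1 r \<Longrightarrow> q x = (\<Sum>k\<in>I. \<phi> k x * q (P k))"
proof -
  obtain x0 where "x0 \<in> E" using assms by blast
  then obtain \<delta> where \<delta>: "\<delta> > 0" "\<And>y. dist y x0 < \<delta> \<Longrightarrow> y \<in> E"
    using assms(1) unfolding open_dist by blast
  \<comment> \<open>With this spacing each coordinate of a node is within \<delta>/2 of that of
    \<open>x0\<close>, so the l1 distance, and hence the Euclidean one, stays below
    \<delta>.\<close>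
  define h where "h = \<delta> / (2 * (real r + 1))"
  have h0: "h > 0" "(real r + 1) * h = \<delta> / 2"
    using \<delta> by (simp_all add: h_def field_simps)
  have "real i * h < \<delta> / 2" if "i \<le> r" for i
    using mult_strict_right_mono[of "real i" "real r + 1" h] that h0 by simp
  note h = h0(1) this
  define s where "s i = x0$1 + real i * h" for i
  define t where "t i = x0$2 + real i * h" for i
  have inj: "inj_on s {..r}" "inj_on t {..r}"
    using h by (auto simp: inj_on_def s_def t_def)
  obtain l where l: "\<And>i. continuous_on UNIV (l i)"
    "\<And>a x. (\<Sum>m\<le>r. a m * x ^ m) = (\<Sum>i\<le>r. (\<Sum>m\<le>r. a m * s i ^ m) * l i x)"
    using lagrange_basis[OF inj(1)] by blast
  obtain l' where l': "\<And>i. continuous_on UNIV (l' i)"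
    "\<And>a x. (\<Sum>m\<le>r. a m * x ^ m) = (\<Sum>i\<le>r. (\<Sum>m\<le>r. a m * t i ^ m) * l' i x)"
    using lagrange_basis[OF inj(2)] by blast
  define P :: "nat \<times> nat \<Rightarrow> pt" where "P k = vector [s (fst k), t (snd k)]" for k
  define \<phi> :: "nat \<times> nat \<Rightarrow> pt \<Rightarrow> real" where "\<phi> k x = l (fst k) (x$1) * l' (snd k) (x$2)" for k x
  show thesis
  proof (rule that[of "{..r} \<times> {..r}" P \<phi>])
    fix k assume k: "k \<in> {..r} \<times> {..r}"
    have "dist (P k) x0 \<le> \<bar>(P k - x0)$1\<bar> + \<bar>(P k - x0)$2\<bar>"
      using norm_le_l1_cart[of "P k - x0"] by (simp add: dist_norm sum_2)
    also have "\<dots> = real (fst k) * h + real (snd k) * h"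
      using h(1) by (simp add: P_def s_def t_def abs_mult)
    also have "\<dots> < \<delta>" using h(2)[of "fst k"] h(2)[of "snd k"] k by auto
    finally show "P k \<in> E" by (rule \<delta>)
  next
    show "continuous_on UNIV (\<phi> k)" for k unfolding \<phi>_def
      by (intro continuous_intros continuous_on_vec_nth_comp l l')
  next
    fix q :: "pt \<Rightarrow> real" and x assume "q \<in> poly1 r"
    then obtain a where a: "\<And>x. q x = (\<Sum>i\<le>r. \<Sum>j\<le>r - i. a i j * (x$1)^i * (x$2)^j)"
      unfolding poly1_def by blast
    \<comment> \<open>Padding with zeros turns the triangle of exponents of total degree
      \<open>r\<close> into the square that a tensor product needs.\<close>
    define b where "b i j = (if j \<le> r - i then a i j else 0)" for i j
    have q: "q x = (\<Sum>i\<le>r. \<Sum>j\<le>r. b i j * (x$1)^i * (x$2)^j)" for x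
      unfolding a
    proof (rule sum.cong[OF refl])
      fix i assume "i \<in> {..r}"
      show "(\<Sum>j\<le>r - i. a i j * (x$1)^i * (x$2)^j) = (\<Sum>j\<le>r. b i j * (x$1)^i * (x$2)^j)"
        by (rule sum.mono_neutral_cong_left) (auto simp: b_def)
    qed
    \<comment> \<open>One coordinate at a time: for frozen \<open>x$2\<close> this is interpolation
      in the first variable, and \<open>q2\<close> then treats the second variable at each node
      \<open>s i\<close>.\<close>
    have q1: "q x = (\<Sum>i\<le>r. q (vector [s i, x$2]) * l i (x$1))" for x
    proof -
      have *: "q (vector [z, x$2]) = (\<Sum>i\<le>r. (\<Sum>j\<le>r. b i j * (x$2)^j) * z ^ i)" for z
        unfolding q sum_distrib_right by (simp add: ac_simps)
      have "(vector [x$1, x$2] :: pt) = x" by (simp add: vec_eq_iff forall_2)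
      then have "q x = (\<Sum>i\<le>r. (\<Sum>j\<le>r. b i j * (x$2)^j) * (x$1) ^ i)" using *[of "x$1"] by simp
      also have "\<dots> = (\<Sum>i\<le>r. q (vector [s i, x$2]) * l i (x$1))"
        unfolding * by (rule l(2))
      finally show ?thesis .
    qed
    have q2: "q (vector [z, y]) = (\<Sum>j\<le>r. q (vector [z, t j]) * l' j y)" for z y
    proof -
      have *: "q (vector [z, y]) = (\<Sum>j\<le>r. (\<Sum>i\<le>r. b i j * z^i) * y ^ j)" for y
        unfolding q sum_distrib_right by (subst sum.swap) (simp add: ac_simps)
      show ?thesis unfolding * by (rule l'(2))
    qed
    have "q x = (\<Sum>i\<le>r. \<Sum>j\<le>r. \<phi> (i, j) x * q (P (i, j)))"
      unfolding q1[of x] q2[of _ "x$2"] sum_distrib_right \<phi>_def P_def by (simp add: ac_simps)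
    then show "q x = (\<Sum>k\<in>{..r} \<times> {..r}. \<phi> k x * q (P k))"
      by (simp add: sum.cartesian_product case_prod_unfold)
  qed simp
qed

text \<open>Values at finitely many nodes inside the open set determine a polynomial. This makes the
  definite description in \<open>ext\<close> meaningful.\<close>

lemma poly3_eqI:
  assumes "open E" "E \<noteq> {}" "q \<in> poly3 r" "q' \<in> poly3 r" "\<And>x. x \<in> E \<Longrightarrow> q x = q' x"
  shows "q = q'"
proof -
  obtain I :: "(nat \<times> nat) set" and P :: "nat \<times> nat \<Rightarrow> pt" and \<phi> :: "nat \<times> nat \<Rightarrow> pt \<Rightarrow> real" where I: "finite I" "\<And>k. k \<in> I \<Longrightarrow> P k \<in> E"
    "\<And>q x. q \<in> poly1 r \<Longrightarrow> q x = (\<Sum>k\<in>I. \<phi> k x * q (P k))"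
    by (rule poly1_interpolation[OF assms(1,2), where r = r]) (rule that)
  have "q x $ k = q' x $ k" for x k
    using I(3)[of "\<lambda>x. q x $ k" x] I(3)[of "\<lambda>x. q' x $ k" x] assms(3-5) I(2)
    by (simp add: poly3_def)
  then show ?thesis by (auto simp: vec_eq_iff)
qed

text \<open>Nodes and weights are chosen before \<open>q\<close>, so they stay fixed while the field
  varies in time.\<close>

lemma poly3_interpolation:
  assumes "open E" "E \<noteq> {}"
  obtains I :: "(nat \<times> nat) set" and P :: "nat \<times> nat \<Rightarrow> pt" and \<phi> :: "nat \<times> nat \<Rightarrow> pt \<Rightarrow> real"
  where "finite I" "\<And>k. k \<in> I \<Longrightarrow> P k \<in> E" "\<And>k. continuous_on UNIV (\<phi> k)"
    "\<And>q x. q \<in> poly3 r \<Longrightarrow> q x = (\<Sum>k\<in>I. \<phi> k x *\<^sub>R q (P k))"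
proof -
  obtain I :: "(nat \<times> nat) set" and P :: "nat \<times> nat \<Rightarrow> pt" and \<phi> :: "nat \<times> nat \<Rightarrow> pt \<Rightarrow> real" where I: "finite I" "\<And>k. k \<in> I \<Longrightarrow> P k \<in> E" "\<And>k. continuous_on UNIV (\<phi> k)"
    "\<And>q x. q \<in> poly1 r \<Longrightarrow> q x = (\<Sum>k\<in>I. \<phi> k x * q (P k))"
    by (rule poly1_interpolation[OF assms(1,2), where r = r]) (rule that)
  have "q x = (\<Sum>k\<in>I. \<phi> k x *\<^sub>R q (P k))" if "q \<in> poly3 r" for q :: field and x
    using I(4)[of "\<lambda>x. q x $ k" x for k] that by (simp add: poly3_def vec_eq_iff)
  then show thesis using that I(1-3) by blast
qed

section \<open>Closure of the polynomial spaces under sums, products and affine substitution\<close>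

lemma poly1_monomial: "i + j \<le> r \<Longrightarrow> (\<lambda>x. x$1^i * x$2^j) \<in> poly1 r"
proof -
  assume le: "i + j \<le> r"
  define a :: "nat \<Rightarrow> nat \<Rightarrow> real" where "a k l = (if k = i then if l = j then 1 else 0 else 0)" for k l
  have "x$1^i * x$2^j = (\<Sum>k\<le>r. \<Sum>l\<le>r - k. a k l * (x$1)^k * (x$2)^l)" for x :: pt
  proof -
    have "(\<Sum>l\<le>r - k. a k l * (x$1)^k * (x$2)^l) = (if k = i then x$1^i * x$2^j else 0)" for k
    proof (cases "k = i")
      case True
      then have "(\<Sum>l\<le>r - k. a k l * (x$1)^k * (x$2)^l) = (\<Sum>l\<le>r - i. if l = j then x$1^i * x$2^j else 0)"
        by (intro sum.cong) (auto simp: a_def)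
      then show ?thesis using True le by simp
    qed (simp add: a_def)
    then have "(\<Sum>k\<le>r. \<Sum>l\<le>r - k. a k l * (x$1)^k * (x$2)^l) = (\<Sum>k\<le>r. if k = i then x$1^i * x$2^j else 0)"
      by (rule sum.cong[OF refl])
    also have "\<dots> = x$1^i * x$2^j" using le by auto
    finally show ?thesis by simp
  qed
  then show ?thesis unfolding poly1_def by blast
qed

lemma poly1_add: "f \<in> poly1 r \<Longrightarrow> g \<in> poly1 r \<Longrightarrow> (\<lambda>x. f x + g x) \<in> poly1 r"
  unfolding poly1_def
proof clarify
  fix a b :: "nat \<Rightarrow> nat \<Rightarrow> real"
  assume "\<forall>x. f x = (\<Sum>i\<le>r. \<Sum>j\<le>r - i. a i j * (x$1)^i * (x$2)^j)" "\<forall>x. g x = (\<Sum>i\<le>r. \<Sum>j\<le>r - i. b i j * (x$1)^i * (x$2)^j)"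
  then have "\<forall>x. f x + g x = (\<Sum>i\<le>r. \<Sum>j\<le>r - i. (a i j + b i j) * (x$1)^i * (x$2)^j)"
    by (simp add: sum.distrib distrib_right)
  then show "\<exists>a. \<forall>x. f x + g x = (\<Sum>i\<le>r. \<Sum>j\<le>r - i. a i j * (x$1)^i * (x$2)^j)"
    by (intro exI[of _ "\<lambda>i j. a i j + b i j"])
qed

lemma poly1_scale: "f \<in> poly1 r \<Longrightarrow> (\<lambda>x. c * f x) \<in> poly1 r"
  unfolding poly1_def
proof clarify
  fix a :: "nat \<Rightarrow> nat \<Rightarrow> real"
  assume "\<forall>x. f x = (\<Sum>i\<le>r. \<Sum>j\<le>r - i. a i j * (x$1)^i * (x$2)^j)"
  then have "\<forall>x. c * f x = (\<Sum>i\<le>r. \<Sum>j\<le>r - i. (c * a i j) * (x$1)^i * (x$2)^j)"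
    by (simp add: sum_distrib_left mult.assoc)
  then show "\<exists>a. \<forall>x. c * f x = (\<Sum>i\<le>r. \<Sum>j\<le>r - i. a i j * (x$1)^i * (x$2)^j)"
    by (intro exI[of _ "\<lambda>i j. c * a i j"])
qed

lemma poly1_const: "(\<lambda>x. c) \<in> poly1 r"
  using poly1_scale[OF poly1_monomial[of 0 0 r], of c] by simp

lemma poly1_sum: "(\<And>i. i \<in> A \<Longrightarrow> f i \<in> poly1 r) \<Longrightarrow> (\<lambda>x. \<Sum>i\<in>A. f i x) \<in> poly1 r"
  by (induction A rule: infinite_finite_induct) (auto intro: poly1_const poly1_add)

lemma poly1_mult:
  assumes "f \<in> poly1 r" "g \<in> poly1 s"
  shows "(\<lambda>x. f x * g x) \<in> poly1 (r + s)"
proof -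
  obtain a where a: "\<And>x. f x = (\<Sum>i\<le>r. \<Sum>j\<le>r - i. a i j * (x$1)^i * (x$2)^j)"
    using assms(1) unfolding poly1_def by blast
  obtain b where b: "\<And>x. g x = (\<Sum>i\<le>s. \<Sum>j\<le>s - i. b i j * (x$1)^i * (x$2)^j)"
    using assms(2) unfolding poly1_def by blast
  have "(\<lambda>x. f x * g x) = (\<lambda>x. \<Sum>i\<le>r. \<Sum>k\<le>s. \<Sum>j\<le>r - i. \<Sum>l\<le>s - k.
      (a i j * b k l) * ((x$1)^(i + k) * (x$2)^(j + l)))"
    unfolding a b sum_product by (simp add: power_add ac_simps)
  also have "\<dots> \<in> poly1 (r + s)"
    by (intro poly1_sum poly1_scale poly1_monomial) auto
  finally show ?thesis .
qed

lemma poly1_power: "f \<in> poly1 1 \<Longrightarrow> (\<lambda>x. f x ^ i) \<in> poly1 i"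
  by (induction i) (use poly1_mult[of f 1] in \<open>auto intro: poly1_const\<close>)

lemma poly1_mono:
  assumes "f \<in> poly1 r" "r \<le> s" shows "f \<in> poly1 s"
  using poly1_mult[OF assms(1) poly1_const[of 1 "s - r"]] assms(2) by simp

text \<open>A monomial of degree i + j becomes a product of i + j affine factors. The case needed is
  the orthogonal projection onto a wall line inside \<open>mirror_ext\<close>.\<close>

lemma poly1_compose_affine:
  assumes "f \<in> poly1 r" "\<And>k. (\<lambda>x. L x $ k) \<in> poly1 1"
  shows "(\<lambda>x. f (L x)) \<in> poly1 r"
proof -
  obtain a where a: "\<And>x. f x = (\<Sum>i\<le>r. \<Sum>j\<le>r - i. a i j * (x$1)^i * (x$2)^j)"
    using assms(1) unfolding poly1_def by blast
  have "(\<lambda>x. (L x $ 1)^i * (L x $ 2)^j) \<in> poly1 r" if "i \<le> r" "j \<le> r - i" for i j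
    using poly1_mult[OF poly1_power[OF assms(2)[of 1], of i] poly1_power[OF assms(2)[of 2], of j]] that
    by (auto intro: poly1_mono)
  then show ?thesis unfolding a by (auto simp: mult.assoc intro!: poly1_sum poly1_scale)
qed

lemma poly3_lincomb: "u \<in> poly3 r \<Longrightarrow> v \<in> poly3 r \<Longrightarrow> (\<lambda>x. a *\<^sub>R u x + b *\<^sub>R v x) \<in> poly3 r"
  by (auto simp: poly3_def intro!: poly1_add poly1_scale)

lemma poly3_add: "u \<in> poly3 r \<Longrightarrow> v \<in> poly3 r \<Longrightarrow> (\<lambda>x. u x + v x) \<in> poly3 r"
  using poly3_lincomb[of u r v 1 1] by simp

text \<open>The partial derivatives appear as explicit witnesses, so that sums and products carry
  their continuity along without any reasoning about \<open>frechet_derivative\<close>.\<close>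

definition C1_fun :: "(pt \<Rightarrow> real) \<Rightarrow> bool" where
  "C1_fun f \<longleftrightarrow> (\<exists>d1 d2. continuous_on UNIV d1 \<and> continuous_on UNIV d2 \<and>
     (\<forall>x. (f has_derivative (\<lambda>h. h$1 * d1 x + h$2 * d2 x)) (at x)))"

lemma C1_funI:
  assumes "continuous_on UNIV d1" "continuous_on UNIV d2"
    "\<And>x. (f has_derivative (\<lambda>h. h$1 * d1 x + h$2 * d2 x)) (at x)"
  shows "C1_fun f"
  using assms unfolding C1_fun_def by blast

lemma C1_fun_const: "C1_fun (\<lambda>x. c)"
  by (rule C1_funI[of "\<lambda>_. 0" "\<lambda>_. 0"]) auto

lemma has_derivative_vec_nth: "((\<lambda>x. x $ k) has_derivative (\<lambda>h. h $ k)) (at x)"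
  by (rule bounded_linear_imp_has_derivative) (rule bounded_linear_vec_nth)

lemma C1_fun_nth: "C1_fun (\<lambda>x. x $ k)"
  using exhaust_2[of k]
proof
  assume "k = 1"
  then show ?thesis using has_derivative_vec_nth[of 1]
    by (intro C1_funI[of "\<lambda>_. 1" "\<lambda>_. 0"]) auto
next
  assume "k = 2"
  then show ?thesis using has_derivative_vec_nth[of 2]
    by (intro C1_funI[of "\<lambda>_. 0" "\<lambda>_. 1"]) auto
qed

lemma C1_fun_continuous: "C1_fun f \<Longrightarrow> continuous_on UNIV f"
  unfolding C1_fun_def by (blast intro: continuous_at_imp_continuous_on has_derivative_continuous)

lemma C1_fun_add:
  assumes "C1_fun f" "C1_fun g" shows "C1_fun (\<lambda>x. f x + g x)"
proof -
  obtain d1 d2 where d: "continuous_on UNIV d1" "continuous_on UNIV d2"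
    "\<And>x. (f has_derivative (\<lambda>h. h$1 * d1 x + h$2 * d2 x)) (at x)"
    using assms(1) unfolding C1_fun_def by blast
  obtain e1 e2 where e: "continuous_on UNIV e1" "continuous_on UNIV e2"
    "\<And>x. (g has_derivative (\<lambda>h. h$1 * e1 x + h$2 * e2 x)) (at x)"
    using assms(2) unfolding C1_fun_def by blast
  show ?thesis
  proof (rule C1_funI[of "\<lambda>x. d1 x + e1 x" "\<lambda>x. d2 x + e2 x"])
    show "((\<lambda>x. f x + g x) has_derivative (\<lambda>h. h$1 * (d1 x + e1 x) + h$2 * (d2 x + e2 x))) (at x)" for x
      by (rule has_derivative_eq_rhs[OF has_derivative_add[OF d(3) e(3)]]) (auto simp: algebra_simps)
  qed (intro continuous_intros d e)+
qed

lemma C1_fun_mult: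
  assumes "C1_fun f" "C1_fun g" shows "C1_fun (\<lambda>x. f x * g x)"
proof -
  obtain d1 d2 where d: "continuous_on UNIV d1" "continuous_on UNIV d2"
    "\<And>x. (f has_derivative (\<lambda>h. h$1 * d1 x + h$2 * d2 x)) (at x)"
    using assms(1) unfolding C1_fun_def by blast
  obtain e1 e2 where e: "continuous_on UNIV e1" "continuous_on UNIV e2"
    "\<And>x. (g has_derivative (\<lambda>h. h$1 * e1 x + h$2 * e2 x)) (at x)"
    using assms(2) unfolding C1_fun_def by blast
  show ?thesis
  proof (rule C1_funI[of "\<lambda>x. f x * e1 x + d1 x * g x" "\<lambda>x. f x * e2 x + d2 x * g x"])
    show "((\<lambda>x. f x * g x) has_derivative
        (\<lambda>h. h$1 * (f x * e1 x + d1 x * g x) + h$2 * (f x * e2 x + d2 x * g x))) (at x)" for x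
      by (rule has_derivative_eq_rhs[OF has_derivative_mult[OF d(3) e(3)]]) (auto simp: algebra_simps)
  qed (intro continuous_intros d e C1_fun_continuous assms)+
qed

lemma C1_fun_sum: "(\<And>i. i \<in> A \<Longrightarrow> C1_fun (f i)) \<Longrightarrow> C1_fun (\<lambda>x. \<Sum>i\<in>A. f i x)"
  by (induction A rule: infinite_finite_induct) (auto intro: C1_fun_const C1_fun_add)

lemma C1_fun_power: "C1_fun f \<Longrightarrow> C1_fun (\<lambda>x. f x ^ i)"
  by (induction i) (auto intro: C1_fun_const C1_fun_mult)

lemma C1_fun_poly1:
  assumes "q \<in> poly1 r" shows "C1_fun q"
proof -
  obtain a where "q = (\<lambda>x. \<Sum>i\<le>r. \<Sum>j\<le>r - i. a i j * (x$1)^i * (x$2)^j)"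
    using assms unfolding poly1_def by blast
  then show ?thesis
    by (auto intro!: C1_fun_sum C1_fun_mult C1_fun_const C1_fun_power C1_fun_nth)
qed

lemma C1_fun_poly3: "q \<in> poly3 r \<Longrightarrow> C1_fun (\<lambda>x. q x $ k)"
  by (auto simp: poly3_def intro: C1_fun_poly1)

lemma poly3_continuous:
  assumes "q \<in> poly3 r" shows "continuous_on UNIV q"
proof -
  have "continuous_on UNIV (\<lambda>x. \<chi> k. q x $ k)"
    by (rule continuous_on_vec_lambda, rule C1_fun_continuous, rule C1_fun_poly3[OF assms])
  then show ?thesis by (simp add: vec_lambda_eta)
qed

text \<open>The bridge from componentwise derivatives to \<open>partial\<close>, which is defined
  through the derivative of the vector-valued map.\<close>

lemma partial_vec:
  fixes f :: "pt \<Rightarrow> real^'n"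
  assumes "\<And>k. ((\<lambda>x. f x $ k) has_derivative (\<lambda>h. h$1 * d1 k + h$2 * d2 k)) (at x)"
  shows "f differentiable (at x)" "partial 1 f x = (\<chi> k. d1 k)" "partial 2 f x = (\<chi> k. d2 k)"
proof -
  have "(f has_derivative (\<lambda>h. \<chi> k. h$1 * d1 k + h$2 * d2 k)) (at x)"
  proof (subst has_derivative_componentwise_within, rule ballI)
    fix b :: "real^'n" assume "b \<in> Basis"
    then obtain k where b: "b = axis k 1" by (auto simp: Basis_vec_def)
    show "((\<lambda>x. f x \<bullet> b) has_derivative (\<lambda>h. (\<chi> k. h$1 * d1 k + h$2 * d2 k) \<bullet> b)) (at x)"
      using assms[of k] by (simp add: b inner_axis)
  qed
  then have "f differentiable (at x)" "frechet_derivative f (at x) = (\<lambda>h. \<chi> k. h$1 * d1 k + h$2 * d2 k)"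
    by (auto simp: differentiable_def frechet_derivative_at[symmetric])
  then show "f differentiable (at x)" "partial 1 f x = (\<chi> k. d1 k)" "partial 2 f x = (\<chi> k. d2 k)"
    by (auto simp: partial_def axis_def vec_eq_iff)
qed

section \<open>Pointwise algebra of flux and reflection, and the energy flux field\<close>

lemma flux_inner: "flux c n a \<bullet> b =
   c * (n$1 * (a$1 * b$2 + a$2 * b$1) + n$2 * (a$1 * b$3 + a$3 * b$1))"
  by (simp add: flux_def A_mat_def inner_vec_def matrix_vector_mult_def sum_2 sum_3 algebra_simps)

lemma A_mat_inner:
  "(A_mat c 1 *v a) \<bullet> b = c * (a$1 * b$2 + a$2 * b$1)"
  "(A_mat c 2 *v a) \<bullet> b = c * (a$1 * b$3 + a$3 * b$1)"
  by (simp_all add: A_mat_def inner_vec_def matrix_vector_mult_def sum_3 algebra_simps)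

text \<open>Symmetry of the matrices A_k; it removes the cross terms of the central flux on the
  diagonal.\<close>

lemma flux_inner_commute: "flux c n a \<bullet> b = flux c n b \<bullet> a"
  by (simp add: flux_inner algebra_simps)

lemma mirror_nth:
  "mirror n a $ 1 = a $ 1"
  "mirror n a $ 2 = a $ 2 - 2 * (a $ 2 * n $ 1 + a $ 3 * n $ 2) * n $ 1"
  "mirror n a $ 3 = a $ 3 - 2 * (a $ 2 * n $ 1 + a $ 3 * n $ 2) * n $ 2"
  by (simp_all add: mirror_def state_def vel_def inner_vec_def sum_2)

lemma norm_1_sum_squares: "norm (n :: pt) = 1 \<Longrightarrow> n$1 * n$1 + n$2 * n$2 = 1"
  by (simp add: norm_eq_1 inner_vec_def sum_2)

text \<open>The product is c p times the sum of the normal velocities of the two states, and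
  reflection by a unit normal flips the sign of the normal velocity.\<close>

lemma flux_mirror_inner:
  assumes "norm n = 1" shows "flux c n (mirror n a) \<bullet> a = 0"
proof -
  have "flux c n (mirror n a) \<bullet> a =
      2 * c * a$1 * (a$2 * n$1 + a$3 * n$2) * (1 - (n$1 * n$1 + n$2 * n$2))"
    by (simp only: flux_inner mirror_nth) algebra
  then show ?thesis using norm_1_sum_squares[OF assms] by simp
qed

text \<open>The field has components 1/2 <A_k q, q>. As A_k is symmetric, differentiation gives <A_k
  q, d_k q> without the factor 1/2.\<close>

lemma energy_flux_field:
  assumes "q \<in> poly3 r"
  obtains F where "C1_field F" "\<And>x. (\<Sum>k\<in>UNIV. partial k F x $ k) = flux_grad c q q x"
    "\<And>x n. F x \<bullet> n = (1/2) * (flux c n (q x) \<bullet> q x)"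
proof -
  define F :: "pt \<Rightarrow> pt" where "F = (\<lambda>x. \<chi> k. (1/2) * ((A_mat c k *v q x) \<bullet> q x))"
  define D where "D k d1 d2 \<longleftrightarrow> continuous_on UNIV d1 \<and> continuous_on UNIV d2 \<and>
     (\<forall>x. ((\<lambda>x. q x $ k) has_derivative (\<lambda>h. h$1 * d1 x + h$2 * d2 x)) (at x))" for k d1 d2
  have "\<forall>k. \<exists>d. D k (fst d) (snd d)"
    using C1_fun_poly3[OF assms(1)] unfolding C1_fun_def D_def by simp
  then obtain d where d: "\<And>k. D k (fst (d k)) (snd (d k))"
    using choice[of "\<lambda>k d. D k (fst d) (snd d)"] by blast
  define d1 d2 where "d1 k = fst (d k)" and "d2 k = snd (d k)" for k
  have d: "continuous_on UNIV (d1 k)" "continuous_on UNIV (d2 k)"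
      "((\<lambda>x. q x $ k) has_derivative (\<lambda>h. h$1 * d1 k x + h$2 * d2 k x)) (at x)" for k x
    using d[of k] by (auto simp: D_def d1_def d2_def)
  \<comment> \<open>The component of the state that A_k couples with the pressure, namely the
    velocity v_k.\<close>
  define g where "g k = (if k = 1 then 2 else 3 :: 3)" for k :: 2
  have F: "F x $ k = c * (q x $ 1 * q x $ g k)" for x k
    using exhaust_2[of k] by (auto simp: F_def A_mat_inner g_def algebra_simps)
  have DF: "((\<lambda>x. F x $ k) has_derivative
      (\<lambda>h. h$1 * (c * (q x $ 1 * d1 (g k) x + d1 1 x * q x $ g k)) +
           h$2 * (c * (q x $ 1 * d2 (g k) x + d2 1 x * q x $ g k)))) (at x)" for k x
    unfolding F
    by (rule has_derivative_eq_rhs, rule has_derivative_mult_right, rule has_derivative_mult[OF d(3) d(3)])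
       (auto simp: algebra_simps)
  note pF = partial_vec[OF DF]
  note qc = C1_fun_continuous[OF C1_fun_poly3[OF assms(1)]]
  have "continuous_on UNIV (partial 1 F)"
    unfolding ext[of "partial 1 F", OF pF(2)]
    by (intro continuous_on_vec_lambda continuous_intros d qc)
  moreover have "continuous_on UNIV (partial 2 F)"
    unfolding ext[of "partial 2 F", OF pF(3)]
    by (intro continuous_on_vec_lambda continuous_intros d qc)
  ultimately have 1: "C1_field F" unfolding C1_field_def forall_2 using pF(1) by blast
  have q: "partial 1 q x = (\<chi> k. d1 k x)" "partial 2 q x = (\<chi> k. d2 k x)" for x
    by (rule partial_vec[OF d(3)])+
  have g: "g 1 = 2" "g 2 = 3" by (simp_all add: g_def)
  have 2: "(\<Sum>k\<in>UNIV. partial k F x $ k) = flux_grad c q q x" for x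
    by (simp only: sum_2 pF(2,3) vec_lambda_beta g flux_grad_def q A_mat_inner) (simp add: algebra_simps)
  have "F x \<bullet> n = F x $ 1 * n $ 1 + F x $ 2 * n $ 2" for x n by (simp only: inner_vec_def sum_2 inner_real_def)
  then have 3: "F x \<bullet> n = (1/2) * (flux c n (q x) \<bullet> q x)" for x n
    by (simp only: F g flux_inner) (simp add: algebra_simps)
  show thesis using 1 2 3 by (rule that)
qed

section \<open>Geometry of cut-cell meshes\<close>

lemma emeasure_length_measure_singleton: "emeasure length_measure {x} = 0"
proof -
  have "hausdorff_pre \<delta> {x} = 0" if "\<delta> > 0" for \<delta>
    using hausdorff_pre_le[of "{x}" "\<lambda>_. {x}" \<delta>] that by simp
  then show ?thesis by (simp add: emeasure_length_measure hausdorff_outer_def)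
qed

text \<open>Two points of a face are what excludes a third adjacent cell and what spans the line of
  a straight face.\<close>

lemma exists_two_points:
  assumes "0 < emeasure length_measure g"
  shows "\<exists>x\<in>g. \<exists>y\<in>g. x \<noteq> y"
proof (rule ccontr)
  assume "\<not> ?thesis"
  then have "g = {} \<or> (\<exists>x. g = {x})" by blast
  then show False using assms by (auto simp: emeasure_length_measure_singleton)
qed

lemma AE_pos_measure_ex:
  assumes "AE x in length_measure. x \<in> g \<longrightarrow> P x" "0 < emeasure length_measure g" "g \<in> sets borel"
  shows "\<exists>x\<in>g. P x"
proof (rule ccontr)
  assume *: "\<not> ?thesis"
  have "AE x in length_measure. x \<notin> g" using assms(1) by eventually_elim (use * in blast)
  then have "g \<in> null_sets length_measure" using assms(3) by (simp add: AE_iff_null_sets)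
  then show False using assms(2) by auto
qed

lemma eventually_along_ray:
  fixes x d :: "'a::real_normed_vector"
  assumes "\<forall>\<^sub>F y in nhds x. P y"
  shows "\<forall>\<^sub>F t in at_right 0. P (x + t *\<^sub>R d)"
proof -
  have "((\<lambda>t. x + t *\<^sub>R d) \<longlongrightarrow> x + 0 *\<^sub>R d) (at_right 0)" by (intro tendsto_intros)
  then show ?thesis using assms by (simp add: filterlim_iff)
qed

text \<open>A ray that is not tangential lies in one of the cones of the definition once
  \<open>e\<close> is small enough.\<close>

lemma is_outward_normal_ray:
  assumes "is_outward_normal A x n"
  shows "d \<bullet> n < 0 \<Longrightarrow> \<forall>\<^sub>F t in at_right 0. x + t *\<^sub>R d \<in> A"
    and "d \<bullet> n > 0 \<Longrightarrow> \<forall>\<^sub>F t in at_right 0. x + t *\<^sub>R d \<notin> A"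
proof -
  have ev: "\<forall>\<^sub>F t in at_right 0.
     (t * (d \<bullet> n) < - e * (t * norm d) \<longrightarrow> x + t *\<^sub>R d \<in> A) \<and>
     (t * (d \<bullet> n) > e * (t * norm d) \<longrightarrow> x + t *\<^sub>R d \<notin> A)" if "e > 0" for e
  proof -
    have *: "\<forall>\<^sub>F y in nhds x. ((y - x) \<bullet> n < - e * norm (y - x) \<longrightarrow> y \<in> A) \<and>
                            ((y - x) \<bullet> n > e * norm (y - x) \<longrightarrow> y \<notin> A)"
      using assms that unfolding is_outward_normal_def by blast
    show ?thesis
      using eventually_along_ray[OF *, of d] eventually_at_right_less[of 0]
      by eventually_elim auto
  qed
  show "\<forall>\<^sub>F t in at_right 0. x + t *\<^sub>R d \<in> A" if "d \<bullet> n < 0"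
  proof -
    have d: "norm d > 0" using that by auto
    \<comment> \<open>Half the cosine of the angle between \<open>d\<close> and \<open>- n\<close>,
      so the ray lies strictly inside the cone; the second claim uses the same choice for
      \<open>n\<close>.\<close>
    define e where "e = - (d \<bullet> n) / (2 * norm d)"
    have e: "e > 0" "e * norm d = - (d \<bullet> n) / 2" using that d by (auto simp: e_def field_simps)
    show ?thesis using ev[OF e(1)] eventually_at_right_less[of 0]
    proof eventually_elim
      case (elim t)
      have "t * (d \<bullet> n) < t * (d \<bullet> n / 2)" using elim(2) that by simp
      also have "\<dots> = - e * (t * norm d)" using e(2) by (simp add: algebra_simps)
      finally show ?case using elim(1) by blast
    qed
  qed
  show "\<forall>\<^sub>F t in at_right 0. x + t *\<^sub>R d \<notin> A" if "d \<bullet> n > 0"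
  proof -
    have d: "norm d > 0" using that by auto
    define e where "e = (d \<bullet> n) / (2 * norm d)"
    have e: "e > 0" "e * norm d = (d \<bullet> n) / 2" using that d by (auto simp: e_def field_simps)
    show ?thesis using ev[OF e(1)] eventually_at_right_less[of 0]
    proof eventually_elim
      case (elim t)
      have "e * (t * norm d) = t * (d \<bullet> n / 2)" using e(2) by (simp add: algebra_simps)
      also have "\<dots> < t * (d \<bullet> n)" using elim(2) that by simp
      finally show ?case using elim(1) by blast
    qed
  qed
qed

text \<open>A direction that leaves \<open>A\<close> and is transversal to \<open>n\<close> contradicts the fact that \<open>L\<close> and \<open>R\<close>
  together fill both sides of the line orthogonal to \<open>n\<close>.\<close>

lemma outward_normals_exclusive:
  assumes "is_outward_normal L x n" "is_outward_normal R x (- n)" "L \<subseteq> A" "R \<subseteq> A"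
  shows "\<not> is_outward_normal A x n'"
proof
  assume A: "is_outward_normal A x n'"
  have norms: "n \<bullet> n = 1" "n' \<bullet> n' = 1" using assms(1) A by (auto simp: is_outward_normal_def norm_eq_1)
  \<comment> \<open>The direction \<open>n'\<close> works unless it is orthogonal to
    \<open>n\<close>; in that case \<open>n + n'\<close> has inner product 1 with both
    normals.\<close>
  obtain d where d: "d \<bullet> n' > 0" "d \<bullet> n \<noteq> 0"
  proof (cases "n' \<bullet> n = 0")
    case True
    then show ?thesis using norms by (intro that[of "n + n'"]) (auto simp: inner_add_left inner_add_right inner_commute)
  next
    case False
    then show ?thesis using norms by (intro that[of n']) auto
  qed
  have "\<forall>\<^sub>F t in at_right 0. x + t *\<^sub>R d \<in> L \<union> R"
  proof (cases "d \<bullet> n < 0")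
    case True
    from is_outward_normal_ray(1)[OF assms(1) True] show ?thesis by (rule eventually_mono) simp
  next
    case False
    then have "d \<bullet> (- n) < 0" using d by simp
    from is_outward_normal_ray(1)[OF assms(2) this] show ?thesis
      by (rule eventually_mono) simp
  qed
  moreover have "\<forall>\<^sub>F t in at_right 0. x + t *\<^sub>R d \<notin> A"
    using is_outward_normal_ray(2)[OF A] d by blast
  ultimately have "\<forall>\<^sub>F t in at_right (0::real). False"
    by eventually_elim (use assms in blast)
  then show False by simp
qed

text \<open>By strict monotonicity two closed grid intervals can meet only at a common node of
  neighbouring intervals. That the indices are consecutive is the part that rules out three mutually
  touching intervals.\<close>

lemma sorted_grid_overlap:
  fixes xs :: "real list"
  assumes "sorted_wrt (<) xs" "Suc i < length xs" "Suc j < length xs" "i \<noteq> j"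
    "xs ! i \<le> z" "z \<le> xs ! Suc i" "xs ! j \<le> z" "z \<le> xs ! Suc j"
  shows "z = xs ! max i j \<and> max i j = Suc (min i j)"
proof -
  have *: "z = xs ! j \<and> j = Suc i"
    if "i < j" "Suc i < length xs" "Suc j < length xs" "z \<le> xs ! Suc i" "xs ! j \<le> z" for i j
  proof (cases "Suc i < j")
    case True
    then have "xs ! Suc i < xs ! j" using assms(1) that by (intro sorted_wrt_nth_less) auto
    then show ?thesis using that by simp
  next
    case False
    then have "j = Suc i" using that by simp
    then show ?thesis using that by auto
  qed
  show ?thesis
    using *[of i j] *[of j i] assms by (cases i j rule: linorder_cases) auto
qed

locale cut_mesh =
  fixes M :: cut_mesh
  assumes mesh: "cut_cell_mesh M"
begin

lemma grid: "sorted_wrt (<) (xgrid M)" "sorted_wrt (<) (ygrid M)" "open (Omega M)"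
    "Omega M \<subseteq> cbox (vector [hd (xgrid M), hd (ygrid M)]) (vector [last (xgrid M), last (ygrid M)])"
    "2 \<le> length (xgrid M)" "2 \<le> length (ygrid M)"
  using mesh by (auto simp: cut_cell_mesh_def cartesian_domain_def)

definition gbox :: "nat \<Rightarrow> nat \<Rightarrow> pt set" where
  "gbox i j = box (vector [xgrid M ! i, ygrid M ! j]) (vector [xgrid M ! Suc i, ygrid M ! Suc j])"

lemma mem_gbox: "x \<in> gbox i j \<longleftrightarrow> xgrid M ! i < x$1 \<and> x$1 < xgrid M ! Suc i \<and>
    ygrid M ! j < x$2 \<and> x$2 < ygrid M ! Suc j"
  by (auto simp: gbox_def mem_box_cart forall_2)

lemma closure_gbox: "x \<in> closure (gbox i j) \<Longrightarrow> xgrid M ! i \<le> x$1 \<and> x$1 \<le> xgrid M ! Suc i \<and>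
    ygrid M ! j \<le> x$2 \<and> x$2 \<le> ygrid M ! Suc j"
proof -
  assume x: "x \<in> closure (gbox i j)"
  have "closure (gbox i j) \<subseteq> cbox (vector [xgrid M ! i, ygrid M ! j]) (vector [xgrid M ! Suc i, ygrid M ! Suc j])"
    unfolding gbox_def by (intro closure_minimal box_subset_cbox closed_cbox)
  then show ?thesis using x by (auto simp: mem_box_cart forall_2)
qed

lemma cell_gbox:
  assumes "E \<in> cells M"
  obtains i j where "Suc i < length (xgrid M)" "Suc j < length (ygrid M)" "E = gbox i j \<inter> Omega M"
  using assms by (auto simp: cells_def bg_cells_def gbox_def)

lemma cell_nonempty: "E \<in> cells M \<Longrightarrow> E \<noteq> {}"
  and cell_subset: "E \<in> cells M \<Longrightarrow> E \<subseteq> Omega M"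
  by (auto simp: cells_def)

lemma cell_open: "E \<in> cells M \<Longrightarrow> open E"
  using grid(3) by (auto simp: cells_def bg_cells_def intro: open_Int)

lemma cell_bounded: "E \<in> cells M \<Longrightarrow> bounded E"
  by (auto simp: cells_def bg_cells_def intro: bounded_subset[OF bounded_box])

lemma finite_cells: "finite (cells M)"
proof -
  have "cells M \<subseteq> (\<lambda>(i, j). gbox i j \<inter> Omega M) ` ({..<length (xgrid M)} \<times> {..<length (ygrid M)})"
    by (fastforce elim!: cell_gbox)
  then show ?thesis by (rule finite_subset) simp
qed

lemma cells_disjoint:
  assumes "E \<in> cells M" "E' \<in> cells M" "E \<noteq> E'"
  shows "E \<inter> E' = {}"
proof (rule ccontr)
  assume "E \<inter> E' \<noteq> {}"
  then obtain x where x: "x \<in> E" "x \<in> E'" by blast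
  obtain i j where ij: "Suc i < length (xgrid M)" "Suc j < length (ygrid M)" "E = gbox i j \<inter> Omega M"
    using cell_gbox[OF assms(1)] .
  obtain k l where kl: "Suc k < length (xgrid M)" "Suc l < length (ygrid M)" "E' = gbox k l \<inter> Omega M"
    using cell_gbox[OF assms(2)] .
  have b: "x \<in> gbox i j" "x \<in> gbox k l" using x ij kl by auto
  have "i = k"
    using sorted_grid_overlap[OF grid(1) ij(1) kl(1), of "x$1"] b unfolding mem_gbox
    by (cases "i < k") (auto simp: max_def split: if_splits)
  moreover have "j = l"
    using sorted_grid_overlap[OF grid(2) ij(2) kl(2), of "x$2"] b unfolding mem_gbox
    by (cases "j < l") (auto simp: max_def split: if_splits)
  ultimately show False using ij kl assms(3) by simp
qed

text \<open>If the two points had different first coordinates, any two of the cells would lie in the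
  same column. Their three distinct row indices would then be pairwise consecutive, which is
  impossible; likewise for the second coordinate.\<close>

lemma three_cells_meet_at_most_once:
  assumes "E1 \<in> cells M" "E2 \<in> cells M" "E3 \<in> cells M" "E1 \<noteq> E2" "E1 \<noteq> E3" "E2 \<noteq> E3"
    "x \<in> closure E1" "x \<in> closure E2" "x \<in> closure E3"
    "y \<in> closure E1" "y \<in> closure E2" "y \<in> closure E3"
  shows "x = y"
proof -
  obtain i1 j1 where 1: "Suc i1 < length (xgrid M)" "Suc j1 < length (ygrid M)" "E1 = gbox i1 j1 \<inter> Omega M"
    using cell_gbox[OF assms(1)] .
  obtain i2 j2 where 2: "Suc i2 < length (xgrid M)" "Suc j2 < length (ygrid M)" "E2 = gbox i2 j2 \<inter> Omega M"
    using cell_gbox[OF assms(2)] .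
  obtain i3 j3 where 3: "Suc i3 < length (xgrid M)" "Suc j3 < length (ygrid M)" "E3 = gbox i3 j3 \<inter> Omega M"
    using cell_gbox[OF assms(3)] .
  have ne: "i1 \<noteq> i2 \<or> j1 \<noteq> j2" "i1 \<noteq> i3 \<or> j1 \<noteq> j3" "i2 \<noteq> i3 \<or> j2 \<noteq> j3"
    using assms(4-6) 1(3) 2(3) 3(3) by auto
  have sub: "closure E1 \<subseteq> closure (gbox i1 j1)" "closure E2 \<subseteq> closure (gbox i2 j2)"
      "closure E3 \<subseteq> closure (gbox i3 j3)"
    by (auto simp: 1 2 3 intro!: closure_mono)
  note b = closure_gbox[OF subsetD[OF sub(1)]] closure_gbox[OF subsetD[OF sub(2)]] closure_gbox[OF subsetD[OF sub(3)]]
  note X = sorted_grid_overlap[OF grid(1)] and Y = sorted_grid_overlap[OF grid(2)]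
  have x12: "x$1 = y$1" "max i1 i2 = Suc (min i1 i2)" if "i1 \<noteq> i2"
    using X[OF 1(1) 2(1) that, of "x$1"] X[OF 1(1) 2(1) that, of "y$1"] b assms(7-12) by auto
  have x13: "x$1 = y$1" "max i1 i3 = Suc (min i1 i3)" if "i1 \<noteq> i3"
    using X[OF 1(1) 3(1) that, of "x$1"] X[OF 1(1) 3(1) that, of "y$1"] b assms(7-12) by auto
  have x23: "x$1 = y$1" "max i2 i3 = Suc (min i2 i3)" if "i2 \<noteq> i3"
    using X[OF 2(1) 3(1) that, of "x$1"] X[OF 2(1) 3(1) that, of "y$1"] b assms(7-12) by auto
  have y12: "x$2 = y$2" "max j1 j2 = Suc (min j1 j2)" if "j1 \<noteq> j2"
    using Y[OF 1(2) 2(2) that, of "x$2"] Y[OF 1(2) 2(2) that, of "y$2"] b assms(7-12) by auto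
  have y13: "x$2 = y$2" "max j1 j3 = Suc (min j1 j3)" if "j1 \<noteq> j3"
    using Y[OF 1(2) 3(2) that, of "x$2"] Y[OF 1(2) 3(2) that, of "y$2"] b assms(7-12) by auto
  have y23: "x$2 = y$2" "max j2 j3 = Suc (min j2 j3)" if "j2 \<noteq> j3"
    using Y[OF 2(2) 3(2) that, of "x$2"] Y[OF 2(2) 3(2) that, of "y$2"] b assms(7-12) by auto
  have "x$1 = y$1"
  proof (rule ccontr)
    assume "x$1 \<noteq> y$1"
    then have "i1 = i2" "i1 = i3" using x12 x13 by auto
    then have "j1 \<noteq> j2" "j1 \<noteq> j3" "j2 \<noteq> j3" using ne by auto
    with y12(2) y13(2) y23(2) show False by (simp add: max_def min_def split: if_splits)
  qed
  moreover have "x$2 = y$2"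
  proof (rule ccontr)
    assume "x$2 \<noteq> y$2"
    then have "j1 = j2" "j1 = j3" using y12 y13 by auto
    then have "i1 \<noteq> i2" "i1 \<noteq> i3" "i2 \<noteq> i3" using ne by auto
    with x12(2) x13(2) x23(2) show False by (simp add: max_def min_def split: if_splits)
  qed
  ultimately show ?thesis by (simp add: vec_eq_iff forall_2)
qed

lemma closure_Int_subset_frontier:
  assumes "E \<in> cells M" "E' \<in> cells M" "E \<noteq> E'"
  shows "closure E \<inter> closure E' \<subseteq> frontier E"
proof -
  have "E \<inter> closure E' = {}"
    using cells_disjoint[OF assms] cell_open[OF assms(1)] by (simp add: open_Int_closure_eq_empty)
  then show ?thesis using cell_open[OF assms(1)] by (auto simp: frontier_def interior_open)
qed

lemma int_face:
  assumes "g \<in> int_faces M"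
  shows "leftc M g \<in> cells M" "rightc M g \<in> cells M" "leftc M g \<noteq> rightc M g"
    "g = closure (leftc M g) \<inter> closure (rightc M g)" "closed g" "0 < emeasure length_measure g"
    "g \<subseteq> frontier (leftc M g)" "g \<subseteq> frontier (rightc M g)"
proof -
  show *: "leftc M g \<in> cells M" "rightc M g \<in> cells M" "leftc M g \<noteq> rightc M g"
    "g = closure (leftc M g) \<inter> closure (rightc M g)"
    using mesh assms by (auto simp: cut_cell_mesh_def faces_oriented_def)
  show "closed g" by (subst *(4)) (intro closed_Int closed_closure)
  show "0 < emeasure length_measure g" using assms by (auto simp: int_faces_def)
  show "g \<subseteq> frontier (leftc M g)" by (subst (1) *(4)) (rule closure_Int_subset_frontier[OF *(1-3)])
  show "g \<subseteq> frontier (rightc M g)"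
    by (subst (1) *(4), subst Int_commute) (rule closure_Int_subset_frontier[OF *(2,1) *(3)[symmetric]])
qed

text \<open>A third cell with \<open>g\<close> in its frontier would share two points with both
  cells of \<open>g\<close>.\<close>

lemma int_face_subset_frontier:
  assumes "g \<in> int_faces M" "E \<in> cells M"
  shows "g \<subseteq> frontier E \<longleftrightarrow> leftc M g = E \<or> rightc M g = E"
proof
  assume g: "g \<subseteq> frontier E"
  show "leftc M g = E \<or> rightc M g = E"
  proof (rule ccontr)
    assume "\<not> ?thesis"
    then have ne: "leftc M g \<noteq> E" "rightc M g \<noteq> E" by auto
    obtain x y where xy: "x \<in> g" "y \<in> g" "x \<noteq> y"
      using exists_two_points[OF int_face(6)[OF assms(1)]] by blast
    then have "x \<in> closure E" "y \<in> closure E" using g by (auto simp: frontier_def)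
    moreover have "x \<in> closure (leftc M g) \<inter> closure (rightc M g)" "y \<in> closure (leftc M g) \<inter> closure (rightc M g)"
      using int_face(4)[OF assms(1)] xy by auto
    ultimately show False
      using three_cells_meet_at_most_once[OF int_face(1,2)[OF assms(1)] assms(2) int_face(3)[OF assms(1)] ne] xy
      by auto
  qed
qed (use int_face(7,8)[OF assms(1)] in auto)

lemma AE_int_normal: "g \<in> int_faces M \<Longrightarrow> AE x in length_measure. x \<in> g \<longrightarrow>
    is_outward_normal (leftc M g) x (normal M g x) \<and> is_outward_normal (rightc M g) x (- normal M g x)"
  and AE_bd_normal: "g \<in> bd_faces M \<Longrightarrow> AE x in length_measure. x \<in> g \<longrightarrow>
    is_outward_normal (Omega M) x (normal M g x)"
  and normal_measurable: "g \<in> int_faces M \<union> bd_faces M \<Longrightarrow> set_borel_measurable borel g (normal M g)"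
  using mesh by (auto simp: cut_cell_mesh_def faces_oriented_def)

lemma bd_faceE:
  assumes "g \<in> bd_faces M"
  obtains E where "E \<in> cells M" "g = closure E \<inter> frontier (Omega M)" "0 < emeasure length_measure g" "closed g"
  using assms by (auto simp: bd_faces_def intro: closed_Int)

text \<open>Positive length of \<open>g'\<close> yields one point at which all the almost-everywhere
  normal conditions hold together.\<close>

lemma int_bd_not_subset:
  assumes "g \<in> int_faces M" "g' \<in> bd_faces M"
  shows "\<not> g' \<subseteq> g"
proof
  assume sub: "g' \<subseteq> g"
  have "AE x in length_measure. x \<in> g' \<longrightarrow> False"
    using AE_int_normal[OF assms(1)] AE_bd_normal[OF assms(2)]
    by eventually_elim (use sub outward_normals_exclusive[OF _ _ cell_subset cell_subset] int_face(1,2)[OF assms(1)] in blast)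
  moreover have "0 < emeasure length_measure g'" "closed g'" using bd_faceE[OF assms(2)] by auto
  ultimately have "\<exists>x\<in>g'. False" by (intro AE_pos_measure_ex) auto
  then show False by blast
qed

lemma int_bd_disjoint: "int_faces M \<inter> bd_faces M = {}"
  using int_bd_not_subset by blast

text \<open>If the frontier of a second cell contained \<open>g\<close>, the two closures would meet
  in a set of positive length, hence in an interior face containing a wall face. The same argument
  makes \<open>bd_cell\<close> unique.\<close>

lemma bd_face_subset_frontier:
  assumes "g \<in> bd_faces M" "E \<in> cells M"
  shows "g \<subseteq> frontier E \<longleftrightarrow> g = closure E \<inter> frontier (Omega M)"
proof
  assume g: "g \<subseteq> frontier E"
  obtain E0 where E0: "E0 \<in> cells M" "g = closure E0 \<inter> frontier (Omega M)" "0 < emeasure length_measure g" "closed g"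
    using bd_faceE[OF assms(1)] .
  have "E0 = E"
  proof (rule ccontr)
    assume ne: "E0 \<noteq> E"
    have sub: "g \<subseteq> closure E0 \<inter> closure E" using E0 g by (auto simp: frontier_def)
    then have "emeasure length_measure g \<le> emeasure length_measure (closure E0 \<inter> closure E)"
      by (intro emeasure_mono) auto
    then have "closure E0 \<inter> closure E \<in> int_faces M"
      unfolding int_faces_def using E0(1,3) assms(2) ne by (fastforce intro: less_le_trans)
    then show False using int_bd_not_subset assms(1) sub by blast
  qed
  then show "g = closure E \<inter> frontier (Omega M)" using E0 by simp
next
  assume g: "g = closure E \<inter> frontier (Omega M)"
  have "frontier (Omega M) \<inter> Omega M = {}" using grid(3) by (auto simp: frontier_def interior_open)
  then show "g \<subseteq> frontier E"
    unfolding g frontier_def[of E] using cell_subset[OF assms(2)] interior_subset[of E] by blast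
qed

lemma bd_cell_unique:
  assumes "g \<in> bd_faces M" "E \<in> cells M" "E' \<in> cells M" "g \<subseteq> frontier E" "g \<subseteq> frontier E'"
  shows "E = E'"
proof (rule ccontr)
  assume ne: "E \<noteq> E'"
  have m: "0 < emeasure length_measure g" using bd_faceE[OF assms(1)] .
  have sub: "g \<subseteq> closure E \<inter> closure E'" using assms(4,5) by (auto simp: frontier_def)
  then have "emeasure length_measure g \<le> emeasure length_measure (closure E \<inter> closure E')"
    by (intro emeasure_mono) auto
  then have "closure E \<inter> closure E' \<in> int_faces M"
    unfolding int_faces_def using m assms(2,3) ne by (fastforce intro: less_le_trans)
  then show False using int_bd_not_subset assms(1) sub by blast
qed

lemma bd_cell:
  assumes "g \<in> bd_faces M"
  shows "bd_cell M g \<in> cells M" "g \<subseteq> frontier (bd_cell M g)"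
    "E \<in> cells M \<Longrightarrow> g \<subseteq> frontier E \<longleftrightarrow> bd_cell M g = E"
    "closed g" "0 < emeasure length_measure g"
proof -
  show c: "closed g" "0 < emeasure length_measure g" using bd_faceE[OF assms] by auto
  obtain E0 where E0: "E0 \<in> cells M" "g = closure E0 \<inter> frontier (Omega M)" using bd_faceE[OF assms] .
  have "bd_cell M g = E0"
    unfolding bd_cell_def using E0 bd_cell_unique[OF assms] bd_face_subset_frontier[OF assms]
    by (intro the_equality) blast+
  then show *: "bd_cell M g \<in> cells M" "g \<subseteq> frontier (bd_cell M g)"
    using E0 bd_face_subset_frontier[OF assms] by auto
  show "E \<in> cells M \<Longrightarrow> g \<subseteq> frontier E \<longleftrightarrow> bd_cell M g = E"
    using * bd_cell_unique[OF assms] by blast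
qed

lemma finite_faces: "finite (int_faces M)" "finite (bd_faces M)"
proof -
  have "int_faces M \<subseteq> (\<lambda>(E1, E2). closure E1 \<inter> closure E2) ` (cells M \<times> cells M)"
    by (auto simp: int_faces_def)
  then show "finite (int_faces M)" by (rule finite_subset) (simp add: finite_cells)
  have "bd_faces M \<subseteq> (\<lambda>E. closure E \<inter> frontier (Omega M)) ` cells M"
    by (auto simp: bd_faces_def)
  then show "finite (bd_faces M)" by (rule finite_subset) (simp add: finite_cells)
qed

lemma finite_faces_of: "finite (int_faces_of M E)" "finite (bd_faces_of M E)" "finite (faces_of M E)"
  using finite_faces by (auto simp: int_faces_of_def bd_faces_of_def faces_of_def)

lemma sum_faces_of:
  fixes h :: "pt set \<Rightarrow> real"
  shows "(\<Sum>g\<in>faces_of M E. h g) = (\<Sum>g\<in>int_faces_of M E. h g) + (\<Sum>g\<in>bd_faces_of M E. h g)"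
  unfolding faces_of_def
  by (rule sum.union_disjoint[OF finite_faces_of(1,2)])
     (use int_bd_disjoint in \<open>auto simp: int_faces_of_def bd_faces_of_def\<close>)

text \<open>Double counting: an interior face is met from exactly two cells, a boundary face from
  one.\<close>

lemma sum_cells_faces:
  fixes h :: "pt set \<Rightarrow> pt set \<Rightarrow> real"
  shows "(\<Sum>E\<in>cells M. \<Sum>g\<in>faces_of M E. h E g) =
    (\<Sum>g\<in>int_faces M. h (leftc M g) g + h (rightc M g) g) + (\<Sum>g\<in>bd_faces M. h (bd_cell M g) g)"
proof -
  have "(\<Sum>E\<in>cells M. \<Sum>g\<in>int_faces_of M E. h E g) = (\<Sum>g\<in>int_faces M. \<Sum>E | E \<in> cells M \<and> g \<subseteq> frontier E. h E g)"
    unfolding int_faces_of_def by (rule sum.swap_restrict[OF finite_cells finite_faces(1)])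
  also have "\<dots> = (\<Sum>g\<in>int_faces M. h (leftc M g) g + h (rightc M g) g)"
  proof (rule sum.cong[OF refl])
    fix g assume g: "g \<in> int_faces M"
    have "{E \<in> cells M. g \<subseteq> frontier E} = {leftc M g, rightc M g}"
      using int_face_subset_frontier[OF g] int_face(1,2)[OF g] by auto
    then show "(\<Sum>E | E \<in> cells M \<and> g \<subseteq> frontier E. h E g) = h (leftc M g) g + h (rightc M g) g"
      using int_face(3)[OF g] by simp
  qed
  finally have 1: "(\<Sum>E\<in>cells M. \<Sum>g\<in>int_faces_of M E. h E g) = \<dots>" .
  have "(\<Sum>E\<in>cells M. \<Sum>g\<in>bd_faces_of M E. h E g) = (\<Sum>g\<in>bd_faces M. \<Sum>E | E \<in> cells M \<and> g \<subseteq> frontier E. h E g)"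
    unfolding bd_faces_of_def by (rule sum.swap_restrict[OF finite_cells finite_faces(2)])
  also have "\<dots> = (\<Sum>g\<in>bd_faces M. h (bd_cell M g) g)"
  proof (rule sum.cong[OF refl])
    fix g assume g: "g \<in> bd_faces M"
    have "{E \<in> cells M. g \<subseteq> frontier E} = {bd_cell M g}"
      using bd_cell[OF g] by auto
    then show "(\<Sum>E | E \<in> cells M \<and> g \<subseteq> frontier E. h E g) = h (bd_cell M g) g" by simp
  qed
  finally show ?thesis using 1 by (simp add: sum_faces_of sum.distrib)
qed

lemma bd_faces_of_unique: "E \<in> cells M \<Longrightarrow> g \<in> bd_faces_of M E \<Longrightarrow> g' \<in> bd_faces_of M E \<Longrightarrow> g = g'"
  unfolding bd_faces_of_def using bd_face_subset_frontier by blast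

lemma face_props:
  assumes "g \<in> int_faces M \<union> bd_faces M"
  shows "compact g" "emeasure length_measure g < \<infinity>"
    "AE x in length_measure. x \<in> g \<longrightarrow> norm (normal M g x) = 1"
proof -
  obtain E where E: "E \<in> cells M" "g \<subseteq> frontier E" "closed g"
    using assms int_face(1,5,7)[of g] bd_cell(1,2,4)[of g] by auto
  have b: "bounded (frontier E)" using cell_bounded[OF E(1)] by (auto simp: frontier_def intro: bounded_subset[OF bounded_closure])
  show "compact g" using E(3) bounded_subset[OF b E(2)] by (simp add: compact_eq_bounded_closed)
  have "emeasure length_measure g \<le> emeasure length_measure (frontier E)"
    using E by (intro emeasure_mono) auto
  \<comment> \<open>Finite length of the cell boundary is part of the regularity recorded in
    \<open>divergence_theorem\<close>.\<close>
  also have "\<dots> < \<infinity>"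
    using mesh E by (auto simp: cut_cell_mesh_def divergence_theorem_def)
  finally show "emeasure length_measure g < \<infinity>" .
  show "AE x in length_measure. x \<in> g \<longrightarrow> norm (normal M g x) = 1"
    using assms
  proof
    assume "g \<in> int_faces M"
    from AE_int_normal[OF this] show ?thesis by eventually_elim (auto simp: is_outward_normal_def)
  next
    assume "g \<in> bd_faces M"
    from AE_bd_normal[OF this] show ?thesis by eventually_elim (auto simp: is_outward_normal_def)
  qed
qed

end

section \<open>Traces and face integrals of piecewise polynomials\<close>

text \<open>Fields of the discrete space are polynomial only inside a cell; since the cell is open,
  their derivatives there can be read off from the polynomial.\<close>

lemma partial_cong_open:
  assumes "open E" "x \<in> E" "\<And>y. y \<in> E \<Longrightarrow> w y = q y" "q differentiable (at x)"
  shows "partial k w x = partial k q x"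
proof -
  obtain D where D: "(q has_derivative D) (at x)" using assms(4) by (auto simp: differentiable_def)
  then have "(w has_derivative D) (at x)"
    by (rule has_derivative_transform_within_open[OF _ assms(1,2)]) (simp add: assms(3))
  then show ?thesis using D by (simp add: partial_def frechet_derivative_at[symmetric])
qed

lemma poly3_differentiable:
  assumes "q \<in> poly3 r" shows "q differentiable (at x)"
proof -
  have "(\<lambda>x. q x $ k) differentiable (at x)" for k
    using C1_fun_poly3[OF assms, of k] by (auto simp: C1_fun_def differentiable_def)
  then have "(\<lambda>x. q x \<bullet> b) differentiable (at x)" if "b \<in> Basis" for b
    using that by (auto simp: Basis_vec_def inner_axis)
  then show ?thesis by (subst differentiable_componentwise_within) blast
qed

lemma flux_grad_cong_open:
  assumes "open E" "x \<in> E" "\<And>y. y \<in> E \<Longrightarrow> u y = q y" "q \<in> poly3 r"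
  shows "flux_grad c u u x = flux_grad c q q x"
  using assms partial_cong_open[OF assms(1-3) poly3_differentiable[OF assms(4)]]
  by (simp add: flux_grad_def)

lemma open_in_sets_lebesgue: "open (E :: pt set) \<Longrightarrow> E \<in> sets lebesgue"
  by (simp add: borel_open)

lemma flux_uminus_inner: "flux c (- n) a \<bullet> b = - (flux c n a \<bullet> b)"
  by (simp add: flux_inner algebra_simps)

text \<open>An expansion valid for every \<open>n\<close>, used only to see measurability where the
  normal need not have norm 1.\<close>

lemma flux_mirror_inner_components: "flux c n (mirror n a) \<bullet> a =
    c * (n$1 * (a$1 * a$2 + (a$2 - 2 * (a$2 * n$1 + a$3 * n$2) * n$1) * a$1) +
         n$2 * (a$1 * a$3 + (a$3 - 2 * (a$2 * n$1 + a$3 * n$2) * n$2) * a$1))"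
  by (simp only: flux_inner mirror_nth)

context cut_mesh
begin

lemma ext_poly:
  assumes "w \<in> V_space M r" "E \<in> cells M"
  shows "ext r E w \<in> poly3 r" "\<And>x. x \<in> E \<Longrightarrow> ext r E w x = w x"
proof -
  obtain q where q: "q \<in> poly3 r" "\<forall>x\<in>E. w x = q x"
    using assms unfolding V_space_def by blast
  have "ext r E w = q"
    unfolding ext_def
  proof (rule the_equality)
    show "q \<in> poly3 r \<and> (\<forall>x\<in>E. q x = w x)" using q by simp
    fix q' assume "q' \<in> poly3 r \<and> (\<forall>x\<in>E. q' x = w x)"
    then show "q' = q"
      using q by (intro poly3_eqI[OF cell_open[OF assms(2)] cell_nonempty[OF assms(2)]]) auto
  qed
  then show "ext r E w \<in> poly3 r" "\<And>x. x \<in> E \<Longrightarrow> ext r E w x = w x" using q by auto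
qed

lemma trace_from_ext:
  assumes "w \<in> V_space M r" "E \<in> cells M" "x \<in> frontier E"
  shows "trace_from E w x = ext r E w x"
proof -
  have "x \<in> closure E" "x \<notin> E"
    using assms(3) cell_open[OF assms(2)] by (auto simp: frontier_def interior_open)
  \<comment> \<open>A frontier point of an open cell lies outside it and is therefore a limit point,
    so the limit in \<open>trace_from\<close> is unique.\<close>
  then have "\<not> trivial_limit (at x within E)"
    by (auto simp: closure_def trivial_limit_within)
  moreover have "(w \<longlongrightarrow> ext r E w x) (at x within E)"
  proof (rule Lim_transform_eventually)
    have "isCont (ext r E w) x"
      using poly3_continuous[OF ext_poly(1)[OF assms(1,2)]] by (simp add: continuous_on_eq_continuous_at)
    then show "(ext r E w \<longlongrightarrow> ext r E w x) (at x within E)"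
      by (auto simp: isCont_def intro: tendsto_within_subset)
    show "\<forall>\<^sub>F y in at x within E. ext r E w y = w y"
      by (auto simp: eventually_at_filter ext_poly(2)[OF assms(1,2)])
  qed
  ultimately show ?thesis unfolding trace_from_def by (rule tendsto_Lim)
qed

lemma face_trace_ext:
  assumes "w \<in> V_space M r"
  shows "g \<in> int_faces M \<Longrightarrow> x \<in> g \<Longrightarrow> trL M g w x = ext r (leftc M g) w x"
    and "g \<in> int_faces M \<Longrightarrow> x \<in> g \<Longrightarrow> trR M g w x = ext r (rightc M g) w x"
    and "g \<in> bd_faces M \<Longrightarrow> x \<in> g \<Longrightarrow> trB M g w x = ext r (bd_cell M g) w x"
  using trace_from_ext[OF assms int_face(1)[of g], of x] trace_from_ext[OF assms int_face(2)[of g], of x]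
    trace_from_ext[OF assms bd_cell(1)[of g], of x] int_face(7,8)[of g] bd_cell(2)[of g]
  by (auto simp: trL_def trR_def trB_def)

text \<open>Faces have finite length, so an almost-everywhere bound suffices. Measurability is asked
  of the truncated function because the normal is measurable only on \<open>g\<close>.\<close>

lemma face_set_integrable:
  fixes f :: "pt \<Rightarrow> real"
  assumes "g \<in> int_faces M \<union> bd_faces M" "(\<lambda>x. indicator g x *\<^sub>R f x) \<in> borel_measurable borel"
    "AE x in length_measure. x \<in> g \<longrightarrow> \<bar>f x\<bar> \<le> B"
  shows "set_integrable length_measure g f"
  unfolding set_integrable_def
proof (rule integrableI_bounded_set[where A = g and B = B])
  show "g \<in> sets length_measure" using face_props(1)[OF assms(1)] by (simp add: borel_compact)
  show "(\<lambda>x. indicator g x *\<^sub>R f x) \<in> borel_measurable length_measure"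
    using assms(2) by (simp cong: measurable_cong_sets)
  show "AE x in length_measure. x \<in> g \<longrightarrow> norm (indicator g x *\<^sub>R f x) \<le> B"
    using assms(3) by eventually_elim simp
qed (use face_props(2)[OF assms(1)] in auto)

lemma face_flux_integrable:
  assumes g: "g \<in> int_faces M \<union> bd_faces M" and "continuous_on UNIV a" "continuous_on UNIV b"
  shows "set_integrable length_measure g (\<lambda>x. flux c (normal M g x) (a x) \<bullet> b x)"
proof -
  have [measurable]: "(\<lambda>x. a x $ k) \<in> borel_measurable borel" "(\<lambda>x. b x $ k) \<in> borel_measurable borel" for k
    using assms(2,3) by (auto intro!: borel_measurable_continuous_onI continuous_intros)
  \<comment> \<open>The flux is linear in the normal, so the indicator can be moved onto the normal,
    which thereby becomes measurable on the whole plane.\<close>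
  define N where "N x = indicator g x *\<^sub>R normal M g x" for x
  have "N \<in> borel_measurable borel"
    using normal_measurable[OF g] by (simp add: set_borel_measurable_def N_def[abs_def])
  then have [measurable]: "(\<lambda>x. N x $ k) \<in> borel_measurable borel" for k
    by (rule measurable_compose[OF _ borel_measurable_nth])
  \<comment> \<open>A continuous majorant from the bound 1 on the components of a unit normal; it is
    bounded on the compact face.\<close>
  define G where "G x = \<bar>c\<bar> * ((\<bar>a x $ 1 * b x $ 2\<bar> + \<bar>a x $ 2 * b x $ 1\<bar>) +
      (\<bar>a x $ 1 * b x $ 3\<bar> + \<bar>a x $ 3 * b x $ 1\<bar>))" for x
  have "continuous_on g G" unfolding G_def
    by (intro continuous_intros continuous_on_subset[OF assms(2)] continuous_on_subset[OF assms(3)] subset_UNIV)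
  then have "bounded (G ` g)"
    by (intro compact_imp_bounded compact_continuous_image face_props(1)[OF g])
  then obtain B where B: "\<And>x. x \<in> g \<Longrightarrow> \<bar>G x\<bar> \<le> B" by (auto simp: bounded_iff)
  show ?thesis
  proof (rule face_set_integrable[OF g, where B = B])
    have "(\<lambda>x. indicator g x *\<^sub>R (flux c (normal M g x) (a x) \<bullet> b x)) =
      (\<lambda>x. c * (N x $ 1 * (a x $ 1 * b x $ 2 + a x $ 2 * b x $ 1) + N x $ 2 * (a x $ 1 * b x $ 3 + a x $ 3 * b x $ 1)))"
      by (auto simp: fun_eq_iff N_def flux_inner indicator_def)
    also have "\<dots> \<in> borel_measurable borel" by measurable
    finally show "(\<lambda>x. indicator g x *\<^sub>R (flux c (normal M g x) (a x) \<bullet> b x)) \<in> borel_measurable borel" .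
    show "AE x in length_measure. x \<in> g \<longrightarrow> \<bar>flux c (normal M g x) (a x) \<bullet> b x\<bar> \<le> B"
      using face_props(3)[OF g]
    proof eventually_elim
      case (elim x)
      show ?case
      proof
        assume x: "x \<in> g"
        let ?n = "normal M g x"
        have n: "\<bar>?n $ k\<bar> \<le> 1" for k using component_le_norm_cart[of ?n k] elim x by simp
        have "\<bar>flux c ?n (a x) \<bullet> b x\<bar> = \<bar>c\<bar> * \<bar>?n$1 * (a x $ 1 * b x $ 2 + a x $ 2 * b x $ 1) +
            ?n$2 * (a x $ 1 * b x $ 3 + a x $ 3 * b x $ 1)\<bar>"
          by (simp add: flux_inner abs_mult)
        also have "\<dots> \<le> \<bar>c\<bar> * (\<bar>?n$1\<bar> * \<bar>a x $ 1 * b x $ 2 + a x $ 2 * b x $ 1\<bar> +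
            \<bar>?n$2\<bar> * \<bar>a x $ 1 * b x $ 3 + a x $ 3 * b x $ 1\<bar>)"
          by (intro mult_left_mono order_trans[OF abs_triangle_ineq]) (auto simp: abs_mult)
        also have "\<dots> \<le> \<bar>c\<bar> * (1 * \<bar>a x $ 1 * b x $ 2 + a x $ 2 * b x $ 1\<bar> +
            1 * \<bar>a x $ 1 * b x $ 3 + a x $ 3 * b x $ 1\<bar>)"
          by (intro mult_left_mono add_mono mult_right_mono n) auto
        also have "\<dots> \<le> G x" unfolding G_def
          by (intro mult_left_mono add_mono) auto
        also have "\<dots> \<le> B" using B[OF x] by simp
        finally show "\<bar>flux c ?n (a x) \<bullet> b x\<bar> \<le> B" .
      qed
    qed
  qed
qed

lemma face_flux_mirror:
  assumes g: "g \<in> int_faces M \<union> bd_faces M" and "continuous_on UNIV a"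
  shows "set_integrable length_measure g (\<lambda>x. flux c (normal M g x) (mirror (normal M g x) (a x)) \<bullet> a x)"
    "(LINT x:g|length_measure. flux c (normal M g x) (mirror (normal M g x) (a x)) \<bullet> a x) = 0"
proof -
  have [measurable]: "(\<lambda>x. a x $ k) \<in> borel_measurable borel" for k
    using assms(2) by (auto intro!: borel_measurable_continuous_onI continuous_intros)
  define N where "N x = indicator g x *\<^sub>R normal M g x" for x
  have "N \<in> borel_measurable borel"
    using normal_measurable[OF g] by (simp add: set_borel_measurable_def N_def[abs_def])
  then have [measurable]: "(\<lambda>x. N x $ k) \<in> borel_measurable borel" for k
    by (rule measurable_compose[OF _ borel_measurable_nth])
  have zero: "AE x in length_measure. x \<in> g \<longrightarrow> flux c (normal M g x) (mirror (normal M g x) (a x)) \<bullet> a x = 0"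
    using face_props(3)[OF g] by eventually_elim (auto simp: flux_mirror_inner)
  \<comment> \<open>Off \<open>g\<close> the truncated normal is zero, and so is the flux, whatever
    the reflected state is.\<close>
  have "(\<lambda>x. indicator g x *\<^sub>R (flux c (normal M g x) (mirror (normal M g x) (a x)) \<bullet> a x)) =
      (\<lambda>x. flux c (N x) (mirror (N x) (a x)) \<bullet> a x)"
    by (auto simp: fun_eq_iff N_def indicator_def flux_inner)
  also have "\<dots> \<in> borel_measurable borel" unfolding flux_mirror_inner_components by measurable
  finally have meas: "(\<lambda>x. indicator g x *\<^sub>R (flux c (normal M g x) (mirror (normal M g x) (a x)) \<bullet> a x)) \<in> borel_measurable borel" .
  show "set_integrable length_measure g (\<lambda>x. flux c (normal M g x) (mirror (normal M g x) (a x)) \<bullet> a x)"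
    by (rule face_set_integrable[OF g meas, where B = 0]) (use zero in eventually_elim, simp)
  show "(LINT x:g|length_measure. flux c (normal M g x) (mirror (normal M g x) (a x)) \<bullet> a x) = 0"
    unfolding set_lebesgue_integral_def using zero
    by (intro integral_eq_zero_AE) (auto simp: indicator_def elim: eventually_mono)
qed

text \<open>Twice the energy flux through the face in the direction of its fixed normal; the right
  cell sees it with the opposite sign.\<close>

definition face_flux :: "real \<Rightarrow> pt set \<Rightarrow> field \<Rightarrow> real" where
  "face_flux c g q = (LINT x:g|length_measure. flux c (normal M g x) (q x) \<bullet> q x)"

lemma face_sets: "g \<in> int_faces M \<union> bd_faces M \<Longrightarrow> g \<in> sets length_measure"
  using face_props(1)[of g] by (simp add: borel_compact)

text \<open>Symmetry of the flux cancels the two cross terms between left and right state.\<close>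

lemma central_int_diag:
  assumes u: "u \<in> V_space M r" and g: "g \<in> int_faces M"
  shows "central_int M c g u u =
    1/2 * face_flux c g (ext r (leftc M g) u) - 1/2 * face_flux c g (ext r (rightc M g) u)"
proof -
  define L R where "L = ext r (leftc M g) u" and "R = ext r (rightc M g) u"
  have cont: "continuous_on UNIV L" "continuous_on UNIV R"
    using poly3_continuous ext_poly(1)[OF u] int_face(1,2)[OF g] by (auto simp: L_def R_def)
  have g': "g \<in> int_faces M \<union> bd_faces M" using g by simp
  have "central_int M c g u u = (LINT x:g|length_measure.
      1/2 * (flux c (normal M g x) (L x) \<bullet> L x) - 1/2 * (flux c (normal M g x) (R x) \<bullet> R x))"
    unfolding central_int_def
  proof (rule set_lebesgue_integral_cong[OF face_sets[OF g']], intro allI impI)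
    fix x assume "x \<in> g"
    then show "((1/2) *\<^sub>R (flux c (normal M g x) (trL M g u x) + flux c (normal M g x) (trR M g u x))) \<bullet> jump M g u x =
      1/2 * (flux c (normal M g x) (L x) \<bullet> L x) - 1/2 * (flux c (normal M g x) (R x) \<bullet> R x)"
      using flux_inner_commute[of c "normal M g x" "L x" "R x"]
      by (simp add: jump_def face_trace_ext[OF u] g L_def R_def inner_diff_right inner_add_left algebra_simps)
  qed
  also have "\<dots> = (LINT x:g|length_measure. 1/2 * (flux c (normal M g x) (L x) \<bullet> L x)) -
      (LINT x:g|length_measure. 1/2 * (flux c (normal M g x) (R x) \<bullet> R x))"
    by (intro set_integral_diff set_integrable_mult_right face_flux_integrable g' cont)
  finally show ?thesis by (simp add: face_flux_def L_def R_def)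
qed

lemma central_bd_diag:
  assumes u: "u \<in> V_space M r" and g: "g \<in> bd_faces M"
  shows "central_bd M c g u u = 1/2 * face_flux c g (ext r (bd_cell M g) u)"
proof -
  define q where "q = ext r (bd_cell M g) u"
  have cont: "continuous_on UNIV q"
    using poly3_continuous ext_poly(1)[OF u] bd_cell(1)[OF g] by (auto simp: q_def)
  have g': "g \<in> int_faces M \<union> bd_faces M" using g by simp
  have "central_bd M c g u u = (LINT x:g|length_measure.
      1/2 * (flux c (normal M g x) (q x) \<bullet> q x) + 1/2 * (flux c (normal M g x) (mirror (normal M g x) (q x)) \<bullet> q x))"
    unfolding central_bd_def
  proof (rule set_lebesgue_integral_cong[OF face_sets[OF g']], intro allI impI)
    fix x assume "x \<in> g"
    then show "((1/2) *\<^sub>R (flux c (normal M g x) (trB M g u x) +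
        flux c (normal M g x) (mirror (normal M g x) (trB M g u x)))) \<bullet> trB M g u x =
      1/2 * (flux c (normal M g x) (q x) \<bullet> q x) + 1/2 * (flux c (normal M g x) (mirror (normal M g x) (q x)) \<bullet> q x)"
      by (simp add: face_trace_ext[OF u] g q_def inner_add_left algebra_simps)
  qed
  also have "\<dots> = (LINT x:g|length_measure. 1/2 * (flux c (normal M g x) (q x) \<bullet> q x)) +
      (LINT x:g|length_measure. 1/2 * (flux c (normal M g x) (mirror (normal M g x) (q x)) \<bullet> q x))"
    by (intro set_integral_add set_integrable_mult_right face_flux_integrable face_flux_mirror g' cont)
  finally show ?thesis by (simp add: face_flux_def face_flux_mirror(2)[OF g' cont] flip: q_def)
qed

lemma b_form_diag:
  "b_form M c E g q q q = (LINT x:g|length_measure. flux c (outn M E g x) (q x) \<bullet> q x)"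
  by (simp add: b_form_def scaleR_2[symmetric])

lemma b_form_face_flux: "b_form M c E g q q q =
    (if g \<in> int_faces M \<and> rightc M g = E then - face_flux c g q else face_flux c g q)"
proof -
  have "(LINT x:g|length_measure. - (flux c (normal M g x) (q x) \<bullet> q x)) = - face_flux c g q"
    using set_integral_mult_right[where a = "-1" and A = g and M = length_measure and f = "\<lambda>x. flux c (normal M g x) (q x) \<bullet> q x"]
    by (simp add: face_flux_def)
  note neg = this
  show ?thesis
  proof (cases "g \<in> int_faces M \<and> rightc M g = E")
    case True
    then show ?thesis using neg by (simp add: b_form_diag outn_def flux_uminus_inner)
  next
    case False
    then have outn: "outn M E g x = normal M g x" for x unfolding outn_def by (rule if_not_P)
    show ?thesis unfolding if_not_P[OF False] b_form_diag face_flux_def outn ..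
  qed
qed

lemma cell_energy:
  assumes "E \<in> cells M" "q \<in> poly3 r"
  shows "(LINT x:E|lebesgue. flux_grad c q q x) = 1/2 * (\<Sum>g\<in>faces_of M E. b_form M c E g q q q)"
proof -
  obtain F where F: "C1_field F" "\<And>x. (\<Sum>k\<in>UNIV. partial k F x $ k) = flux_grad c q q x"
    "\<And>x n. F x \<bullet> n = (1/2) * (flux c n (q x) \<bullet> q x)"
    by (rule energy_flux_field[OF assms(2), where c = c]) (rule that)
  have "(LINT x:E|lebesgue. (\<Sum>k\<in>UNIV. partial k F x $ k)) =
      (\<Sum>g\<in>faces_of M E. LINT x:g|length_measure. F x \<bullet> outn M E g x)"
    using mesh F(1) assms(1) by (simp add: cut_cell_mesh_def divergence_theorem_def)
  then show ?thesis by (simp add: F(2,3) b_form_diag sum_distrib_left)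
qed

lemma cell_energy_ext:
  assumes "u \<in> V_space M r" "E \<in> cells M"
  shows "(LINT x:E|lebesgue. flux_grad c u u x) =
    1/2 * (\<Sum>g\<in>faces_of M E. b_form M c E g (ext r E u) (ext r E u) (ext r E u))"
proof -
  have "(LINT x:E|lebesgue. flux_grad c u u x) = (LINT x:E|lebesgue. flux_grad c (ext r E u) (ext r E u) x)"
    using cell_open[OF assms(2)] ext_poly[OF assms]
    by (intro set_lebesgue_integral_cong open_in_sets_lebesgue allI impI flux_grad_cong_open) auto
  then show ?thesis using cell_energy[OF assms(2) ext_poly(1)[OF assms]] by simp
qed

lemma a_h_diag:
  assumes u: "u \<in> V_space M r"
  shows "a_h M c u u = 0"
proof -
  let ?e = "\<lambda>E. ext r E u"
  have "(\<Sum>E\<in>cells M. LINT x:E|lebesgue. flux_grad c u u x) =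
      (\<Sum>E\<in>cells M. \<Sum>g\<in>faces_of M E. 1/2 * b_form M c E g (?e E) (?e E) (?e E))"
    by (simp add: cell_energy_ext[OF u] sum_distrib_left)
  also have "\<dots> = (\<Sum>g\<in>int_faces M. 1/2 * b_form M c (leftc M g) g (?e (leftc M g)) (?e (leftc M g)) (?e (leftc M g)) +
      1/2 * b_form M c (rightc M g) g (?e (rightc M g)) (?e (rightc M g)) (?e (rightc M g))) +
      (\<Sum>g\<in>bd_faces M. 1/2 * b_form M c (bd_cell M g) g (?e (bd_cell M g)) (?e (bd_cell M g)) (?e (bd_cell M g)))"
    by (rule sum_cells_faces)
  also have "\<dots> = (\<Sum>g\<in>int_faces M. central_int M c g u u) + (\<Sum>g\<in>bd_faces M. central_bd M c g u u)"
  proof (intro arg_cong2[where f = "(+)"] sum.cong refl)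
    fix g assume g: "g \<in> int_faces M"
    then show "1/2 * b_form M c (leftc M g) g (?e (leftc M g)) (?e (leftc M g)) (?e (leftc M g)) +
      1/2 * b_form M c (rightc M g) g (?e (rightc M g)) (?e (rightc M g)) (?e (rightc M g)) = central_int M c g u u"
      using int_face(3)[OF g] by (auto simp: b_form_face_flux central_int_diag[OF u])
  next
    fix g assume g: "g \<in> bd_faces M"
    then show "1/2 * b_form M c (bd_cell M g) g (?e (bd_cell M g)) (?e (bd_cell M g)) (?e (bd_cell M g)) = central_bd M c g u u"
      using int_bd_disjoint by (auto simp: b_form_face_flux central_bd_diag[OF u])
  qed
  finally show ?thesis by (simp add: a_h_def)
qed

end

section \<open>Reflection at a straight face\<close>

text \<open>Identifies the set onto which \<open>mirror_ext\<close> projects with the line of the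
  wall.\<close>

lemma affine_hull_line:
  fixes n :: pt
  assumes "n \<noteq> 0" "g \<subseteq> {x. n \<bullet> x = d}" "a \<in> g" "b \<in> g" "a \<noteq> b"
  shows "affine hull g = {x. n \<bullet> x = d}"
proof
  show "affine hull g \<subseteq> {x. n \<bullet> x = d}"
    using assms(2) affine_hyperplane by (rule hull_minimal)
  show "{x. n \<bullet> x = d} \<subseteq> affine hull g"
  proof
    fix x assume "x \<in> {x. n \<bullet> x = d}"
    define v w where "v = b - a" and "w = x - a"
    have "n \<bullet> a = d" "n \<bullet> b = d" "n \<bullet> x = d" using assms(2-4) \<open>x \<in> _\<close> by auto
    then have "n \<bullet> v = 0" "n \<bullet> w = 0" by (simp_all add: v_def w_def inner_diff_right)
    then have vw: "n$1 * v$1 + n$2 * v$2 = 0" "n$1 * w$1 + n$2 * w$2 = 0"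
      by (simp_all add: inner_vec_def sum_2)
    \<comment> \<open>Both \<open>v\<close> and \<open>w\<close> are orthogonal to the nonzero
      \<open>n\<close>, so in the plane their determinant vanishes and they are parallel.\<close>
    have "n$1 * (v$1 * w$2 - v$2 * w$1) = 0" "n$2 * (v$1 * w$2 - v$2 * w$1) = 0"
      using vw by algebra+
    then have cross: "v$1 * w$2 = v$2 * w$1" using assms(1) by (auto simp: vec_eq_iff forall_2)
    have "v \<noteq> 0" using assms(5) by (simp add: v_def)
    then have vv: "v \<bullet> v \<noteq> 0" by simp
    define t where "t = (w \<bullet> v) / (v \<bullet> v)"
    have "(w \<bullet> v) * v$1 = w$1 * (v \<bullet> v)" "(w \<bullet> v) * v$2 = w$2 * (v \<bullet> v)"
      using cross by (auto simp: inner_vec_def sum_2) algebra+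
    then have "t * v$1 = w$1" "t * v$2 = w$2" using vv by (auto simp: t_def field_simps)
    then have "x = (1 - t) *\<^sub>R a + t *\<^sub>R b"
      by (simp add: vec_eq_iff forall_2 v_def w_def algebra_simps)
    then show "x \<in> affine hull g"
      using mem_affine[OF affine_affine_hull hull_inc[OF assms(3)] hull_inc[OF assms(4)], of "1 - t" t] by simp
  qed
qed

lemma closest_point_line:
  fixes n x :: pt
  assumes "norm n = 1"
  shows "closest_point {x. n \<bullet> x = d} x = x - (n \<bullet> x - d) *\<^sub>R n"
proof (rule closest_point_unique[symmetric])
  have n: "n \<bullet> n = 1" using assms by (simp add: norm_eq_1)
  show "x - (n \<bullet> x - d) *\<^sub>R n \<in> {x. n \<bullet> x = d}" using n by (simp add: inner_diff_right)
  show "\<forall>z\<in>{x. n \<bullet> x = d}. dist x (x - (n \<bullet> x - d) *\<^sub>R n) \<le> dist x z"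
  proof
    fix z assume "z \<in> {x. n \<bullet> x = d}"
    then have "\<bar>n \<bullet> x - d\<bar> = \<bar>n \<bullet> (x - z)\<bar>" by (simp add: inner_diff_right)
    also have "\<dots> \<le> dist x z" using Cauchy_Schwarz_ineq2[of n "x - z"] assms by (simp add: dist_norm)
    finally show "dist x (x - (n \<bullet> x - d) *\<^sub>R n) \<le> dist x z" using assms by (simp add: dist_norm)
  qed
qed (auto intro: convex_hyperplane closed_hyperplane)

text \<open>The orthogonal projection onto the line is affine, so the reflection preserves the degree.\<close>

lemma mirror_ext_line:
  assumes "affine hull g = {x. n \<bullet> x = d}" "norm n = 1"
  shows "q \<in> poly3 r \<Longrightarrow> mirror_ext g n q \<in> poly3 r"
    and "mirror_ext g n (mirror_ext g n q) = q"
    and "mirror_ext g n (\<lambda>x. q x + q' x) = (\<lambda>x. mirror_ext g n q x + mirror_ext g n q' x)"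
proof -
  define y where "y x = x - (n \<bullet> x - d) *\<^sub>R n" for x
  have cp: "closest_point (affine hull g) x = y x" for x
    unfolding assms(1) y_def by (rule closest_point_line[OF assms(2)])
  have nn: "n $ 1 * n $ 1 + n $ 2 * n $ 2 = 1" by (rule norm_1_sum_squares[OF assms(2)])
  \<comment> \<open>Idempotence of the projection is what makes the reflection an involution
    although it subtracts the normal velocity at another point.\<close>
  have yy: "y (y x) = y x" for x
    using assms(2) by (simp add: y_def inner_diff_right norm_eq_1)
  have m: "mirror_ext g n q x $ 1 = q x $ 1"
    "mirror_ext g n q x $ 2 = q x $ 2 + (- 2 * n $ 1 * n $ 1) * q (y x) $ 2 + (- 2 * n $ 2 * n $ 1) * q (y x) $ 3"
    "mirror_ext g n q x $ 3 = q x $ 3 + (- 2 * n $ 1 * n $ 2) * q (y x) $ 2 + (- 2 * n $ 2 * n $ 2) * q (y x) $ 3" for q x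
    by (simp_all add: mirror_ext_def state_def vel_def inner_vec_def sum_2 cp algebra_simps)
  have coord: "(\<lambda>x. x $ k) \<in> poly1 1" for k
    using exhaust_2[of k] poly1_monomial[of 1 0 1] poly1_monomial[of 0 1 1] by auto
  have yk: "(\<lambda>x. y x $ k) \<in> poly1 1" for k
  proof -
    have "(\<lambda>x. y x $ k) = (\<lambda>x. x $ k + ((- n $ k * n $ 1) * x $ 1 + (- n $ k * n $ 2) * x $ 2 + d * n $ k))"
      by (auto simp: y_def inner_vec_def sum_2 algebra_simps)
    also have "\<dots> \<in> poly1 1" by (intro poly1_add poly1_scale poly1_const coord)
    finally show ?thesis .
  qed
  show "q \<in> poly3 r \<Longrightarrow> mirror_ext g n q \<in> poly3 r"
    unfolding poly3_def
  proof (clarify)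
    fix k assume "\<forall>k. (\<lambda>x. q x $ k) \<in> poly1 r"
    then have "(\<lambda>x. q x $ l) \<in> poly1 r" "(\<lambda>x. q (y x) $ l) \<in> poly1 r" for l
      using poly1_compose_affine[OF _ yk] by blast+
    then show "(\<lambda>x. mirror_ext g n q x $ k) \<in> poly1 r"
      using exhaust_3[of k] by (auto simp only: m intro!: poly1_add poly1_scale)
  qed
  show "mirror_ext g n (mirror_ext g n q) = q"
  proof (rule ext)
    fix x
    \<comment> \<open>The squared norm of \<open>n\<close> is isolated as a factor; replacing it by
      1 cancels the two terms with coefficient 4.\<close>
    have "mirror_ext g n (mirror_ext g n q) x $ 2 = q x $ 2 - 4 * n $ 1 * (n $ 1 * q (y x) $ 2 + n $ 2 * q (y x) $ 3)
        + 4 * n $ 1 * (n $ 1 * n $ 1 + n $ 2 * n $ 2) * (n $ 1 * q (y x) $ 2 + n $ 2 * q (y x) $ 3)"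
      unfolding m yy by algebra
    then have 2: "mirror_ext g n (mirror_ext g n q) x $ 2 = q x $ 2" unfolding nn by algebra
    have "mirror_ext g n (mirror_ext g n q) x $ 3 = q x $ 3 - 4 * n $ 2 * (n $ 1 * q (y x) $ 2 + n $ 2 * q (y x) $ 3)
        + 4 * n $ 2 * (n $ 1 * n $ 1 + n $ 2 * n $ 2) * (n $ 1 * q (y x) $ 2 + n $ 2 * q (y x) $ 3)"
      unfolding m yy by algebra
    then have 3: "mirror_ext g n (mirror_ext g n q) x $ 3 = q x $ 3" unfolding nn by algebra
    show "mirror_ext g n (mirror_ext g n q) x = q x"
      using 2 3 m(1) by (simp add: vec_eq_iff forall_3)
  qed
  show "mirror_ext g n (\<lambda>x. q x + q' x) = (\<lambda>x. mirror_ext g n q x + mirror_ext g n q' x)"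
    by (simp add: fun_eq_iff vec_eq_iff forall_3 m algebra_simps)
qed

context cut_mesh
begin

text \<open>Positive length makes the constant normal unique, which settles the description in
  \<open>face_normal\<close>, and gives two points spanning the line.\<close>

lemma straight_face_line:
  assumes g: "g \<in> bd_faces M" and "straight_face M g"
  obtains d where "affine hull g = {x. face_normal M g \<bullet> x = d}" "norm (face_normal M g) = 1"
proof -
  obtain n d where n: "norm n = 1" "AE x in length_measure. x \<in> g \<longrightarrow> normal M g x = n" "g \<subseteq> {x. n \<bullet> x = d}"
    using assms(2) unfolding straight_face_def by blast
  have "face_normal M g = n"
    unfolding face_normal_def
  proof (rule the_equality, rule n(2))
    fix n' assume "AE x in length_measure. x \<in> g \<longrightarrow> normal M g x = n'"
    with n(2) have "AE x in length_measure. x \<in> g \<longrightarrow> n' = n" by eventually_elim auto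
    then have "\<exists>x\<in>g. n' = n" using bd_cell(4,5)[OF g] by (intro AE_pos_measure_ex) auto
    then show "n' = n" by blast
  qed
  moreover obtain a b where ab: "a \<in> g" "b \<in> g" "a \<noteq> b"
    using exists_two_points[OF bd_cell(5)[OF g]] by blast
  have "n \<noteq> 0" using n(1) by auto
  ultimately show thesis
    using affine_hull_line[OF \<open>n \<noteq> 0\<close> n(3) ab] n(1) that[of d] by simp
qed

end

section \<open>The energy balance of a pair of faces\<close>

lemma symm_linearD:
  assumes "symm_linear r q" "u \<in> poly3 r" "v \<in> poly3 r" "w \<in> poly3 r" "z \<in> poly3 r"
  shows "q u v (\<lambda>x. w x + z x) = q u v w + q u v z"
    and "q u v (\<lambda>x. w x - z x) = q u v w - q u v z"
    and "q u v w = q v u w"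
proof -
  have *: "q u v (\<lambda>x. a *\<^sub>R w x + b *\<^sub>R z x) = a * q u v w + b * q u v z" for a b
    using assms unfolding symm_linear_def by blast
  show "q u v (\<lambda>x. w x + z x) = q u v w + q u v z" using *[of 1 1] by simp
  show "q u v (\<lambda>x. w x - z x) = q u v w - q u v z" using *[of 1 "-1"] by simp
  show "q u v w = q v u w" using assms unfolding symm_linear_def by blast
qed

text \<open>The algebra of one pair of faces: \<open>P\<close>, \<open>Q\<close> stand for p_ij,
  p_ji, \<open>V\<close>, \<open>W\<close> for p_V, p_V^*, and \<open>I\<close> for the share of the
  volume energy belonging to the pair.\<close>

locale pair_forms =
  fixes r :: nat and P Q V W :: form3 and I :: "field \<Rightarrow> real"
  assumes lin: "symm_linear r P" "symm_linear r Q" "symm_linear r V" "symm_linear r W"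
    and sum: "\<And>u v w. u \<in> poly3 r \<Longrightarrow> v \<in> poly3 r \<Longrightarrow> w \<in> poly3 r \<Longrightarrow> P u v w + Q u v w = V u v w + W u v w"
    and volume: "\<And>w. w \<in> poly3 r \<Longrightarrow> I w = 1/2 * P w w w + 1/2 * Q w w w"
    and jumpP: "\<And>u v. u \<in> poly3 r \<Longrightarrow> v \<in> poly3 r \<Longrightarrow> P u v (\<lambda>x. u x - v x) = 1/2 * P u u u - 1/2 * P v v v"
    and jumpQ: "\<And>u v. u \<in> poly3 r \<Longrightarrow> v \<in> poly3 r \<Longrightarrow> Q u v (\<lambda>x. u x - v x) = 1/2 * Q u u u - 1/2 * Q v v v"
begin

text \<open>The diagonal value of J^1_ij, with \<open>w\<close> the polynomial of the small cell and
  \<open>a\<close>, \<open>b\<close> those attached to the two faces.\<close>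

definition volume_correction :: "field \<Rightarrow> field \<Rightarrow> field \<Rightarrow> real" where
  "volume_correction a b w =
     - (V a b w - I w + W a b w) + 1/2 * (V a b a - I a + W a b a) + 1/2 * (V a b b - I b + W a b b)"

lemma volume_correction_eq:
  assumes "a \<in> poly3 r" "b \<in> poly3 r" "w \<in> poly3 r"
  shows "volume_correction a b w = I w - (P a b w + Q a b w)
     + 1/2 * (P a b a + Q a b a) + 1/2 * (P a b b + Q a b b)
     - 1/4 * (P a a a + Q a a a) - 1/4 * (P b b b + Q b b b)"
  using sum[of a b w] sum[of a b a] sum[of a b b] volume[of a] volume[of b] assms
  by (simp add: volume_correction_def algebra_simps)

text \<open>After cancellation of the mixed terms containing \<open>w\<close>, half of
  \<open>P - Q\<close> tested with \<open>a - b\<close> is left. The jump identities turn it into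
  quarters of diagonal values; with the quarters in \<open>volume_correction_eq\<close>, those of
  \<open>P\<close> at \<open>a\<close> and of \<open>Q\<close> at \<open>b\<close> vanish and the
  others double.\<close>

lemma interior_pair:
  assumes "a \<in> poly3 r" "b \<in> poly3 r" "w \<in> poly3 r"
  shows "P a b (\<lambda>x. w x - b x) + Q a b (\<lambda>x. w x - a x) + volume_correction a b w =
    I w - 1/2 * (Q a a a + P b b b)"
  using jumpP[of a b] jumpQ[of a b] assms
    symm_linearD(2)[OF lin(1), of a b w b] symm_linearD(2)[OF lin(2), of a b w a]
    symm_linearD(2)[OF lin(1), of a b a b] symm_linearD(2)[OF lin(2), of a b a b]
  by (simp add: volume_correction_eq[OF assms] algebra_simps)

text \<open>For a reflected argument the contributions of \<open>Q\<close> cancel by the reflection property and symmetry.\<close>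

lemma boundary_pair:
  assumes b: "b \<in> poly3 r" and w: "w \<in> poly3 r"
    and m: "\<And>q. q \<in> poly3 r \<Longrightarrow> m q \<in> poly3 r" "m (m b) = b" "m (\<lambda>x. m b x + b x) = (\<lambda>x. m (m b) x + m b x)"
    and refl: "\<And>u v w. u \<in> poly3 r \<Longrightarrow> v \<in> poly3 r \<Longrightarrow> w \<in> poly3 r \<Longrightarrow> Q u (m v) w = - Q (m u) v (m w)"
  shows "P (m b) b (\<lambda>x. w x - b x) + Q (m b) b w + volume_correction (m b) b w = I w - 1/2 * P b b b"
proof -
  define a where "a = m b"
  have a: "a \<in> poly3 r" using m(1) b by (simp add: a_def)
  \<comment> \<open>Removes the diagonal values of \<open>Q\<close>. Its mixed terms add up to half
    of \<open>Q a b\<close> tested with \<open>a + b\<close>, which is treated next.\<close>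
  have "Q a a a = - Q b b b" using refl[OF a b a] m(2) by (simp add: a_def)
  moreover have "Q a b (\<lambda>x. a x + b x) = 0"
  proof -
    have s: "(\<lambda>x. a x + b x) \<in> poly3 r" by (rule poly3_add[OF a b])
    \<comment> \<open>The sum of a field and its mirror image is invariant, so reflection gives
      antisymmetry in the first two arguments, against the symmetry of the form.\<close>
    have "m (\<lambda>x. a x + b x) = (\<lambda>x. a x + b x)" using m(2,3) by (simp add: a_def add.commute)
    then have "Q b a (\<lambda>x. a x + b x) = - Q a b (\<lambda>x. a x + b x)"
      using refl[OF b b s] by (simp add: a_def)
    then show ?thesis using symm_linearD(3)[OF lin(2) a b s s] by simp
  qed
  ultimately have "P a b (\<lambda>x. w x - b x) + Q a b w + volume_correction a b w = I w - 1/2 * P b b b"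
    using jumpP[OF a b] symm_linearD(2)[OF lin(1) a b w b] symm_linearD(2)[OF lin(1) a b a b]
      symm_linearD(1)[OF lin(2) a b a b]
    by (simp add: volume_correction_eq[OF a b w] algebra_simps)
  then show ?thesis by (simp add: a_def)
qed

end

text \<open>Passes from unordered to ordered pairs. The second index is held fixed in the inner sum,
  as in the consistency condition for a face.\<close>

lemma sum_idx_pairs:
  fixes h :: "nat \<Rightarrow> nat \<Rightarrow> real"
  shows "(\<Sum>(i, j)\<in>idx_pairs M E. h i j + h j i) = (\<Sum>i\<in>idx M E. \<Sum>j\<in>idx M E - {i}. h j i)"
proof -
  let ?A = "idx M E"
  let ?swap = "\<lambda>(i, j). (j, i) :: nat \<times> nat"
  have fin: "finite (idx_pairs M E)"
    by (rule finite_subset[of _ "?A \<times> ?A"]) (auto simp: idx_pairs_def idx_def)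
  have "(\<Sum>i\<in>?A. \<Sum>j\<in>?A - {i}. h j i) = (\<Sum>(i, j)\<in>(SIGMA i:?A. ?A - {i}). h j i)"
    by (rule sum.Sigma) (auto simp: idx_def)
  also have "(SIGMA i:?A. ?A - {i}) = idx_pairs M E \<union> ?swap ` idx_pairs M E"
    by (force simp: idx_pairs_def image_iff)
  also have "(\<Sum>(i, j)\<in>\<dots>. h j i) = (\<Sum>(i, j)\<in>idx_pairs M E. h j i) + (\<Sum>(i, j)\<in>?swap ` idx_pairs M E. h j i)"
    by (rule sum.union_disjoint) (use fin in \<open>auto simp: idx_pairs_def\<close>)
  also have "(\<Sum>(i, j)\<in>?swap ` idx_pairs M E. h j i) = (\<Sum>(i, j)\<in>idx_pairs M E. h i j)"
    by (subst sum.reindex) (auto simp: inj_on_def case_prod_unfold)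
  finally show ?thesis by (simp add: sum.distrib[symmetric] case_prod_unfold add.commute)
qed

text \<open>The weight is the reciprocal of the number of pairs, so the shares add up to the full
  volume energy.\<close>

lemma pair_weight_card:
  assumes "2 \<le> nfaces M E"
  shows "pair_weight M E * real (card (idx_pairs M E)) = 1"
proof -
  define K where "K = nfaces M E"
  have "2 * real (card (idx_pairs M E)) = (\<Sum>(i, j)\<in>idx_pairs M E. 1 + 1)" by simp
  also have "\<dots> = (\<Sum>i\<in>idx M E. \<Sum>j\<in>idx M E - {i}. 1)" by (rule sum_idx_pairs)
  also have "\<dots> = (\<Sum>i\<in>idx M E. real (K - 1))"
    by (intro sum.cong) (simp_all add: idx_def K_def)
  also have "\<dots> = real K * (real K - 1)" using assms by (simp add: idx_def K_def of_nat_diff)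
  finally show ?thesis using assms by (simp add: pair_weight_def K_def[symmetric] field_simps)
qed

section \<open>The stabilization of the central flux conserves energy\<close>

lemma small_cells_subset: "small_cells M \<alpha> \<subseteq> cells M"
  by (auto simp: small_cells_def cells_def)

locale small_cell = cut_mesh +
  fixes c \<alpha> :: real and r :: nat and E :: "pt set"
    and p :: "nat \<Rightarrow> nat \<Rightarrow> form3" and pV pVs :: form3 and u :: field
  assumes admissible: "small_cells_admissible M \<alpha>" and small: "E \<in> small_cells M \<alpha>"
    and forms: "propagation_forms M c r E p pV pVs"
    and preserving: "energy_preserving M c r E p"
    and reflect: "reflecting M r E p"
    and u: "u \<in> V_space M r"
begin

lemma cell: "E \<in> cells M" using small small_cells_subset by auto

lemma face_bij: "bij_betw (face M E) (idx M E) (faces_of M E)"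
  using mesh cell by (auto simp: cut_cell_mesh_def faces_numbered_def)

lemma face_cases:
  assumes "i \<in> idx M E"
  shows "face M E i \<in> int_faces_of M E \<and> face M E i \<notin> bd_faces M \<or>
    face M E i \<in> bd_faces_of M E \<and> face M E i \<notin> int_faces M"
  using bij_betw_apply[OF face_bij assms] int_bd_disjoint
  by (auto simp: faces_of_def int_faces_of_def bd_faces_of_def)

lemma one_bd_face:
  assumes "i \<in> idx M E" "j \<in> idx M E" "i \<noteq> j" "face M E i \<in> bd_faces M"
  shows "face M E j \<in> int_faces_of M E" "face M E j \<notin> bd_faces M"
proof -
  have "face M E i \<in> bd_faces_of M E" using face_cases[OF assms(1)] assms(4) by auto
  moreover have "face M E i \<noteq> face M E j"
    using bij_betw_imp_inj_on[OF face_bij] assms(1-3) by (auto dest: inj_onD)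
  ultimately show "face M E j \<in> int_faces_of M E" "face M E j \<notin> bd_faces M"
    using face_cases[OF assms(2)] bd_faces_of_unique[OF cell] by auto
qed

lemma nbr_cell: "g \<in> int_faces_of M E \<Longrightarrow> nbr M E g \<in> cells M"
  using int_face by (auto simp: int_faces_of_def nbr_def)

lemma ext_nbr_poly: "face M E i \<in> int_faces_of M E \<Longrightarrow> ext_nbr M r E i u \<in> poly3 r"
  unfolding ext_nbr_def by (intro ext_poly[OF u] nbr_cell)

definition volume_energy :: "field \<Rightarrow> real" where
  "volume_energy q = (LINT x:E|lebesgue. flux_grad c q q x)"

lemma pair_forms:
  assumes "i \<in> idx M E" "j \<in> idx M E" "i \<noteq> j"
  shows "pair_forms r (p i j) (p j i) pV pVs (\<lambda>q. pair_weight M E * volume_energy q)"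
proof
  have lin: "symm_linear r (p i j)" if "i \<in> idx M E" "j \<in> idx M E" "i \<noteq> j" for i j
    using forms that by (simp add: propagation_forms_def)
  show "symm_linear r (p i j)" "symm_linear r (p j i)" using lin assms by auto
  show "symm_linear r pV" "symm_linear r pVs" using forms by (simp_all add: propagation_forms_def)
  show "p i j u v w + p j i u v w = pV u v w + pVs u v w"
    if "u \<in> poly3 r" "v \<in> poly3 r" "w \<in> poly3 r" for u v w
    using forms assms that by (simp add: propagation_forms_def)
  show "pair_weight M E * volume_energy w = 1/2 * p i j w w w + 1/2 * p j i w w w" if "w \<in> poly3 r" for w
    using preserving assms that unfolding energy_preserving_def volume_energy_def by blast
  have jump: "p i j u v (\<lambda>x. u x - v x) = 1/2 * p i j u u u - 1/2 * p i j v v v"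
    if "u \<in> poly3 r" "v \<in> poly3 r" "i \<in> idx M E" "j \<in> idx M E" "i \<noteq> j" for u v i j
    using preserving that unfolding energy_preserving_def by blast
  show "p i j u v (\<lambda>x. u x - v x) = 1/2 * p i j u u u - 1/2 * p i j v v v"
    "p j i u v (\<lambda>x. u x - v x) = 1/2 * p j i u u u - 1/2 * p j i v v v"
    if "u \<in> poly3 r" "v \<in> poly3 r" for u v
    using jump that assms by auto
qed

text \<open>Summed over \<open>k\<close> this is the face form of face \<open>i\<close> at the
  polynomial of the neighbour. The value 0 at a wall records that no term of the wall face survives
  in \<open>boundary_pair\<close>.\<close>

definition outflow :: "nat \<Rightarrow> nat \<Rightarrow> real" where
  "outflow k i = (if face M E i \<in> int_faces M
     then p k i (ext_nbr M r E i u) (ext_nbr M r E i u) (ext_nbr M r E i u) else 0)"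

lemma bd_pair_energy:
  assumes ij: "i \<in> idx M E" "j \<in> idx M E" "i \<noteq> j" and bd: "face M E i \<in> bd_faces M"
  shows "J0_bd M r E p i j u u + pair_forms.volume_correction pV pVs (\<lambda>q. pair_weight M E * volume_energy q)
      (ext_refl M r E i j u) (ext_nbr M r E j u) (ext r E u) =
    pair_weight M E * volume_energy (ext r E u) - 1/2 * (outflow i j + outflow j i)"
proof -
  let ?g = "face M E i"
  let ?m = "mirror_ext ?g (face_normal M ?g)"
  interpret pf: pair_forms r "p i j" "p j i" pV pVs "\<lambda>q. pair_weight M E * volume_energy q"
    by (rule pair_forms[OF ij])
  have g: "?g \<in> bd_faces_of M E" "?g \<notin> int_faces M" using face_cases[OF ij(1)] bd by auto
  have "straight_face M ?g" using admissible small g by (auto simp: small_cells_admissible_def)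
  then obtain d where d: "affine hull ?g = {x. face_normal M ?g \<bullet> x = d}" "norm (face_normal M ?g) = 1"
    using straight_face_line[OF bd] by blast
  note m = mirror_ext_line[OF d]
  note j = one_bd_face[OF ij bd]
  have "p i j (?m (ext_nbr M r E j u)) (ext_nbr M r E j u) (\<lambda>x. ext r E u x - ext_nbr M r E j u x) +
      p j i (?m (ext_nbr M r E j u)) (ext_nbr M r E j u) (ext r E u) +
      pf.volume_correction (?m (ext_nbr M r E j u)) (ext_nbr M r E j u) (ext r E u) =
      pair_weight M E * volume_energy (ext r E u) - 1/2 * p i j (ext_nbr M r E j u) (ext_nbr M r E j u) (ext_nbr M r E j u)"
  proof (rule pf.boundary_pair)
    show "ext_nbr M r E j u \<in> poly3 r" "ext r E u \<in> poly3 r"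
      using ext_nbr_poly[OF j(1)] ext_poly(1)[OF u cell] by auto
    show "p j i u' (?m v) w = - p j i (?m u') v (?m w)" if "u' \<in> poly3 r" "v \<in> poly3 r" "w \<in> poly3 r" for u' v w
      using reflect ij g(1) that unfolding reflecting_def Let_def by blast
  qed (simp_all add: m)
  moreover have "face M E j \<in> int_faces M" using j(1) by (simp add: int_faces_of_def)
  ultimately show ?thesis using g(2) by (simp add: J0_bd_def ext_refl_def outflow_def)
qed

lemma J1_ij_diag:
  assumes ij: "i \<in> idx M E" "j \<in> idx M E" "i \<noteq> j"
  shows "J1_ij M c r E pV pVs i j u u = pair_forms.volume_correction pV pVs (\<lambda>q. pair_weight M E * volume_energy q)
      (ext_pair M r E i j u) (ext_pair M r E j i u) (ext r E u)"
proof -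
  interpret pf: pair_forms r "p i j" "p j i" pV pVs "\<lambda>q. pair_weight M E * volume_energy q"
    by (rule pair_forms[OF ij])
  show ?thesis
    unfolding pf.volume_correction_def by (simp add: J1_ij_def J1_term_def volume_energy_def)
qed

lemma pair_energy:
  assumes ij: "i \<in> idx M E" "j \<in> idx M E" "i \<noteq> j"
  shows "J0_ij M r E p i j u u + J1_ij M c r E pV pVs i j u u =
    pair_weight M E * volume_energy (ext r E u) - 1/2 * (outflow i j + outflow j i)"
proof -
  interpret pf: pair_forms r "p i j" "p j i" pV pVs "\<lambda>q. pair_weight M E * volume_energy q"
    by (rule pair_forms[OF ij])
  have U: "ext r E u \<in> poly3 r" by (rule ext_poly(1)[OF u cell])
  consider "face M E i \<in> bd_faces M" | "face M E i \<notin> bd_faces M" "face M E j \<in> bd_faces M"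
    | "face M E i \<notin> bd_faces M" "face M E j \<notin> bd_faces M" by blast
  then show ?thesis
  proof cases
    case 1
    then show ?thesis using bd_pair_energy[OF ij 1] one_bd_face(2)[OF ij 1]
      by (simp add: J1_ij_diag[OF ij] J0_ij_def ext_pair_def)
  next
    case 2
    have g: "face M E j \<in> bd_faces_of M E" using face_cases[OF ij(2)] 2 by auto
    have "straight_face M (face M E j)" using admissible small g by (auto simp: small_cells_admissible_def)
    then obtain d where d: "affine hull face M E j = {x. face_normal M (face M E j) \<bullet> x = d}"
        "norm (face_normal M (face M E j)) = 1"
      using straight_face_line[OF 2(2)] by blast
    have q: "ext_nbr M r E i u \<in> poly3 r"
      using ext_nbr_poly one_bd_face(1)[OF ij(2,1) ij(3)[symmetric] 2(2)] by blast
    have m: "ext_refl M r E j i u \<in> poly3 r"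
      unfolding ext_refl_def by (rule mirror_ext_line(1)[OF d q])
    \<comment> \<open>\<open>J0_ij\<close> exchanges the roles of the indices when the wall is
      second, but \<open>J1_ij\<close> keeps their order; symmetry of \<open>pV\<close> and
      \<open>pVs\<close> reconciles the two.\<close>
    have "pf.volume_correction (ext_nbr M r E i u) (ext_refl M r E j i u) (ext r E u) =
        pf.volume_correction (ext_refl M r E j i u) (ext_nbr M r E i u) (ext r E u)"
      unfolding pf.volume_correction_def
      using symm_linearD(3)[OF pf.lin(3) q m] symm_linearD(3)[OF pf.lin(4) q m] q m U by simp
    then show ?thesis using bd_pair_energy[OF ij(2,1) ij(3)[symmetric] 2(2)] 2
      by (simp add: J1_ij_diag[OF ij] J0_ij_def ext_pair_def add.commute)
  next
    case 3
    then have i: "face M E i \<in> int_faces_of M E" and j: "face M E j \<in> int_faces_of M E"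
      using face_cases[OF ij(1)] face_cases[OF ij(2)] by (auto simp: bd_faces_of_def)
    then have "face M E i \<in> int_faces M" "face M E j \<in> int_faces M" by (auto simp: int_faces_of_def)
    then show ?thesis
      using pf.interior_pair[OF ext_nbr_poly[OF i] ext_nbr_poly[OF j] U] 3
      by (simp add: J1_ij_diag[OF ij] J0_ij_def J0_int_def ext_pair_def outflow_def add.commute)
  qed
qed

lemma face_form_sum:
  assumes "q \<in> poly3 r" "j \<in> idx M E"
  shows "(\<Sum>i\<in>idx M E - {j}. p i j q q q) = b_form M c E (face M E j) q q q"
  using forms assms unfolding propagation_forms_def by blast

text \<open>For a fixed face the polynomial of its neighbour is fixed too, so the inner sum is the
  consistency condition of the propagation forms.\<close>

lemma outflow_sum:
  "(\<Sum>j\<in>idx M E. \<Sum>i\<in>idx M E - {j}. outflow i j) =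
   (\<Sum>g\<in>int_faces_of M E. b_form M c E g (ext r (nbr M E g) u) (ext r (nbr M E g) u) (ext r (nbr M E g) u))"
proof -
  let ?b = "\<lambda>g. if g \<in> int_faces M
     then b_form M c E g (ext r (nbr M E g) u) (ext r (nbr M E g) u) (ext r (nbr M E g) u) else 0"
  have "(\<Sum>i\<in>idx M E - {j}. outflow i j) = ?b (face M E j)" if "j \<in> idx M E" for j
  proof (cases "face M E j \<in> int_faces M")
    case True
    then have "face M E j \<in> int_faces_of M E" using face_cases[OF that] by auto
    from face_form_sum[OF ext_nbr_poly[OF this] that] show ?thesis
      using True by (simp add: outflow_def ext_nbr_def)
  qed (simp add: outflow_def)
  then have "(\<Sum>j\<in>idx M E. \<Sum>i\<in>idx M E - {j}. outflow i j) = (\<Sum>j\<in>idx M E. ?b (face M E j))"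
    by simp
  also have "\<dots> = (\<Sum>g\<in>faces_of M E. ?b g)" by (rule sum.reindex_bij_betw[OF face_bij])
  also have "\<dots> = (\<Sum>g\<in>int_faces_of M E. ?b g) + (\<Sum>g\<in>bd_faces_of M E. ?b g)" by (rule sum_faces_of)
  also have "(\<Sum>g\<in>bd_faces_of M E. ?b g) = 0"
    using int_bd_disjoint by (intro sum.neutral) (auto simp: bd_faces_of_def)
  finally show ?thesis by (simp add: int_faces_of_def)
qed

text \<open>In terms of the outward normal of \<open>E\<close>, the central flux at an interior face
  is half the own face form minus half that of the neighbour, whichever side is left. The own halves
  add up to the volume energy by \<open>cell_energy\<close>.\<close>

lemma central_sum:
  "(\<Sum>g\<in>int_faces_of M E. central_int M c g u u) + (\<Sum>g\<in>bd_faces_of M E. central_bd M c g u u) =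
   volume_energy (ext r E u) -
   1/2 * (\<Sum>g\<in>int_faces_of M E. b_form M c E g (ext r (nbr M E g) u) (ext r (nbr M E g) u) (ext r (nbr M E g) u))"
proof -
  let ?b = "\<lambda>E' g. b_form M c E g (ext r E' u) (ext r E' u) (ext r E' u)"
  have "central_int M c g u u = 1/2 * ?b E g - 1/2 * ?b (nbr M E g) g" if "g \<in> int_faces_of M E" for g
  proof -
    have g: "g \<in> int_faces M" "leftc M g = E \<or> rightc M g = E"
      using that int_face_subset_frontier cell by (auto simp: int_faces_of_def)
    then show ?thesis
      using int_face(3)[OF g(1)] by (auto simp: central_int_diag[OF u] b_form_face_flux nbr_def)
  qed
  then have 1: "(\<Sum>g\<in>int_faces_of M E. central_int M c g u u) =
      1/2 * (\<Sum>g\<in>int_faces_of M E. ?b E g) - 1/2 * (\<Sum>g\<in>int_faces_of M E. ?b (nbr M E g) g)"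
    by (simp add: sum_subtractf sum_divide_distrib)
  have "central_bd M c g u u = 1/2 * ?b E g" if "g \<in> bd_faces_of M E" for g
  proof -
    have g: "g \<in> bd_faces M" "bd_cell M g = E" "g \<notin> int_faces M"
      using that bd_cell(3) cell int_bd_disjoint by (auto simp: bd_faces_of_def)
    then show ?thesis by (simp add: central_bd_diag[OF u] b_form_face_flux)
  qed
  then have 2: "(\<Sum>g\<in>bd_faces_of M E. central_bd M c g u u) = 1/2 * (\<Sum>g\<in>bd_faces_of M E. ?b E g)"
    unfolding sum_distrib_left by (intro sum.cong) auto
  show ?thesis
    using 1 2 cell_energy[OF cell ext_poly(1)[OF u cell], of c]
    by (simp add: volume_energy_def sum_faces_of add_divide_distrib)
qed

text \<open>A cell with at most one face carries no pairs; there all face forms vanish.\<close>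

lemma volume_energy_few_faces:
  assumes "nfaces M E < 2"
  shows "volume_energy (ext r E u) = 0"
proof -
  let ?q = "ext r E u"
  have q: "?q \<in> poly3 r" by (rule ext_poly(1)[OF u cell])
  have "b_form M c E (face M E j) ?q ?q ?q = 0" if "j \<in> idx M E" for j
  proof -
    have empty: "idx M E - {j} = {}" using that assms by (auto simp: idx_def)
    show ?thesis unfolding face_form_sum[OF q that, symmetric] empty by simp
  qed
  then have "(\<Sum>j\<in>idx M E. b_form M c E (face M E j) ?q ?q ?q) = 0" by simp
  then have "(\<Sum>g\<in>faces_of M E. b_form M c E g ?q ?q ?q) = 0"
    by (simp only: sum.reindex_bij_betw[OF face_bij, of "\<lambda>g. b_form M c E g ?q ?q ?q"])
  then show ?thesis by (simp add: volume_energy_def cell_energy[OF cell q])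
qed

lemma J_a_cell_diag: "J0_E M c r dt E p u u + J1_E M c r dt E pV pVs u u = 0"
proof -
  let ?K = "real (card (idx_pairs M E))"
  have "(\<Sum>(i, j)\<in>idx_pairs M E. J0_ij M r E p i j u u) + (\<Sum>(i, j)\<in>idx_pairs M E. J1_ij M c r E pV pVs i j u u) =
      (\<Sum>(i, j)\<in>idx_pairs M E. pair_weight M E * volume_energy (ext r E u) - 1/2 * (outflow i j + outflow j i))"
    unfolding sum.distrib[symmetric]
    by (rule sum.cong) (auto simp: idx_pairs_def pair_energy)
  also have "\<dots> = pair_weight M E * ?K * volume_energy (ext r E u) -
      1/2 * (\<Sum>(i, j)\<in>idx_pairs M E. outflow i j + outflow j i)"
    by (simp add: case_prod_unfold sum_subtractf sum_divide_distrib)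
  also have "pair_weight M E * ?K * volume_energy (ext r E u) = volume_energy (ext r E u)"
    \<comment> \<open>With fewer than two faces there are no pairs and the left side is 0, so the
      volume energy itself has to vanish.\<close>
    using pair_weight_card volume_energy_few_faces by (cases "nfaces M E < 2") auto
  finally have "(\<Sum>(i, j)\<in>idx_pairs M E. J0_ij M r E p i j u u) + (\<Sum>(i, j)\<in>idx_pairs M E. J1_ij M c r E pV pVs i j u u) =
      (\<Sum>g\<in>int_faces_of M E. central_int M c g u u) + (\<Sum>g\<in>bd_faces_of M E. central_bd M c g u u)"
    unfolding sum_idx_pairs central_sum outflow_sum .
  then show ?thesis
    unfolding J0_E_def J1_E_def by (simp only: right_diff_distrib[symmetric] distrib_left[symmetric] diff_add_eq) simp
qed

end

section \<open>Dissipation\<close>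

text \<open>After exchanging the sums, each \<open>g\<close> is charged at most once and with a
  factor of at most 1.\<close>

lemma sum_dominated_by_disjoint:
  fixes \<eta> :: "'a \<Rightarrow> real" and D :: "'b \<Rightarrow> real"
  assumes "finite A" "finite G" "\<And>g. g \<in> G \<Longrightarrow> 0 \<le> D g"
    and \<eta>: "\<And>E g. E \<in> A \<Longrightarrow> g \<in> G \<Longrightarrow> R E g \<Longrightarrow> \<eta> E \<le> 1"
    and unique: "\<And>E E' g. E \<in> A \<Longrightarrow> E' \<in> A \<Longrightarrow> g \<in> G \<Longrightarrow> R E g \<Longrightarrow> R E' g \<Longrightarrow> E = E'"
  shows "(\<Sum>E\<in>A. \<Sum>g | g \<in> G \<and> R E g. \<eta> E * D g) \<le> (\<Sum>g\<in>G. D g)"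
proof -
  have "(\<Sum>E\<in>A. \<Sum>g | g \<in> G \<and> R E g. \<eta> E * D g) = (\<Sum>g\<in>G. \<Sum>E | E \<in> A \<and> R E g. \<eta> E * D g)"
    by (rule sum.swap_restrict[OF assms(1,2)])
  also have "\<dots> \<le> (\<Sum>g\<in>G. D g)"
  proof (rule sum_mono)
    fix g assume g: "g \<in> G"
    show "(\<Sum>E | E \<in> A \<and> R E g. \<eta> E * D g) \<le> D g"
    proof (cases "{E. E \<in> A \<and> R E g} = {}")
      case True
      show ?thesis unfolding True using assms(3)[OF g] by simp
    next
      case False
      then obtain E where E: "E \<in> A" "R E g" by blast
      then have *: "{E. E \<in> A \<and> R E g} = {E}" using unique[OF _ _ g] by blast
      show ?thesis unfolding * using mult_right_mono[OF \<eta>[OF E(1) g E(2)] assms(3)[OF g]] by simp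
    qed
  qed
  finally show ?thesis .
qed

context cut_mesh
begin

text \<open>The sign is needed only where the normal has norm 1, hence almost everywhere on the
  face. Should the integrand fail to be integrable, the integral is 0 by convention and the bound
  persists.\<close>

lemma face_integral_nonneg:
  fixes f :: "pt \<Rightarrow> real"
  assumes "g \<in> int_faces M \<union> bd_faces M" "\<And>x. norm (normal M g x) = 1 \<Longrightarrow> 0 \<le> f x"
  shows "0 \<le> (LINT x:g|length_measure. f x)"
  unfolding set_lebesgue_integral_def
  using face_props(3)[OF assms(1)]
  by (intro integral_nonneg_AE) (auto simp: indicator_def assms(2) elim: eventually_mono)

lemma face_integral_zero:
  fixes f :: "pt \<Rightarrow> real"
  assumes "g \<in> int_faces M \<union> bd_faces M" "\<And>x. norm (normal M g x) = 1 \<Longrightarrow> f x = 0"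
  shows "(LINT x:g|length_measure. f x) = 0"
  unfolding set_lebesgue_integral_def
  using face_props(3)[OF assms(1)]
  by (intro integral_eq_zero_AE) (auto simp: indicator_def assms(2) elim: eventually_mono)

lemma diss_int_nonneg:
  assumes "dissipative S" "g \<in> int_faces M"
  shows "0 \<le> diss_int M S g u u"
  unfolding diss_int_def jump_def using assms
  by (intro face_integral_nonneg) (auto simp: dissipative_def)

lemma diss_bd_nonneg:
  assumes "wall_dissipative S" "g \<in> bd_faces M"
  shows "0 \<le> diss_bd M S g u u"
  unfolding diss_bd_def using assms
  by (intro face_integral_nonneg) (auto simp: wall_dissipative_def)

text \<open>Each summand pairs \<open>S n a b\<close> with \<open>a - b\<close>, the second one with
  the arguments exchanged, so positive semi-definiteness applies to both.\<close>

lemma Js_ij_nonneg: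
  assumes "dissipative S"
  shows "0 \<le> Js_ij M r E S i j u u"
proof -
  have S: "0 \<le> S n a b \<bullet> (a - b)" if "norm n = 1" for n a b
    using assms that by (auto simp: dissipative_def)
  show ?thesis
    unfolding Js_ij_def
    by (intro mult_nonneg_nonneg sum_nonneg face_integral_nonneg add_nonneg_nonneg S)
       (auto simp: faces_of_def int_faces_of_def bd_faces_of_def)
qed

lemma eta_le_1:
  assumes "c > 0" "dt > 0" "g \<in> faces_of M E"
  shows "eta M c r dt E \<le> 1"
proof -
  \<comment> \<open>One existing face makes the maximum in \<open>eta\<close> the length of a face,
    hence non-negative; over an empty set it would be unspecified.\<close>
  have "idx M E \<noteq> {}"
    using assms(3) finite_faces_of(3)[of E] by (auto simp: idx_def nfaces_def card_gt_0_iff Suc_le_eq)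
  then have "Max ((\<lambda>i. measure length_measure (face M E i)) ` idx M E) \<in> (\<lambda>i. measure length_measure (face M E i)) ` idx M E"
    by (intro Max_in) (auto simp: idx_def)
  then have "0 \<le> Max ((\<lambda>i. measure length_measure (face M E i)) ` idx M E)" by auto
  then show ?thesis using assms(1,2) by (simp add: eta_def)
qed

lemma small_cells_share_no_face:
  assumes "small_cells_admissible M \<alpha>" "E \<in> small_cells M \<alpha>" "E' \<in> small_cells M \<alpha>"
    "g \<in> int_faces M" "g \<subseteq> frontier E" "g \<subseteq> frontier E'"
  shows "E = E'"
proof (rule ccontr)
  assume "E \<noteq> E'"
  have cells: "E \<in> cells M" "E' \<in> cells M" using assms(2,3) small_cells_subset by auto
  then have "nbr M E g = E'"
    using int_face_subset_frontier[OF assms(4)] assms(5,6) \<open>E \<noteq> E'\<close> by (auto simp: nbr_def)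
  moreover have "nbr M E g \<notin> small_cells M \<alpha>"
    using assms by (auto simp: small_cells_admissible_def int_faces_of_def)
  ultimately show False using assms(3) by simp
qed

lemma Js_h_eq: "Js_h M c r dt \<alpha> S u u =
   (\<Sum>E\<in>small_cells M \<alpha>. eta M c r dt E * (\<Sum>(i, j)\<in>idx_pairs M E. Js_ij M r E S i j u u))
   - (\<Sum>E\<in>small_cells M \<alpha>. \<Sum>g | g \<in> int_faces M \<and> g \<subseteq> frontier E. eta M c r dt E * diss_int M S g u u)
   - (\<Sum>E\<in>small_cells M \<alpha>. \<Sum>g | g \<in> bd_faces M \<and> g \<subseteq> frontier E. eta M c r dt E * diss_bd M S g u u)"
  by (simp add: Js_h_def Js_E_def int_faces_of_def bd_faces_of_def sum_subtractf sum_distrib_left)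

lemma dissipation_nonneg:
  assumes "c > 0" "dt > 0" "small_cells_admissible M \<alpha>" "dissipative S" "wall_dissipative S"
    and eta: "\<forall>E\<in>small_cells M \<alpha>. 0 \<le> eta M c r dt E"
  shows "0 \<le> s_h M S u u + Js_h M c r dt \<alpha> S u u"
proof -
  have fin: "finite (small_cells M \<alpha>)" using finite_subset[OF small_cells_subset finite_cells] .
  have 1: "(\<Sum>E\<in>small_cells M \<alpha>. \<Sum>g | g \<in> int_faces M \<and> g \<subseteq> frontier E. eta M c r dt E * diss_int M S g u u)
      \<le> (\<Sum>g\<in>int_faces M. diss_int M S g u u)"
  proof (rule sum_dominated_by_disjoint[OF fin finite_faces(1)])
    show "eta M c r dt E \<le> 1" if "g \<in> int_faces M" "g \<subseteq> frontier E" for E g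
      using that by (intro eta_le_1[OF assms(1,2), of g]) (auto simp: faces_of_def int_faces_of_def)
  qed (use diss_int_nonneg[OF assms(4)] small_cells_share_no_face[OF assms(3)] in blast)+
  have 2: "(\<Sum>E\<in>small_cells M \<alpha>. \<Sum>g | g \<in> bd_faces M \<and> g \<subseteq> frontier E. eta M c r dt E * diss_bd M S g u u)
      \<le> (\<Sum>g\<in>bd_faces M. diss_bd M S g u u)"
  proof (rule sum_dominated_by_disjoint[OF fin finite_faces(2)])
    show "eta M c r dt E \<le> 1" if "g \<in> bd_faces M" "g \<subseteq> frontier E" for E g
      using that by (intro eta_le_1[OF assms(1,2), of g]) (auto simp: faces_of_def bd_faces_of_def)
  qed (use diss_bd_nonneg[OF assms(5)] bd_cell_unique small_cells_subset in blast)+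
  \<comment> \<open>The added jump terms carry the factor \<open>eta\<close> itself, so here its
    sign matters; the subtracted terms were bounded through \<open>eta_le_1\<close>.\<close>
  have "0 \<le> (\<Sum>E\<in>small_cells M \<alpha>. eta M c r dt E * (\<Sum>(i, j)\<in>idx_pairs M E. Js_ij M r E S i j u u))"
    using eta by (intro sum_nonneg mult_nonneg_nonneg) (auto intro: Js_ij_nonneg[OF assms(4)])
  then show ?thesis using 1 2 unfolding Js_h_eq s_h_def by linarith
qed

lemma dissipation_zero:
  assumes "\<forall>n a b. norm n = 1 \<longrightarrow> S n a b = 0"
  shows "s_h M S u u + Js_h M c r dt \<alpha> S u u = 0"
proof -
  have int: "diss_int M S g u u = 0" if "g \<in> int_faces M" for g
    unfolding diss_int_def using assms that by (intro face_integral_zero) auto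
  have bd: "diss_bd M S g u u = 0" if "g \<in> bd_faces M" for g
    unfolding diss_bd_def using assms that by (intro face_integral_zero) auto
  have Js: "Js_ij M r E S i j u u = 0" for E i j
    unfolding Js_ij_def
    by (intro mult_eq_0_iff[THEN iffD2] disjI2 sum.neutral ballI face_integral_zero)
       (auto simp: faces_of_def int_faces_of_def bd_faces_of_def assms)
  show ?thesis by (simp add: Js_h_eq s_h_def int bd Js)
qed

lemma J_a_diag:
  assumes "small_cells_admissible M \<alpha>" "u \<in> V_space M r"
    "\<And>E. E \<in> small_cells M \<alpha> \<Longrightarrow> propagation_forms M c r E (p E) (pV E) (pVs E)"
    "\<And>E. E \<in> small_cells M \<alpha> \<Longrightarrow> energy_preserving M c r E (p E)"
    "\<And>E. E \<in> small_cells M \<alpha> \<Longrightarrow> reflecting M r E (p E)"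
  shows "Ja_h M c r dt \<alpha> p pV pVs u u = 0"
  unfolding Ja_h_def
proof (rule sum.neutral, rule ballI)
  fix E assume E: "E \<in> small_cells M \<alpha>"
  interpret small_cell M c \<alpha> r E "p E" "pV E" "pVs E" u
    by unfold_locales (use assms E in auto)
  show "J0_E M c r dt E (p E) u u + J1_E M c r dt E (pV E) (pVs E) u u = 0"
    by (rule J_a_cell_diag)
qed

end

section \<open>The energy as a function of time\<close>

lemma sorted_list_bracket:
  fixes xs :: "real list"
  assumes "xs \<noteq> []" "hd xs \<le> z" "z \<le> last xs" "z \<notin> set xs"
  obtains i where "Suc i < length xs" "xs ! i < z" "z < xs ! Suc i"
proof -
  define k where "k = (LEAST k. k < length xs \<and> z \<le> xs ! k)"
  have "length xs - 1 < length xs \<and> z \<le> xs ! (length xs - 1)"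
    using assms by (simp add: last_conv_nth)
  then have k: "k < length xs \<and> z \<le> xs ! k" unfolding k_def by (rule LeastI)
  have ne: "z \<noteq> xs ! i" if "i < length xs" for i using assms(4) that by (auto simp: in_set_conv_nth)
  have "k \<noteq> 0"
  proof
    assume "k = 0"
    then show False using k ne[of 0] assms(1,2) by (simp add: hd_conv_nth)
  qed
  then obtain i where i: "k = Suc i" by (cases k) auto
  have "\<not> (i < length xs \<and> z \<le> xs ! i)" using not_less_Least[of i "\<lambda>k. k < length xs \<and> z \<le> xs ! k"] i by (simp add: k_def)
  then show thesis using k i ne[of k] by (intro that[of i]) auto
qed

lemma continuous_set_integrable:
  fixes f :: "pt \<Rightarrow> real"
  assumes "continuous_on UNIV f" "open E" "bounded E"
  shows "set_integrable lebesgue E f"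
proof -
  obtain a b where ab: "E \<subseteq> cbox a b" using bounded_subset_cbox_symmetric[OF assms(3)] by blast
  have "f absolutely_integrable_on cbox a b"
    by (rule absolutely_integrable_continuous) (rule continuous_on_subset[OF assms(1)], simp)
  then show ?thesis using open_in_sets_lebesgue[OF assms(2)] ab by (rule set_integrable_subset)
qed

lemma has_vector_derivative_inner:
  assumes "(f has_vector_derivative f') (at x within A)" "(g has_vector_derivative g') (at x within A)"
  shows "((\<lambda>x. f x \<bullet> g x) has_vector_derivative (f x \<bullet> g' + f' \<bullet> g x)) (at x within A)"
  using bounded_bilinear.has_vector_derivative[OF bounded_bilinear_inner assms] .

section \<open>From cells to the whole domain, and differentiation in time\<close>

context cut_mesh
begin

text \<open>Cells are open, so the points they miss lie on the finitely many grid lines.\<close>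

lemma negligible_Omega_minus_cells: "negligible (Omega M - \<Union>(cells M))"
proof (rule negligible_subset)
  let ?N = "(\<Union>a\<in>set (xgrid M). {x :: pt. axis 1 1 \<bullet> x = a}) \<union> (\<Union>a\<in>set (ygrid M). {x :: pt. axis 2 1 \<bullet> x = a})"
  show "negligible ?N"
    by (intro negligible_Un negligible_Union) (auto intro!: negligible_hyperplane simp: axis_eq_0_iff)
  show "Omega M - \<Union>(cells M) \<subseteq> ?N"
  proof
    fix x assume x: "x \<in> Omega M - \<Union>(cells M)"
    show "x \<in> ?N"
    proof (rule ccontr)
      assume "x \<notin> ?N"
      then have nin: "x$1 \<notin> set (xgrid M)" "x$2 \<notin> set (ygrid M)" by (auto simp: inner_axis')
      have "hd (xgrid M) \<le> x$1" "x$1 \<le> last (xgrid M)" "hd (ygrid M) \<le> x$2" "x$2 \<le> last (ygrid M)"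
        using grid(4) x by (auto simp: mem_box_cart forall_2 subset_iff)
      moreover have "xgrid M \<noteq> []" "ygrid M \<noteq> []" using grid(5,6) by auto
      ultimately obtain i j where "Suc i < length (xgrid M)" "xgrid M ! i < x$1" "x$1 < xgrid M ! Suc i"
          "Suc j < length (ygrid M)" "ygrid M ! j < x$2" "x$2 < ygrid M ! Suc j"
        using sorted_list_bracket nin by metis
      then have "gbox i j \<in> bg_cells M" "x \<in> gbox i j" by (auto simp: bg_cells_def gbox_def mem_gbox[unfolded gbox_def])
      then have "gbox i j \<inter> Omega M \<in> cells M" "x \<in> gbox i j \<inter> Omega M" using x by (auto simp: cells_def)
      then show False using x by blast
    qed
  qed
qed

lemma integral_Omega:
  fixes f :: "pt \<Rightarrow> real"
  assumes "\<And>E. E \<in> cells M \<Longrightarrow> set_integrable lebesgue E f"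
  shows "(LINT x:Omega M|lebesgue. f x) = (\<Sum>E\<in>cells M. LINT x:E|lebesgue. f x)"
proof -
  let ?U = "\<Union>(cells M)"
  have sets: "E \<in> sets lebesgue" if "E \<in> cells M" for E
    using open_in_sets_lebesgue[OF cell_open[OF that]] .
  have U: "set_integrable lebesgue ?U f"
    using set_integrable_UN[of "cells M" lebesgue "\<lambda>E. E" f] finite_cells assms sets by simp
  have diff: "negligible {x \<in> ?U - Omega M. f x \<noteq> 0}" "negligible {x \<in> Omega M - ?U. f x \<noteq> 0}"
    by (rule negligible_subset[OF negligible_empty], use cell_subset in blast)
       (rule negligible_subset[OF negligible_Omega_minus_cells], blast)
  \<comment> \<open>The null set is discarded on the side of the gauge integral, to which the
    Lebesgue integrals are converted and back.\<close>
  then have "f absolutely_integrable_on Omega M"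
    using U absolutely_integrable_spike_set_eq[of ?U "Omega M" f] by blast
  then have "(LINT x:Omega M|lebesgue. f x) = integral (Omega M) f"
    by (rule set_lebesgue_integral_eq_integral(2))
  also have "\<dots> = integral ?U f" using diff by (intro integral_spike_set) auto
  also have "\<dots> = (LINT x:?U|lebesgue. f x)" using set_lebesgue_integral_eq_integral(2)[OF U] by simp
  also have "\<dots> = (\<Sum>E\<in>cells M. LINT x:E|lebesgue. f x)"
    using set_integral_finite_Union[of "cells M" "\<lambda>E. E" lebesgue f] finite_cells assms sets cells_disjoint
    by (auto simp: disjoint_family_on_def)
  finally show ?thesis .
qed

text \<open>On a cell, interpolation at points of the cell expresses the solution and its time derivative through
  finitely many point values, so the energy is a quadratic form in differentiable functions of time.\<close>

lemma cell_energy_derivative: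
  fixes u du :: "real \<Rightarrow> field"
  assumes E: "E \<in> cells M" and u: "\<And>t. 0 \<le> t \<Longrightarrow> u t \<in> V_space M r"
    and du: "\<And>t x. 0 \<le> t \<Longrightarrow> x \<in> E \<Longrightarrow> ((\<lambda>s. u s x) has_vector_derivative du t x) (at t within {0..})"
    and t: "0 \<le> t"
  shows "set_integrable lebesgue E (\<lambda>x. (norm (u t x))\<^sup>2)"
    and "set_integrable lebesgue E (\<lambda>x. du t x \<bullet> u t x)"
    and "((\<lambda>s. LINT x:E|lebesgue. (norm (u s x))\<^sup>2) has_vector_derivative
      2 * (LINT x:E|lebesgue. du t x \<bullet> u t x)) (at t within {0..})"
proof -
  obtain J :: "(nat \<times> nat) set" and P :: "nat \<times> nat \<Rightarrow> pt" and \<phi> :: "nat \<times> nat \<Rightarrow> pt \<Rightarrow> real" where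
    J: "finite J" "\<And>k. k \<in> J \<Longrightarrow> P k \<in> E" "\<And>k. continuous_on UNIV (\<phi> k)"
    "\<And>q x. q \<in> poly3 r \<Longrightarrow> q x = (\<Sum>k\<in>J. \<phi> k x *\<^sub>R q (P k))"
    by (rule poly3_interpolation[OF cell_open[OF E] cell_nonempty[OF E], where r = r]) (rule that)
  have ux: "u s x = (\<Sum>k\<in>J. \<phi> k x *\<^sub>R u s (P k))" if "0 \<le> s" "x \<in> E" for s x
    using J(4)[OF ext_poly(1)[OF u[OF that(1)] E], of x] ext_poly(2)[OF u[OF that(1)] E] that(2) J(2) by simp
  \<comment> \<open>\<open>du\<close> is known only as a pointwise derivative; uniqueness of
    derivatives transfers the interpolation formula to it.\<close>
  have dux: "du t x = (\<Sum>k\<in>J. \<phi> k x *\<^sub>R du t (P k))" if "x \<in> E" for x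
  proof (rule vector_derivative_unique_within)
    \<comment> \<open>This includes t = 0, where the derivative is one-sided.\<close>
    show "at t within {0..} \<noteq> bot"
    proof
      assume "at t within {0..} = bot"
      moreover have "at_right t \<le> at t within {0..}" using t by (intro at_le) auto
      ultimately show False using trivial_limit_at_right_real[of t] by (simp add: bot.extremum_unique)
    qed
    show "((\<lambda>s. u s x) has_vector_derivative du t x) (at t within {0..})" by (rule du[OF t that])
    have "((\<lambda>s. \<Sum>k\<in>J. \<phi> k x *\<^sub>R u s (P k)) has_vector_derivative (\<Sum>k\<in>J. \<phi> k x *\<^sub>R du t (P k))) (at t within {0..})"
      by (intro has_vector_derivative_sum bounded_linear.has_vector_derivative[OF bounded_linear_scaleR_right] du t J)
    then show "((\<lambda>s. u s x) has_vector_derivative (\<Sum>k\<in>J. \<phi> k x *\<^sub>R du t (P k))) (at t within {0..})"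
      by (rule has_vector_derivative_transform[rotated 2]) (use t ux that in auto)
  qed
  define m where "m k l = (LINT x:E|lebesgue. \<phi> k x * \<phi> l x)" for k l
  have int: "set_integrable lebesgue E (\<lambda>x. \<phi> k x * \<phi> l x)" for k l
    by (intro continuous_set_integrable continuous_intros J cell_open[OF E] cell_bounded[OF E])
  \<comment> \<open>With the mass matrix \<open>m\<close> of the interpolation weights, one formula
    covers both the energy density and its rate of change.\<close>
  have quad: "set_integrable lebesgue E f" "(LINT x:E|lebesgue. f x) = (\<Sum>k\<in>J. \<Sum>l\<in>J. m k l * (a k \<bullet> b l))"
    if f: "\<And>x. x \<in> E \<Longrightarrow> f x = (\<Sum>k\<in>J. \<phi> k x *\<^sub>R a k) \<bullet> (\<Sum>l\<in>J. \<phi> l x *\<^sub>R b l)" for f and a b :: "nat \<times> nat \<Rightarrow> st"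
  proof -
    have f': "f x = (\<Sum>k\<in>J. \<Sum>l\<in>J. (\<phi> k x * \<phi> l x) * (a k \<bullet> b l))" if "x \<in> E" for x
      unfolding f[OF that] by (subst inner_sum_left, intro sum.cong refl)
       (simp add: inner_sum_right ac_simps)
    have i: "integrable lebesgue (\<lambda>x. (\<Sum>k\<in>J. \<Sum>l\<in>J. (indicator E x *\<^sub>R (\<phi> k x * \<phi> l x)) * (a k \<bullet> b l)))"
      using int unfolding set_integrable_def by (intro Bochner_Integration.integrable_sum integrable_mult_left)
    have e: "(\<lambda>x. indicator E x *\<^sub>R f x) = (\<lambda>x. (\<Sum>k\<in>J. \<Sum>l\<in>J. (indicator E x *\<^sub>R (\<phi> k x * \<phi> l x)) * (a k \<bullet> b l)))"
      by (auto simp: fun_eq_iff indicator_def f')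
    show "set_integrable lebesgue E f" unfolding set_integrable_def e by (rule i)
    show "(LINT x:E|lebesgue. f x) = (\<Sum>k\<in>J. \<Sum>l\<in>J. m k l * (a k \<bullet> b l))"
      unfolding set_lebesgue_integral_def e m_def using int unfolding set_integrable_def
      by (subst Bochner_Integration.integral_sum; simp)+
  qed
  have N: "(norm (u s x))\<^sup>2 = (\<Sum>k\<in>J. \<phi> k x *\<^sub>R u s (P k)) \<bullet> (\<Sum>l\<in>J. \<phi> l x *\<^sub>R u s (P l))" if "0 \<le> s" "x \<in> E" for s x
    using ux[OF that] by (simp add: power2_norm_eq_inner)
  have Dt: "du t x \<bullet> u t x = (\<Sum>k\<in>J. \<phi> k x *\<^sub>R du t (P k)) \<bullet> (\<Sum>l\<in>J. \<phi> l x *\<^sub>R u t (P l))" if "x \<in> E" for x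
    using ux[OF t that] dux[OF that] by simp
  show "set_integrable lebesgue E (\<lambda>x. (norm (u t x))\<^sup>2)" by (rule quad(1)[OF N[OF t]])
  show "set_integrable lebesgue E (\<lambda>x. du t x \<bullet> u t x)" by (rule quad(1)[OF Dt])
  have msym: "m k l = m l k" for k l by (simp add: m_def mult.commute)
  have "(\<Sum>k\<in>J. \<Sum>l\<in>J. m k l * (u t (P k) \<bullet> du t (P l) + du t (P k) \<bullet> u t (P l))) =
      (\<Sum>k\<in>J. \<Sum>l\<in>J. m k l * (u t (P k) \<bullet> du t (P l))) + (\<Sum>k\<in>J. \<Sum>l\<in>J. m k l * (du t (P k) \<bullet> u t (P l)))"
    by (simp add: distrib_left sum.distrib)
  \<comment> \<open>Symmetry of the mass matrix merges the two halves of the product rule into the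
    factor 2.\<close>
  also have "(\<Sum>k\<in>J. \<Sum>l\<in>J. m k l * (u t (P k) \<bullet> du t (P l))) = (\<Sum>k\<in>J. \<Sum>l\<in>J. m k l * (du t (P k) \<bullet> u t (P l)))"
    by (subst sum.swap) (simp add: msym inner_commute)
  finally have D: "(\<Sum>k\<in>J. \<Sum>l\<in>J. m k l * (u t (P k) \<bullet> du t (P l) + du t (P k) \<bullet> u t (P l))) =
      2 * (LINT x:E|lebesgue. du t x \<bullet> u t x)"
    by (simp add: quad(2)[OF Dt])
  have "((\<lambda>s. \<Sum>k\<in>J. \<Sum>l\<in>J. m k l * (u s (P k) \<bullet> u s (P l))) has_vector_derivative
      (\<Sum>k\<in>J. \<Sum>l\<in>J. m k l * (u t (P k) \<bullet> du t (P l) + du t (P k) \<bullet> u t (P l)))) (at t within {0..})"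
    by (intro has_vector_derivative_sum has_vector_derivative_mult_right has_vector_derivative_inner du t J)
  then show "((\<lambda>s. LINT x:E|lebesgue. (norm (u s x))\<^sup>2) has_vector_derivative
      2 * (LINT x:E|lebesgue. du t x \<bullet> u t x)) (at t within {0..})"
    unfolding D
    by (rule has_vector_derivative_transform[rotated 2]) (use t quad(2)[OF N] in auto)
qed

lemma L2norm_derivative:
  fixes u du :: "real \<Rightarrow> field"
  assumes u: "\<And>t. 0 \<le> t \<Longrightarrow> u t \<in> V_space M r"
    and du: "\<And>t E x. 0 \<le> t \<Longrightarrow> E \<in> cells M \<Longrightarrow> x \<in> E \<Longrightarrow>
      ((\<lambda>s. u s x) has_vector_derivative du t x) (at t within {0..})"
    and t: "0 \<le> t"
  shows "((\<lambda>s. 1/2 * (L2norm (Omega M) (u s))\<^sup>2) has_vector_derivative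
    (LINT x:Omega M|lebesgue. du t x \<bullet> u t x)) (at t within {0..})"
proof -
  have L2: "1/2 * (L2norm (Omega M) (u s))\<^sup>2 = 1/2 * (\<Sum>E\<in>cells M. LINT x:E|lebesgue. (norm (u s x))\<^sup>2)"
    if "0 \<le> s" for s
  proof -
    have "0 \<le> (LINT x:Omega M|lebesgue. (norm (u s x))\<^sup>2)"
      unfolding set_lebesgue_integral_def by (intro integral_nonneg_AE) simp
    then have "(L2norm (Omega M) (u s))\<^sup>2 = (LINT x:Omega M|lebesgue. (norm (u s x))\<^sup>2)"
      by (simp add: L2norm_def)
    also have "\<dots> = (\<Sum>E\<in>cells M. LINT x:E|lebesgue. (norm (u s x))\<^sup>2)"
      by (intro integral_Omega cell_energy_derivative(1)[OF _ u du that])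
    finally show ?thesis by simp
  qed
  have "((\<lambda>s. 1/2 * (\<Sum>E\<in>cells M. LINT x:E|lebesgue. (norm (u s x))\<^sup>2)) has_vector_derivative
      1/2 * (\<Sum>E\<in>cells M. 2 * (LINT x:E|lebesgue. du t x \<bullet> u t x))) (at t within {0..})"
    by (intro has_vector_derivative_mult_right has_vector_derivative_sum cell_energy_derivative(3)[OF _ u du t])
  also have "1/2 * (\<Sum>E\<in>cells M. 2 * (LINT x:E|lebesgue. du t x \<bullet> u t x)) = (LINT x:Omega M|lebesgue. du t x \<bullet> u t x)"
    unfolding sum_distrib_left[symmetric]
    by (subst integral_Omega[OF cell_energy_derivative(2)[OF _ u du t]]) auto
  finally show ?thesis
    by (rule has_vector_derivative_transform[rotated 2]) (use t L2 in auto)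
qed

end

text \<open>For a small cell with faces, the sign condition on \<open>eta\<close> says that
  \<open>dt\<close> is at least |E| / ((2r+1) c max|gamma_i|). For a smaller time step the jump
  terms of J^s would enter with negative weight. The equality case follows from the vanishing of all
  forms on the diagonal, for any \<open>eta\<close>.\<close>

theorem theorem1:
  fixes M :: cut_mesh
    and c dt \<alpha> T :: real
    and r :: nat
    and S :: "pt \<Rightarrow> st \<Rightarrow> st \<Rightarrow> st"
    and p :: "pt set \<Rightarrow> nat \<Rightarrow> nat \<Rightarrow> form3"
    and pV pVs :: "pt set \<Rightarrow> form3"
    and u du :: "real \<Rightarrow> field"
  assumes "c > 0" and "dt > 0" and "0 < \<alpha>" and "\<alpha> < 1"
    and "cut_cell_mesh M"
    and "small_cells_admissible M \<alpha>"
    and "dissipative S" and "wall_dissipative S"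
    and "\<And>E. E \<in> small_cells M \<alpha> \<Longrightarrow> propagation_forms M c r E (p E) (pV E) (pVs E)"
    and "\<And>E. E \<in> small_cells M \<alpha> \<Longrightarrow> energy_preserving M c r E (p E)"
    and "\<And>E. E \<in> small_cells M \<alpha> \<Longrightarrow> reflecting M r E (p E)"
    and "\<And>t. 0 \<le> t \<Longrightarrow> u t \<in> V_space M r"
    and "\<And>t E x. 0 \<le> t \<Longrightarrow> E \<in> cells M \<Longrightarrow> x \<in> E \<Longrightarrow>
           ((\<lambda>s. u s x) has_vector_derivative du t x) (at t within {0..})"
    and "\<And>t w. 0 \<le> t \<Longrightarrow> w \<in> V_space M r \<Longrightarrow>
           (LINT x:Omega M|lebesgue. du t x \<bullet> w x)
           + a_h M c (u t) w + Ja_h M c r dt \<alpha> p pV pVs (u t) w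
           + s_h M S (u t) w + Js_h M c r dt \<alpha> S (u t) w = 0"
    and "T > 0"
  shows "((\<forall>E \<in> small_cells M \<alpha>. 0 \<le> eta M c r dt E) \<longrightarrow>
           1/2 * (L2norm (Omega M) (u T))\<^sup>2 \<le> 1/2 * (L2norm (Omega M) (u 0))\<^sup>2)
       \<and> ((\<forall>n a b. norm n = 1 \<longrightarrow> S n a b = 0) \<longrightarrow>
           1/2 * (L2norm (Omega M) (u T))\<^sup>2 = 1/2 * (L2norm (Omega M) (u 0))\<^sup>2)"
proof -
  interpret cut_mesh M by unfold_locales (rule assms(5))
  let ?D = "\<lambda>t. LINT x:Omega M|lebesgue. du t x \<bullet> u t x"
  have D: "?D t = - (s_h M S (u t) (u t) + Js_h M c r dt \<alpha> S (u t) (u t))" if "0 \<le> t" for t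
    using assms(14)[OF that assms(12)[OF that]] a_h_diag[OF assms(12)[OF that], of c]
      J_a_diag[OF assms(6) assms(12)[OF that] assms(9-11), where dt = dt] by linarith
  have deriv: "((\<lambda>s. 1/2 * (L2norm (Omega M) (u s))\<^sup>2) has_vector_derivative ?D t) (at t within {0..})" if "0 \<le> t" for t
    by (rule L2norm_derivative[OF assms(12,13) that])
  \<comment> \<open>The mean value theorem needs the rate only at a single time, so no integrability
    of the rate in time enters.\<close>
  have "\<exists>t\<in>{0..T}. 1/2 * (L2norm (Omega M) (u T))\<^sup>2 - 1/2 * (L2norm (Omega M) (u 0))\<^sup>2 = (T - 0) *\<^sub>R ?D t"
  proof (rule mvt_very_simple)
    show "((\<lambda>s. 1/2 * (L2norm (Omega M) (u s))\<^sup>2) has_derivative (\<lambda>h. h *\<^sub>R ?D t)) (at t within {0..T})"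
      if "0 \<le> t" "t \<le> T" for t
      using has_vector_derivative_within_subset[OF deriv[OF that(1)], of "{0..T}"]
      by (auto simp: has_vector_derivative_def)
  qed (use assms(15) in simp)
  then obtain t where t: "0 \<le> t"
    "1/2 * (L2norm (Omega M) (u T))\<^sup>2 - 1/2 * (L2norm (Omega M) (u 0))\<^sup>2 = T * ?D t"
    by auto
  show ?thesis
  proof (intro conjI impI)
    assume "\<forall>E\<in>small_cells M \<alpha>. 0 \<le> eta M c r dt E"
    from dissipation_nonneg[OF assms(1,2,6-8) this, of "u t"] have "?D t \<le> 0" using D[OF t(1)] by simp
    then have "T * ?D t \<le> 0" using assms(15) by (simp add: mult_nonneg_nonpos)
    then show "1/2 * (L2norm (Omega M) (u T))\<^sup>2 \<le> 1/2 * (L2norm (Omega M) (u 0))\<^sup>2" using t(2) by simp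
  next
    assume "\<forall>n a b. norm n = 1 \<longrightarrow> S n a b = 0"
    from dissipation_zero[OF this, of "u t" c r dt \<alpha>] have "?D t = 0" using D[OF t(1)] by simp
    then show "1/2 * (L2norm (Omega M) (u T))\<^sup>2 = 1/2 * (L2norm (Omega M) (u 0))\<^sup>2" using t(2) by simp
  qed
qed

end
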